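(* Let $F\in\mathcal S(]-\infty,0],\mathbb C)$ and let $N\ge 1$ be an integer. For every real $t<0$, $$\sum_{n=1}^{+\infty}d_nF(nt)=-\frac1t\int_0^{+\infty}F(-u)\Bigl(\ln\Bigl(\frac{u}{-t}\Bigr)+2\gamma\Bigr)du+\frac{F(0)}{4}+\sum_{n=1}^{N}\frac{\zeta(-2n+1)^2}{(2n-1)!}\,t^{2n-1}F^{(2n-1)}(0)+\frac{1}{2i\pi}\int_{\Re(s)=2N}\Gamma(-s)\,\zeta(-s)^2\,F^{(s)}(0)\,(-t)^s\,ds .$$
   Context: $d_n$ is the number of positive divisors of $n$; $\gamma$ is Euler's constant; $\zeta$ is the Riemann zeta function. $\mathcal S(]-\infty,0],\mathbb C)$ is the space of functions $F\in C^\infty(]-\infty,0],\mathbb C)$ (one-sided derivatives at $0$) such that $\lim_{t\to-\infty}|t|^mF^{(n)}(t)=0$ for all integers $n,m\ge 0$. For such $F$, define $F^{(s)}(0)=\frac{1}{\Gamma(-s)}\int_0^{+\infty}u^{-s-1}F(-u)\,du$ for $\Re(s)<0$; this function of $s$ extends to an entire function, still denoted $s\mapsto F^{(s)}(0)$, which at $s=n\in\mathbb N$ equals the usual $n$-th derivative. The integral over $\Re(s)=c$ is along the upward oriented vertical line; the integrand has a removable singularity at $s=2N$ and is extended there by continuity. $(-t)^s=e^{s\ln(-t)}$. *)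

theory Defs
  imports "HOL-Complex_Analysis.Complex_Analysis"
begin

text \<open>A function on \<open>]-\<infinity>,0]\<close> is represented by a total function on the reals, of which only the
  values on \<open>{..0}\<close> matter; derivatives are taken within \<open>{..0}\<close>, hence are one-sided at \<open>0\<close>.\<close>

fun nderiv_neg :: "nat \<Rightarrow> (real \<Rightarrow> complex) \<Rightarrow> real \<Rightarrow> complex" where
  "nderiv_neg 0 F = F"
| "nderiv_neg (Suc n) F = (\<lambda>t. vector_derivative (nderiv_neg n F) (at t within {..0}))"

definition schwartz_neg :: "(real \<Rightarrow> complex) set" where
  "schwartz_neg = {F.
     (\<forall>n. \<forall>t\<le>0. nderiv_neg n F differentiable (at t within {..0})) \<and>
     (\<forall>n m. ((\<lambda>t. complex_of_real (\<bar>t\<bar> ^ m) * nderiv_neg n F t) \<longlongrightarrow> 0) at_bot)}"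

text \<open>\<open>cderiv0 F s\<close> is \<open>F^(s)(0)\<close>. The entire extension is unique by the identity theorem.\<close>

definition cderiv0 :: "(real \<Rightarrow> complex) \<Rightarrow> complex \<Rightarrow> complex" where
  "cderiv0 F = (THE G. G holomorphic_on UNIV \<and>
     (\<forall>s. Re s < 0 \<longrightarrow>
        G s = 1 / Gamma (- s) * (LBINT u:{0<..}. complex_of_real u powr (- s - 1) * F (- u))))"

text \<open>The Riemann zeta function as the analytic continuation of its Dirichlet series. The value
  at the pole is a dummy value that makes the description unique.\<close>

definition riemann_zeta :: "complex \<Rightarrow> complex" where
  "riemann_zeta = (THE Z. Z holomorphic_on (- {1}) \<and>
     (\<forall>s. Re s > 1 \<longrightarrow> (\<lambda>n. 1 / of_nat (Suc n) powr s) sums Z s) \<and> Z 1 = 0)"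

definition divisor_count :: "nat \<Rightarrow> nat" where
  "divisor_count n = card {d. d dvd n}"

text \<open>Integration along the upward oriented line \<open>Re s = c\<close>, parametrised by \<open>s = c + i y\<close>.\<close>

definition vline_integrable :: "real \<Rightarrow> (complex \<Rightarrow> complex) \<Rightarrow> bool" where
  "vline_integrable c g \<longleftrightarrow> integrable lborel (\<lambda>y. g (Complex c y))"

definition vline_integral :: "real \<Rightarrow> (complex \<Rightarrow> complex) \<Rightarrow> complex" where
  "vline_integral c g = \<i> * (LBINT y. g (Complex c y))"

text \<open>At \<open>s = 2N\<close> (\<open>N \<ge> 1\<close>) the library convention \<open>Gamma (- 2N) = 0\<close> gives this function the value
  \<open>0\<close>. This is its continuous extension there: the simple pole of the Gamma factor meets a double
  zero of the squared zeta factor.\<close>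

definition remainder_integrand :: "(real \<Rightarrow> complex) \<Rightarrow> real \<Rightarrow> complex \<Rightarrow> complex" where
  "remainder_integrand F t s =
     Gamma (- s) * riemann_zeta (- s) ^ 2 * cderiv0 F s * complex_of_real (- t) powr s"

end

theory Submission
  imports Defs "HOL-Probability.Sinc_Integral"
begin

text \<open>Let \<open>M(w)\<close> be the Mellin transform of \<open>u \<mapsto> F(-u)\<close>, so that \<open>\<Gamma>(-s) F\<^sup>(\<^sup>s\<^sup>)(0) = M(-s)\<close>. Since
  \<open>\<zeta>(w)\<^sup>2 = \<Sum> d\<^sub>n n\<^sup>-\<^sup>w\<close> for \<open>Re w > 1\<close>, Mellin inversion turns the divisor sum into the integral of
  \<open>\<Gamma>(-s) \<zeta>(-s)\<^sup>2 F\<^sup>(\<^sup>s\<^sup>)(0) (-t)\<^sup>s\<close> over \<open>Re s = -2\<close>. Repeated integration by parts makes \<open>M\<close> decay faster than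
  any power on vertical lines, while \<open>\<zeta>\<close> grows polynomially, so the line may be moved to \<open>Re s = 2N\<close>.
  The double pole at \<open>s = -1\<close> gives the logarithmic integral, the poles of \<open>\<Gamma>(-s)\<close> at
  \<open>0, ..., 2N - 1\<close> give the derivatives of \<open>F\<close>, and the trivial zeros remove those at even \<open>s > 0\<close>.\<close>

section \<open>Mellin transforms of rapidly decreasing functions\<close>

text \<open>Both \<open>cderiv0\<close> and \<open>riemann_zeta\<close> are definite descriptions,
  so each function has to be constructed and shown unique before anything can be computed.
  \<open>cderiv0\<close> is glued from the products
  \<open>rGamma (k - s) * mellin g (k - s)\<close>, where \<open>g\<close> is the reflected k-th
  derivative of \<open>F\<close>; such a product lives on Re s < k, and raising \<open>k\<close>
  widens the domain and also buys decay. For zeta a single recursion, summed from Taylor expansions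
  about the positive integers, supplies the continuation, the polynomial growth, the value at 0, the
  trivial zeros and the constant \<gamma> in the expansion at 1. Mellin inversion meets a double
  integral that is not absolutely convergent over all heights; it is truncated at height T, and
  boundedness of the sine integral replaces absolute convergence as T grows. Origin of the
  constants: 1/4 is the square of the value -1/2 of zeta at 0, and 2 \<gamma> is the derivative at 1
  of the square of (s - 1) zeta(s). At s = n the residue -(-1)^n / n! of Gamma(-s) meets (-t)^n, so
  only -t^n / n! remains, and its sign flips when the residues are moved to the other side.\<close>

lemma has_field_derivative_lebesgue_integral:
  fixes g :: "complex \<Rightarrow> 'a \<Rightarrow> complex"
  assumes r: "0 < r"
    and int: "\<And>s. s \<in> ball s0 r \<Longrightarrow> integrable M (g s)"
    and meas: "g' s0 \<in> borel_measurable M"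
    and der: "\<And>s u. s \<in> ball s0 r \<Longrightarrow> ((\<lambda>s. g s u) has_field_derivative g' s u) (at s)"
    and bnd: "\<And>s u. s \<in> ball s0 r \<Longrightarrow> norm (g' s u) \<le> D u"
    and D: "integrable M D"
  shows "((\<lambda>s. \<integral>u. g s u \<partial>M) has_field_derivative (\<integral>u. g' s0 u \<partial>M)) (at s0)"
proof -
  have s0: "s0 \<in> ball s0 r" using r by simp
  have "((\<lambda>y. ((\<integral>u. g y u \<partial>M) - (\<integral>u. g s0 u \<partial>M)) / (y - s0)) \<longlongrightarrow> (\<integral>u. g' s0 u \<partial>M))
          (at s0 within ball s0 r)"
    unfolding tendsto_at_iff_sequentially
  proof (intro allI impI)
    fix X assume X: "\<forall>i. X i \<in> ball s0 r - {s0}" and lim: "X \<longlonglongrightarrow> s0"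
    have "(\<lambda>i. \<integral>u. (g (X i) u - g s0 u) / (X i - s0) \<partial>M) \<longlonglongrightarrow> (\<integral>u. g' s0 u \<partial>M)"
    proof (rule integral_dominated_convergence[OF meas _ D])
      fix i
      show "(\<lambda>u. (g (X i) u - g s0 u) / (X i - s0)) \<in> borel_measurable M"
        using int[of "X i"] int[OF s0] X by (intro borel_measurable_divide borel_measurable_diff) auto
      show "AE u in M. norm ((g (X i) u - g s0 u) / (X i - s0)) \<le> D u"
      proof (rule AE_I2)
        fix u
        \<comment> \<open>The mean value inequality on the convex ball: a bound on the derivative
          bounds every difference quotient, so \<open>D\<close> dominates the whole
          sequence.\<close>
        have "norm (g (X i) u - g s0 u) \<le> D u * norm (X i - s0)"
          by (rule field_differentiable_bound[of "ball s0 r" "\<lambda>s. g s u" "\<lambda>s. g' s u"])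
             (use X s0 bnd der in \<open>auto intro: has_field_derivative_at_within\<close>)
        then show "norm ((g (X i) u - g s0 u) / (X i - s0)) \<le> D u"
          using X[rule_format, of i] by (simp add: norm_divide divide_le_eq)
      qed
    next
      show "AE u in M. (\<lambda>i. (g (X i) u - g s0 u) / (X i - s0)) \<longlonglongrightarrow> g' s0 u"
      proof (rule AE_I2)
        fix u
        have "((\<lambda>y. (g y u - g s0 u) / (y - s0)) \<longlongrightarrow> g' s0 u) (at s0)"
          using der[OF s0, of u] by (simp add: has_field_derivative_iff)
        then have "\<forall>X. (\<forall>i. X i \<in> UNIV - {s0}) \<longrightarrow> X \<longlonglongrightarrow> s0 \<longrightarrow>
            ((\<lambda>y. (g y u - g s0 u) / (y - s0)) \<circ> X) \<longlonglongrightarrow> g' s0 u"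
          by (simp add: tendsto_at_iff_sequentially)
        then show "(\<lambda>i. (g (X i) u - g s0 u) / (X i - s0)) \<longlonglongrightarrow> g' s0 u"
          using X lim by (force simp: o_def)
      qed
    qed
    moreover have "(\<integral>u. (g (X i) u - g s0 u) / (X i - s0) \<partial>M)
        = ((\<integral>u. g (X i) u \<partial>M) - (\<integral>u. g s0 u \<partial>M)) / (X i - s0)" for i
      using int[of "X i"] int[OF s0] X by simp
    ultimately show "((\<lambda>y. ((\<integral>u. g y u \<partial>M) - (\<integral>u. g s0 u \<partial>M)) / (y - s0)) \<circ> X)
        \<longlonglongrightarrow> (\<integral>u. g' s0 u \<partial>M)"
      by (simp only: o_def)
  qed
  then show ?thesis
    using s0 by (simp add: has_field_derivative_iff at_within_open[OF s0])
qed

text \<open>Decay of one function only, with no derivatives. Each reflected derivative of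
  \<open>F\<close> is \<open>rapid\<close> by itself, and lemmas that differentiate take the pair
  \<open>g\<close>, \<open>g'\<close> together with the relation between them.\<close>

definition rapid :: "(real \<Rightarrow> complex) \<Rightarrow> bool" where
  "rapid g \<longleftrightarrow> continuous_on {0..} g \<and> (\<forall>m. \<exists>C. \<forall>u\<ge>0. u ^ m * norm (g u) \<le> C)"

lemma rapid_bound:
  assumes "rapid g"
  obtains C where "C > 0" "\<And>u. u \<ge> 0 \<Longrightarrow> u ^ m * norm (g u) \<le> C"
proof -
  obtain C where "\<forall>u\<ge>0. u ^ m * norm (g u) \<le> C" using assms unfolding rapid_def by blast
  then show ?thesis using that[of "max C 1"] by force
qed

lemma set_integrable_powr_split:
  fixes a :: real
  assumes "a > 0"
  shows "set_integrable lborel {0<..} (\<lambda>u. if u \<le> 1 then u powr (a - 1) else u powr - 2)"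
proof -
  have 1: "set_integrable lborel (einterval 0 1) (\<lambda>u. u powr (a - 1))"
  proof (rule interval_integral_FTC_nonneg(1)[where F = "\<lambda>u. u powr a / a" and A = 0 and B = "1 / a"])
    show "(((\<lambda>u. u powr a / a) \<circ> real_of_ereal) \<longlongrightarrow> 0) (at_right 0)"
      using assms unfolding zero_ereal_def
      by (auto simp: ereal_tendsto_simps intro!: tendsto_eq_intros tendsto_powr'[where b = a] eventually_at_rightI[of 0 1])
    show "(((\<lambda>u. u powr a / a) \<circ> real_of_ereal) \<longlongrightarrow> 1 / a) (at_left 1)"
      using assms unfolding one_ereal_def
      by (auto simp: ereal_tendsto_simps intro!: tendsto_eq_intros)
  qed (use assms in \<open>auto intro!: derivative_eq_intros continuous_intros simp: zero_ereal_def one_ereal_def powr_diff field_simps\<close>)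
  have 2: "set_integrable lborel (einterval 1 \<infinity>) (\<lambda>u. u powr - 2)"
  proof (rule interval_integral_FTC_nonneg(1)[where F = "\<lambda>u. - (u powr - 1)" and A = "- 1" and B = 0])
    show "(((\<lambda>u. - (u powr - 1)) \<circ> real_of_ereal) \<longlongrightarrow> - 1) (at_right 1)"
      using assms unfolding one_ereal_def
      by (auto simp: ereal_tendsto_simps intro!: tendsto_eq_intros)
    have "((\<lambda>u::real. u powr - 1) \<longlongrightarrow> 0) at_top"
      by (rule tendsto_neg_powr) (auto simp: filterlim_ident)
    from tendsto_minus[OF this] show "(((\<lambda>u. - (u powr - 1)) \<circ> real_of_ereal) \<longlongrightarrow> 0) (at_left \<infinity>)"
      by (simp add: ereal_tendsto_simps)
    fix x :: real assume "1 < ereal x"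
    then have "x > 0" by (simp add: one_ereal_def)
    from DERIV_minus[OF has_real_derivative_powr[OF this, of "- 1"]]
    show "((\<lambda>u. - (u powr - 1)) has_real_derivative x powr - 2) (at x)" by simp
  qed (auto intro!: continuous_intros simp: one_ereal_def)
  have "set_integrable lborel {0<..<1} (\<lambda>u. if u \<le> 1 then u powr (a - 1) else u powr - 2)"
    using 1 unfolding zero_ereal_def one_ereal_def einterval_eq
    by (rule set_integrable_cong[THEN iffD1, rotated -1]) auto
  moreover have "set_integrable lborel {1<..} (\<lambda>u. if u \<le> 1 then u powr (a - 1) else u powr - 2)"
    using 2 unfolding one_ereal_def einterval_eq
    by (rule set_integrable_cong[THEN iffD1, rotated -1]) auto
  ultimately have "set_integrable lborel ({0<..<1} \<union> {1<..}) (\<lambda>u. if u \<le> 1 then u powr (a - 1) else u powr - 2)"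
    by (rule set_integrable_Un) auto
  moreover have "AE x in lborel. (x \<in> {0<..<1} \<union> {1<..}) = (x \<in> {0::real<..})"
    using AE_lborel_singleton[of "1::real"] by eventually_elim auto
  ultimately show ?thesis
    unfolding set_integrable_def
    by (subst integrable_cong_AE[where g = "\<lambda>u. indicator ({0<..<1} \<union> {1<..}) u *\<^sub>R (if u \<le> 1 then u powr (a - 1) else u powr - 2)"])
       (auto elim!: eventually_mono simp: indicator_def)
qed

lemma abs_ln_le_powr:
  fixes u e :: real
  assumes "0 < u" "u \<le> 1" "e > 0"
  shows "\<bar>ln u\<bar> \<le> u powr (- e) / e"
  using ln_powr_bound[of "1 / u" e] assms by (simp add: ln_div powr_minus powr_divide field_simps)

text \<open>A single majorant for the whole strip between \<open>a\<close> and \<open>b\<close>. The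
  logarithmic factor lets it dominate the derivative of the Mellin integrand in \<open>s\<close> as
  well as the integrand itself.\<close>

lemma set_integrable_mellin_majorant:
  assumes g: "rapid g" and ab: "0 < a" "a \<le> b"
  shows "set_integrable lborel {0<..}
    (\<lambda>u. (1 + \<bar>ln u\<bar>) * (u powr (a - 1) + u powr (b - 1)) * norm (g u))"
proof -
  \<comment> \<open>For u > 1 the logarithmic factor costs one power of u, so the product is of
    order u^(b - m), and m \<ge> b + 2 leaves u^(-2).\<close>
  obtain m :: nat where m: "b + 2 \<le> real m" using real_arch_simple by blast
  obtain C0 where C0: "C0 > 0" "\<And>u. u \<ge> 0 \<Longrightarrow> u ^ 0 * norm (g u) \<le> C0" using rapid_bound[OF g] by blast
  obtain C1 where C1: "C1 > 0" "\<And>u. u \<ge> 0 \<Longrightarrow> u ^ m * norm (g u) \<le> C1" using rapid_bound[OF g] by blast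
  define K where "K = 2 * (1 + 2 / a) * C0 + 4 * C1"
  \<comment> \<open>Near 0 half of the exponent \<open>a\<close> is spent on the logarithm, which is
    O(u^(-a/2)); the remaining exponent a/2 - 1 is still integrable there.\<close>
  define D where "D = (\<lambda>u. K * (if u \<le> 1 then u powr (a / 2 - 1) else u powr - 2))"
  have D: "set_integrable lborel {0<..} D"
    unfolding D_def using set_integrable_powr_split[of "a/2"] ab by simp
  show ?thesis
  proof (rule set_integrable_bound[OF D])
    have c: "continuous_on {0<..} (\<lambda>u. (1 + \<bar>ln u\<bar>) * (u powr (a - 1) + u powr (b - 1)) * norm (g u))"
      using g by (auto intro!: continuous_intros simp: rapid_def elim: continuous_on_subset)
    show "set_borel_measurable lborel {0<..} (\<lambda>u. (1 + \<bar>ln u\<bar>) * (u powr (a - 1) + u powr (b - 1)) * norm (g u))"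
      unfolding set_borel_measurable_def
      using borel_measurable_continuous_on_indicator[OF _ c] by simp
    have nn: "0 \<le> (1 + \<bar>ln u\<bar>) * (u powr (a - 1) + u powr (b - 1)) * norm (g u)" for u
      by (intro mult_nonneg_nonneg add_nonneg_nonneg) auto
    have "norm ((1 + \<bar>ln u\<bar>) * (u powr (a - 1) + u powr (b - 1)) * norm (g u)) \<le> norm (D u)" if u: "u > 0" for u
    proof (cases "u \<le> 1")
      case True
      have l: "1 + \<bar>ln u\<bar> \<le> (1 + 2 / a) * u powr (- (a/2))"
      proof -
        have "1 \<le> u powr (- (a/2))" using True u ab powr_mono'[of "-(a/2)" 0 u] by simp
        moreover have "\<bar>ln u\<bar> \<le> u powr (- (a/2)) / (a/2)"
          using abs_ln_le_powr[of u "a/2"] True u ab by simp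
        moreover have "(1 + 2 / a) * u powr (- (a/2)) = u powr (- (a/2)) + u powr (- (a/2)) / (a/2)"
          using ab by (simp add: field_simps)
        ultimately show ?thesis by linarith
      qed
      have p: "u powr (a - 1) + u powr (b - 1) \<le> 2 * u powr (a - 1)"
        using powr_mono'[of "a-1" "b-1" u] True u ab by simp
      have "(1 + \<bar>ln u\<bar>) * (u powr (a - 1) + u powr (b - 1)) * norm (g u)
          \<le> ((1 + 2 / a) * u powr (- (a/2))) * (2 * u powr (a - 1)) * C0"
        using C0(2)[of u] u ab by (intro mult_mono l p) (auto intro!: mult_nonneg_nonneg)
      also have "\<dots> = 2 * (1 + 2 / a) * C0 * (u powr (- (a/2)) * u powr (a - 1))" by simp
      also have "u powr (- (a/2)) * u powr (a - 1) = u powr (a/2 - 1)"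
        using u by (simp flip: powr_add)
      also have "2 * (1 + 2 / a) * C0 * u powr (a/2 - 1) \<le> D u"
        unfolding D_def K_def using True C1 by (auto intro!: mult_right_mono)
      finally show ?thesis using nn[of u] unfolding real_norm_def by linarith
    next
      case False
      have l: "1 + \<bar>ln u\<bar> \<le> 2 * u" using False ln_le_minus_one[of u] by simp
      have p: "u powr (a - 1) + u powr (b - 1) \<le> 2 * u powr (b - 1)"
        using powr_mono[of "a-1" "b-1" u] False u ab by simp
      have "norm (g u) \<le> C1 * u powr (- m)"
        using C1(2)[of u] u by (simp add: powr_minus powr_realpow field_simps)
      then have "(1 + \<bar>ln u\<bar>) * (u powr (a - 1) + u powr (b - 1)) * norm (g u)
          \<le> (2 * u) * (2 * u powr (b - 1)) * (C1 * u powr (- m))"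
        using u ab by (intro mult_mono l p) (auto intro!: mult_nonneg_nonneg)
      also have "\<dots> = 4 * C1 * (u powr 1 * u powr (b - 1) * u powr (- m))" using u by simp
      also have "u powr 1 * u powr (b - 1) * u powr (- m) = u powr (b - m)"
        by (simp only: powr_add[symmetric]) simp
      also have "4 * C1 * u powr (b - m) \<le> 4 * C1 * u powr - 2"
        using m False C1 by (intro mult_left_mono powr_mono) auto
      also have "\<dots> \<le> D u"
        unfolding D_def K_def using False C0 ab by (auto intro!: mult_right_mono)
      finally show ?thesis using nn[of u] unfolding real_norm_def by linarith
    qed
    then show "AE u in lborel. u \<in> {0<..} \<longrightarrow> norm ((1 + \<bar>ln u\<bar>) * (u powr (a - 1) + u powr (b - 1)) * norm (g u)) \<le> norm (D u)"
      by auto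
  qed
qed

definition mellin :: "(real \<Rightarrow> complex) \<Rightarrow> complex \<Rightarrow> complex" where
  "mellin g s = (LBINT u:{0<..}. complex_of_real u powr (s - 1) * g u)"

definition mellin_ln :: "(real \<Rightarrow> complex) \<Rightarrow> complex \<Rightarrow> complex" where
  "mellin_ln g s = (LBINT u:{0<..}. complex_of_real (ln u) * (complex_of_real u powr (s - 1) * g u))"

text \<open>On each side of u = 1 one of the two end exponents dominates, so their sum serves all of
  (0, \<infinity>) at once.\<close>

lemma powr_between:
  fixes u :: real
  assumes "u > 0" "a \<le> c" "c \<le> b"
  shows "u powr (c - 1) \<le> u powr (a - 1) + u powr (b - 1)"
proof (cases "u \<le> 1")
  case True
  have "u powr (c - 1) \<le> u powr (a - 1)" using True assms by (intro powr_mono') auto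
  then show ?thesis by (simp add: add_increasing2)
next
  case False
  have "u powr (c - 1) \<le> u powr (b - 1)" using False assms by (intro powr_mono) auto
  then show ?thesis by (simp add: add_increasing)
qed

lemma norm_mellin_integrand_le:
  assumes "u > 0" "a \<le> Re s" "Re s \<le> b"
  shows "norm (complex_of_real u powr (s - 1) * g u) \<le> (u powr (a - 1) + u powr (b - 1)) * norm (g u)"
  using powr_between[of u a "Re s" b] assms
  by (auto simp: norm_mult norm_powr_real_powr intro!: mult_right_mono)

lemma continuous_on_mellin_integrand:
  assumes "rapid g"
  shows "continuous_on {0<..} (\<lambda>u. complex_of_real u powr (s - 1) * g u)"
  using assms by (auto intro!: continuous_intros simp: rapid_def elim: continuous_on_subset)

lemma
  assumes g: "rapid g" and s: "Re s > 0"
  shows set_integrable_mellin: "set_integrable lborel {0<..} (\<lambda>u. complex_of_real u powr (s - 1) * g u)"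
    and set_integrable_mellin_ln:
      "set_integrable lborel {0<..} (\<lambda>u. complex_of_real (ln u) * (complex_of_real u powr (s - 1) * g u))"
proof -
  have maj: "set_integrable lborel {0<..}
    (\<lambda>u. (1 + \<bar>ln u\<bar>) * (u powr (Re s - 1) + u powr (Re s - 1)) * norm (g u))"
    by (rule set_integrable_mellin_majorant) (use g s in auto)
  have b: "norm (complex_of_real u powr (s - 1) * g u) \<le> (u powr (Re s - 1) + u powr (Re s - 1)) * norm (g u)" if "u > 0" for u
    using norm_mellin_integrand_le[of u "Re s" s "Re s" g] that by simp
  show "set_integrable lborel {0<..} (\<lambda>u. complex_of_real u powr (s - 1) * g u)"
  proof (rule set_integrable_bound[OF maj])
    show "set_borel_measurable lborel {0<..} (\<lambda>u. complex_of_real u powr (s - 1) * g u)"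
      unfolding set_borel_measurable_def
      using borel_measurable_continuous_on_indicator[OF _ continuous_on_mellin_integrand[OF g]] by simp
    have "norm (complex_of_real u powr (s - 1) * g u) \<le>
        norm ((1 + \<bar>ln u\<bar>) * (u powr (Re s - 1) + u powr (Re s - 1)) * norm (g u))" if "u > 0" for u
    proof -
      have "1 * ((u powr (Re s - 1) + u powr (Re s - 1)) * norm (g u)) \<le> (1 + \<bar>ln u\<bar>) * ((u powr (Re s - 1) + u powr (Re s - 1)) * norm (g u))"
        by (intro mult_right_mono) auto
      then show ?thesis using b[OF that] by (simp add: abs_mult mult.assoc)
    qed
    then show "AE u in lborel. u \<in> {0<..} \<longrightarrow> norm (complex_of_real u powr (s - 1) * g u) \<le>
        norm ((1 + \<bar>ln u\<bar>) * (u powr (Re s - 1) + u powr (Re s - 1)) * norm (g u))" by auto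
  qed
  show "set_integrable lborel {0<..} (\<lambda>u. complex_of_real (ln u) * (complex_of_real u powr (s - 1) * g u))"
  proof (rule set_integrable_bound[OF maj])
    have c: "continuous_on {0<..} (\<lambda>u. complex_of_real (ln u) * (complex_of_real u powr (s - 1) * g u))"
      by (intro continuous_on_mult continuous_on_mellin_integrand g) (auto intro!: continuous_intros)
    show "set_borel_measurable lborel {0<..} (\<lambda>u. complex_of_real (ln u) * (complex_of_real u powr (s - 1) * g u))"
      unfolding set_borel_measurable_def
      using borel_measurable_continuous_on_indicator[OF _ c] by simp
    have "norm (complex_of_real (ln u) * (complex_of_real u powr (s - 1) * g u)) \<le>
        norm ((1 + \<bar>ln u\<bar>) * (u powr (Re s - 1) + u powr (Re s - 1)) * norm (g u))" if "u > 0" for u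
    proof -
      have "norm (complex_of_real (ln u) * (complex_of_real u powr (s - 1) * g u))
         \<le> (1 + \<bar>ln u\<bar>) * ((u powr (Re s - 1) + u powr (Re s - 1)) * norm (g u))"
        unfolding norm_mult[of "complex_of_real (ln u)"] using b[OF that] by (intro mult_mono) auto
      then show ?thesis by (simp add: abs_mult mult.assoc)
    qed
    then show "AE u in lborel. u \<in> {0<..} \<longrightarrow> norm (complex_of_real (ln u) * (complex_of_real u powr (s - 1) * g u)) \<le>
        norm ((1 + \<bar>ln u\<bar>) * (u powr (Re s - 1) + u powr (Re s - 1)) * norm (g u))" by auto
  qed
qed

text \<open>Uniform in \<open>Im s\<close>, because the modulus of u^(s - 1) depends only on
  \<open>Re s\<close>. Decay in \<open>Im s\<close> is gained later by dividing by a Pochhammer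
  symbol.\<close>

lemma norm_mellin_le:
  assumes g: "rapid g" and ab: "0 < a" "a \<le> b"
  obtains C where "C > 0" "\<And>s. a \<le> Re s \<Longrightarrow> Re s \<le> b \<Longrightarrow> norm (mellin g s) \<le> C"
proof -
  define w where "w = (\<lambda>u. (1 + \<bar>ln u\<bar>) * (u powr (a - 1) + u powr (b - 1)) * norm (g u))"
  have w: "set_integrable lborel {0<..} w"
    unfolding w_def by (rule set_integrable_mellin_majorant) (use g ab in auto)
  have "norm (mellin g s) \<le> (LBINT u:{0<..}. w u)" if s: "a \<le> Re s" "Re s \<le> b" for s
  proof -
    have i: "set_integrable lborel {0<..} (\<lambda>u. complex_of_real u powr (s - 1) * g u)"
      using g s ab by (intro set_integrable_mellin) auto
    have "norm (mellin g s) \<le> (LBINT u:{0<..}. norm (complex_of_real u powr (s - 1) * g u))"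
      unfolding mellin_def by (rule set_integral_norm_bound[OF i])
    also have "\<dots> \<le> (LBINT u:{0<..}. w u)"
    proof (rule set_integral_mono[OF set_integrable_norm[OF i] w])
      fix u :: real assume "u \<in> {0<..}"
      then have "norm (complex_of_real u powr (s - 1) * g u) \<le> 1 * ((u powr (a - 1) + u powr (b - 1)) * norm (g u))"
        using norm_mellin_integrand_le[of u a s b g] s by simp
      also have "\<dots> \<le> (1 + \<bar>ln u\<bar>) * ((u powr (a - 1) + u powr (b - 1)) * norm (g u))"
        by (intro mult_right_mono) auto
      finally show "norm (complex_of_real u powr (s - 1) * g u) \<le> w u" by (simp add: w_def mult.assoc)
    qed
    finally show ?thesis .
  qed
  then show ?thesis by (intro that[of "max 1 (LBINT u:{0<..}. w u)"]) force+
qed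

lemma mellin_has_field_derivative:
  assumes g: "rapid g" and s: "Re s > 0"
  shows "(mellin g has_field_derivative mellin_ln g s) (at s)"
proof -
  \<comment> \<open>The ball of radius Re s / 2 about \<open>s\<close> lies in the strip from Re s /
    2 to 2 Re s, whose majorant this is.\<close>
  define w where "w = (\<lambda>u. (1 + \<bar>ln u\<bar>) * (u powr (Re s / 2 - 1) + u powr (2 * Re s - 1)) * norm (g u))"
  have w: "set_integrable lborel {0<..} w"
    unfolding w_def by (rule set_integrable_mellin_majorant) (use g s in auto)
  have bd: "Re s / 2 \<le> Re z \<and> Re z \<le> 2 * Re s \<and> Re z > 0" if "z \<in> ball s (Re s / 2)" for z
  proof -
    have "\<bar>Re (z - s)\<bar> < Re s / 2" 
      using that abs_Re_le_cmod[of "z - s"] by (simp add: dist_norm norm_minus_commute)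
    then show ?thesis using s unfolding minus_complex.sel by (intro conjI; linarith)
  qed
  have "((\<lambda>s. \<integral>u. indicator {0<..} u *\<^sub>R (complex_of_real u powr (s - 1) * g u) \<partial>lborel) has_field_derivative
     (\<integral>u. indicator {0<..} u *\<^sub>R (complex_of_real (ln u) * (complex_of_real u powr (s - 1) * g u)) \<partial>lborel)) (at s)"
  proof (rule has_field_derivative_lebesgue_integral[where r = "Re s / 2" and D = "\<lambda>u. indicator {0<..} u *\<^sub>R w u" and
        g' = "\<lambda>s u. indicator {0<..} u *\<^sub>R (complex_of_real (ln u) * (complex_of_real u powr (s - 1) * g u))"])
    show "integrable lborel (\<lambda>u. indicator {0<..} u *\<^sub>R (complex_of_real u powr (z - 1) * g u))"
      if "z \<in> ball s (Re s / 2)" for z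
      using set_integrable_mellin[OF g, of z] bd[OF that] by (simp add: set_integrable_def)
    show "(\<lambda>u. indicator {0<..} u *\<^sub>R (complex_of_real (ln u) * (complex_of_real u powr (s - 1) * g u))) \<in> borel_measurable lborel"
      using set_integrable_mellin_ln[OF g s] by (simp add: set_integrable_def)
    show "integrable lborel (\<lambda>u. indicator {0<..} u *\<^sub>R w u)" using w by (simp add: set_integrable_def)
    fix z u assume z: "z \<in> ball s (Re s / 2)"
    show "((\<lambda>s. indicator {0<..} u *\<^sub>R (complex_of_real u powr (s - 1) * g u)) has_field_derivative
      indicator {0<..} u *\<^sub>R (complex_of_real (ln u) * (complex_of_real u powr (z - 1) * g u))) (at z)"
      by (cases "u > 0") (auto simp: powr_def Ln_of_real intro!: derivative_eq_intros)
    show "norm (indicator {0<..} u *\<^sub>R (complex_of_real (ln u) * (complex_of_real u powr (z - 1) * g u)))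
        \<le> indicator {0<..} u *\<^sub>R w u"
    proof (cases "u > 0")
      case True
      have "norm (complex_of_real (ln u) * (complex_of_real u powr (z - 1) * g u))
         \<le> (1 + \<bar>ln u\<bar>) * ((u powr (Re s / 2 - 1) + u powr (2 * Re s - 1)) * norm (g u))"
        unfolding norm_mult[of "complex_of_real (ln u)"] 
        using norm_mellin_integrand_le[of u "Re s / 2" z "2 * Re s" g] bd[OF z] True by (intro mult_mono) auto
      then show ?thesis using True by (simp add: w_def mult.assoc)
    qed simp
  qed (use s in auto)
  then show ?thesis unfolding mellin_def[abs_def] mellin_ln_def set_lebesgue_integral_def .
qed

lemma mellin_holomorphic:
  assumes "rapid g" shows "mellin g holomorphic_on {s. Re s > 0}"
  using mellin_has_field_derivative[OF assms]
  by (auto simp: holomorphic_on_def field_differentiable_def intro: has_field_derivative_at_within)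

lemma tendsto_powr_mult_rapid:
  assumes "rapid g"
  shows "((\<lambda>u. complex_of_real u powr s * g u) \<longlongrightarrow> 0) at_top"
proof -
  obtain m :: nat where m: "Re s + 1 \<le> real m" using real_arch_simple by blast
  obtain C where C: "C > 0" "\<And>u. u \<ge> 0 \<Longrightarrow> u ^ m * norm (g u) \<le> C" using rapid_bound[OF assms] by blast
  show ?thesis
  proof (rule Lim_null_comparison)
    have "norm (complex_of_real u powr s * g u) \<le> C * u powr - 1" if "u \<ge> 1" for u
    proof -
      have "norm (complex_of_real u powr s * g u) = u powr Re s * norm (g u)"
        using that by (simp add: norm_mult norm_powr_real_powr)
      also have "\<dots> \<le> u powr (real m - 1) * norm (g u)"
        using that m by (intro mult_right_mono powr_mono) auto
      also have "\<dots> = u powr - 1 * (u ^ m * norm (g u))"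
        using that by (simp add: powr_diff powr_minus powr_realpow field_simps)
      also have "\<dots> \<le> u powr - 1 * C" using C that by (intro mult_left_mono) auto
      finally show ?thesis by (simp add: mult.commute)
    qed
    then show "\<forall>\<^sub>F u in at_top. norm (complex_of_real u powr s * g u) \<le> C * u powr - 1"
      by (intro eventually_mono[OF eventually_ge_at_top[of 1]]) blast
    show "((\<lambda>u. C * u powr - 1) \<longlongrightarrow> 0) at_top"
      by (rule tendsto_mult_right_zero, rule tendsto_neg_powr) (auto simp: filterlim_ident)
  qed
qed

lemma rapid_tendsto_at_right_0:
  assumes "rapid g" shows "(g \<longlongrightarrow> g 0) (at_right 0)"
proof -
  have "(g \<longlongrightarrow> g 0) (at 0 within {0..})"
    using assms by (simp add: rapid_def continuous_on)
  then show ?thesis by (rule tendsto_within_subset) auto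
qed

lemma tendsto_0_powr_mult_rapid:
  assumes "rapid g" "Re s > 0"
  shows "((\<lambda>u. complex_of_real u powr s * g u) \<longlongrightarrow> 0) (at_right 0)"
proof -
  have "((\<lambda>u. complex_of_real u powr s) \<longlongrightarrow> 0) (at_right 0)"
  proof (rule tendsto_norm_zero_cancel)
    have "((\<lambda>u. u powr Re s) \<longlongrightarrow> 0) (at_right 0)"
      using assms by (auto intro!: tendsto_eq_intros tendsto_powr'[where b = "Re s"] eventually_at_rightI[of 0 1])
    then show "((\<lambda>u. norm (complex_of_real u powr s)) \<longlongrightarrow> 0) (at_right 0)"
      by (rule Lim_transform_eventually) 
         (auto simp: norm_powr_real_powr intro!: eventually_at_rightI[of 0 1])
  qed
  from tendsto_mult[OF this rapid_tendsto_at_right_0[OF assms(1)]] show ?thesis by simp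
qed

text \<open>\<open>g'\<close> is minus the derivative of \<open>g\<close>: for g(u) = G(-u) this
  makes g'(u) the reflection of the derivative of G, and no signs accumulate under iteration. The
  identity is the fundamental theorem for u^s g(u), whose limits at 0 and \<infinity>
  vanish.\<close>

lemma mellin_by_parts:
  assumes g: "rapid g" and g': "rapid g'" and s: "Re s > 0"
    and der: "\<And>u. u > 0 \<Longrightarrow> (g has_vector_derivative - g' u) (at u)"
  shows "s * mellin g s = mellin g' (s + 1)"
proof -
  have i1: "set_integrable lborel {0<..} (\<lambda>u. complex_of_real u powr (s - 1) * g u)"
    using set_integrable_mellin[OF g s] .
  have i2: "set_integrable lborel {0<..} (\<lambda>u. complex_of_real u powr s * g' u)"
    using set_integrable_mellin[OF g', of "s + 1"] s by simp
  have c1: "continuous_on {0<..} g" "continuous_on {0<..} g'"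
    using g g' by (auto simp: rapid_def elim: continuous_on_subset)
  let ?f = "\<lambda>u. s * (complex_of_real u powr (s - 1) * g u) - complex_of_real u powr s * g' u"
  have "(LBINT u=ereal 0..\<infinity>. ?f u) = 0 - 0"
  proof (rule interval_integral_FTC_integrable[where F = "\<lambda>u. complex_of_real u powr s * g u"])
    fix u :: real assume "ereal 0 < ereal u"
    then have u: "u > 0" by simp
    have "((\<lambda>u. complex_of_real u powr s) has_vector_derivative s * complex_of_real u powr (s - 1)) (at u)"
      using u by (intro has_vector_derivative_real_field) (auto intro!: derivative_eq_intros)
    from has_vector_derivative_mult[OF this der[OF u]]
    show "((\<lambda>u. complex_of_real u powr s * g u) has_vector_derivative ?f u) (at u)"
      by (simp add: algebra_simps)
    have "continuous_on {0<..} ?f" using c1 by (auto intro!: continuous_intros)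
    then show "isCont ?f u" using u by (simp add: continuous_on_eq_continuous_at)
  next
    show "set_integrable lborel (einterval (ereal 0) \<infinity>) ?f"
      using i1 i2 by (auto intro!: set_integral_diff)
    show "(((\<lambda>u. complex_of_real u powr s * g u) \<circ> real_of_ereal) \<longlongrightarrow> 0) (at_right (ereal 0))"
      using tendsto_0_powr_mult_rapid[OF g s] by (simp add: ereal_tendsto_simps)
    show "(((\<lambda>u. complex_of_real u powr s * g u) \<circ> real_of_ereal) \<longlongrightarrow> 0) (at_left \<infinity>)"
      using tendsto_powr_mult_rapid[OF g] by (simp add: ereal_tendsto_simps)
  qed auto
  then have "(LBINT u:{0<..}. ?f u) = 0" by (simp add: interval_integral_to_infinity_eq)
  moreover have "(LBINT u:{0<..}. ?f u) = s * mellin g s - mellin g' (s + 1)"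
    using i1 i2 by (subst set_integral_diff) (auto simp: mellin_def)
  ultimately show ?thesis by simp
qed

text \<open>The degenerate case s = 0 of the integration by parts, where the boundary value at 0
  survives. It is the source of the ordinary derivatives at integer points.\<close>

lemma mellin_at_1:
  assumes g: "rapid g" and g': "rapid g'"
    and der: "\<And>u. u > 0 \<Longrightarrow> (g has_vector_derivative - g' u) (at u)"
  shows "mellin g' 1 = g 0"
proof -
  have i2: "set_integrable lborel {0<..} g'"
    using set_integrable_mellin[OF g', of 1] 
    by (rule set_integrable_cong[THEN iffD1, rotated -1]) auto
  have "(LBINT u=ereal 0..\<infinity>. - g' u) = 0 - g 0"
  proof (rule interval_integral_FTC_integrable[where F = g])
    fix u :: real assume "ereal 0 < ereal u"
    then have u: "u > 0" by simp
    show "(g has_vector_derivative - g' u) (at u)" by (rule der[OF u])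
    have "continuous_on {0<..} (\<lambda>u. - g' u)" 
      using g' by (auto simp: rapid_def intro!: continuous_intros elim: continuous_on_subset)
    then show "isCont (\<lambda>u. - g' u) u" using u by (simp add: continuous_on_eq_continuous_at)
  next
    show "set_integrable lborel (einterval (ereal 0) \<infinity>) (\<lambda>u. - g' u)"
      using i2 by (simp add: set_integrable_def)
    show "((g \<circ> real_of_ereal) \<longlongrightarrow> g 0) (at_right (ereal 0))"
      using rapid_tendsto_at_right_0[OF g] by (simp add: ereal_tendsto_simps)
    have "(g \<longlongrightarrow> 0) at_top"
      using tendsto_powr_mult_rapid[OF g, of 0]
      by (rule Lim_transform_eventually[OF _ eventually_mono[OF eventually_gt_at_top[of 0]]]) auto
    then show "((g \<circ> real_of_ereal) \<longlongrightarrow> 0) (at_left \<infinity>)"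
      by (simp add: ereal_tendsto_simps)
  qed auto
  then have "(LBINT u:{0<..}. - g' u) = - g 0" by (simp add: interval_integral_to_infinity_eq)
  moreover have "(LBINT u:{0<..}. - g' u) = - (LBINT u:{0<..}. g' u)"
    by (simp add: set_lebesgue_integral_def)
  moreover have "mellin g' 1 = (LBINT u:{0<..}. g' u)"
    unfolding mellin_def by (rule set_lebesgue_integral_cong) auto
  ultimately show ?thesis by simp
qed

section \<open>The entire extension of the derivatives at zero\<close>

lemma
  assumes "F \<in> schwartz_neg" 
  shows nderiv_neg_has_vector_derivative:
      "t \<le> 0 \<Longrightarrow> (nderiv_neg k F has_vector_derivative nderiv_neg (Suc k) F t) (at t within {..0})"
    and continuous_on_nderiv_neg: "continuous_on {..0} (nderiv_neg k F)"
proof -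
  have d: "nderiv_neg k F differentiable (at t within {..0})" if "t \<le> 0" for t
    using assms that by (auto simp: schwartz_neg_def)
  then show "t \<le> 0 \<Longrightarrow> (nderiv_neg k F has_vector_derivative nderiv_neg (Suc k) F t) (at t within {..0})"
    by (simp add: vector_derivative_works)
  show "continuous_on {..0} (nderiv_neg k F)"
    using d by (auto simp: continuous_on_eq_continuous_within intro: differentiable_imp_continuous_within)
qed

lemma rapid_nderiv_neg:
  assumes F: "F \<in> schwartz_neg" 
  shows "rapid (\<lambda>u. nderiv_neg k F (- u))"
  unfolding rapid_def
proof (intro conjI allI)
  show "continuous_on {0..} (\<lambda>u. nderiv_neg k F (- u))"
    by (rule continuous_on_compose2[OF continuous_on_nderiv_neg[OF F]]) (auto intro!: continuous_intros)
  fix m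
  have "((\<lambda>t. complex_of_real (\<bar>t\<bar> ^ m) * nderiv_neg k F t) \<longlongrightarrow> 0) at_bot"
    using F by (auto simp: schwartz_neg_def)
  from tendstoD[OF this, of 1] obtain T where
    T: "\<And>t. t \<le> T \<Longrightarrow> \<bar>t\<bar> ^ m * norm (nderiv_neg k F t) < 1"
    by (auto simp: eventually_at_bot_linorder norm_mult norm_power)
  have "continuous_on {min T 0..0} (\<lambda>t. complex_of_real (\<bar>t\<bar> ^ m) * nderiv_neg k F t)"
    by (intro continuous_intros continuous_on_subset[OF continuous_on_nderiv_neg[OF F]]) auto
  then have "bounded ((\<lambda>t. complex_of_real (\<bar>t\<bar> ^ m) * nderiv_neg k F t) ` {min T 0..0})"
    by (intro compact_imp_bounded compact_continuous_image) auto
  then obtain B where B: "\<forall>t\<in>{min T 0..0}. \<bar>t\<bar> ^ m * norm (nderiv_neg k F t) \<le> B"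
    unfolding bounded_iff by (auto simp: norm_mult norm_power simp del: abs_power_minus)
  show "\<exists>C. \<forall>u\<ge>0. u ^ m * norm (nderiv_neg k F (- u)) \<le> C"
  proof (intro exI[of _ "max B 1"] allI impI)
    fix u :: real assume u: "u \<ge> 0"
    show "u ^ m * norm (nderiv_neg k F (- u)) \<le> max B 1"
    proof (cases "- u \<le> T")
      case True
      then show ?thesis using T[of "-u"] u by simp
    next
      case False
      then show ?thesis using B[rule_format, of "-u"] u by simp
    qed
  qed
qed

lemma nderiv_neg_reflect_has_vector_derivative:
  assumes "F \<in> schwartz_neg" "u > 0"
  shows "((\<lambda>u. nderiv_neg k F (- u)) has_vector_derivative - nderiv_neg (Suc k) F (- u)) (at u)"
proof -
  \<comment> \<open>For u > 0 the point -u is interior to the half-line, so the derivative within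
    \<open>{..0}\<close> is a two-sided one.\<close>
  have "(nderiv_neg k F has_vector_derivative nderiv_neg (Suc k) F (- u)) (at (- u) within {..<0})"
    using nderiv_neg_has_vector_derivative[OF assms(1), of "-u" k] assms(2)
    by (auto intro: has_vector_derivative_within_subset)
  then have "(nderiv_neg k F has_vector_derivative nderiv_neg (Suc k) F (- u)) (at (- u))"
    using assms(2) by (subst (asm) at_within_open) auto
  moreover have "(uminus has_vector_derivative (- 1)) (at u)"
    by (auto intro!: derivative_eq_intros)
  ultimately show ?thesis
    using vector_diff_chain_at[of uminus "-1" u "nderiv_neg k F" "nderiv_neg (Suc k) F (- u)"] by (simp add: o_def)
qed

text \<open>The factor w produced by integration by parts is the one in
  \<open>rGamma w = w * rGamma (w + 1)\<close>, so the normalised Mellin transform is unchanged when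
  the order of the derivative and the argument rise together.\<close>

lemma rGamma_mellin_shift:
  assumes F: "F \<in> schwartz_neg" and w: "Re w > 0"
  shows "rGamma w * mellin (\<lambda>u. nderiv_neg k F (- u)) w
    = rGamma (w + of_nat d) * mellin (\<lambda>u. nderiv_neg (k + d) F (- u)) (w + of_nat d)"
proof (induction d)
  case (Suc d)
  let ?w = "w + of_nat d"
  have "?w * mellin (\<lambda>u. nderiv_neg (k + d) F (- u)) ?w = mellin (\<lambda>u. nderiv_neg (Suc (k + d)) F (- u)) (?w + 1)"
    by (rule mellin_by_parts[OF rapid_nderiv_neg[OF F] rapid_nderiv_neg[OF F] _ nderiv_neg_reflect_has_vector_derivative[OF F]])
       (use w in auto)
  then have "rGamma ?w * mellin (\<lambda>u. nderiv_neg (k + d) F (- u)) ?w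
     = rGamma (?w + 1) * mellin (\<lambda>u. nderiv_neg (Suc (k + d)) F (- u)) (?w + 1)"
    by (metis rGamma_plus1 mult.assoc mult.commute)
  then show ?case using Suc by (simp add: add_ac del: nderiv_neg.simps)
qed simp

lemma rGamma_mellin_eq:
  assumes F: "F \<in> schwartz_neg" and "Re s < real j" "Re s < real k"
  shows "rGamma (of_nat j - s) * mellin (\<lambda>u. nderiv_neg j F (- u)) (of_nat j - s)
       = rGamma (of_nat k - s) * mellin (\<lambda>u. nderiv_neg k F (- u)) (of_nat k - s)"
proof -
  have *: "rGamma (of_nat j - s) * mellin (\<lambda>u. nderiv_neg j F (- u)) (of_nat j - s)
       = rGamma (of_nat k - s) * mellin (\<lambda>u. nderiv_neg k F (- u)) (of_nat k - s)"
    if "Re s < real j" "j \<le> k" for j k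
    using rGamma_mellin_shift[OF F, of "of_nat j - s" j "k - j"] that by (simp add: of_nat_diff)
  show ?thesis
  proof (cases "j \<le> k")
    case True
    show ?thesis by (rule *[OF assms(2) True])
  next
    case False
    show ?thesis by (rule *[OF assms(3), symmetric]) (use False in simp)
  qed
qed

text \<open>The pieces on the half-planes Re s < k agree where they overlap and are holomorphic
  because \<open>rGamma\<close> is entire. The identity theorem shows that the glued function is the
  only one matching the description.\<close>

lemma
  assumes F: "F \<in> schwartz_neg"
  shows cderiv0_eq: "Re s < real k \<Longrightarrow>
      cderiv0 F s = rGamma (of_nat k - s) * mellin (\<lambda>u. nderiv_neg k F (- u)) (of_nat k - s)"
    and cderiv0_holomorphic: "cderiv0 F holomorphic_on UNIV"
proof -
  define E where "E = (\<lambda>k s. rGamma (of_nat k - s) * mellin (\<lambda>u. nderiv_neg k F (- u)) (of_nat k - s))"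
  \<comment> \<open>The index varies with \<open>s\<close>, so holomorphy is not visible from this
    formula; near a given point G coincides with one fixed piece \<open>E k\<close>.\<close>
  define G where "G = (\<lambda>s. E (nat \<lceil>\<bar>Re s\<bar>\<rceil> + 1) s)"
  have G: "G s = E k s" if "Re s < real k" for s k
    unfolding G_def E_def by (rule rGamma_mellin_eq[OF F _ that]) linarith
  have E_hol: "E k holomorphic_on {s. Re s < real k}" for k
  proof -
    have "(\<lambda>s. mellin (\<lambda>u. nderiv_neg k F (- u)) (of_nat k - s)) holomorphic_on {s. Re s < real k}"
      by (rule holomorphic_on_compose_gen[OF _ mellin_holomorphic[OF rapid_nderiv_neg[OF F]], unfolded o_def])
         (auto intro!: holomorphic_intros)
    then show ?thesis unfolding E_def by (auto intro!: holomorphic_intros)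
  qed
  have op: "open {s. Re s < real k}" for k by (rule open_halfspace_Re_lt)
  have G_hol: "G holomorphic_on UNIV"
  proof -
    have "G field_differentiable (at s)" for s
    proof -
      define k where "k = nat \<lceil>\<bar>Re s\<bar>\<rceil> + 1"
      have k: "Re s < real k" unfolding k_def by linarith
      have "G holomorphic_on {s. Re s < real k}"
        using holomorphic_transform[OF E_hol[of k]] G by simp
      then show ?thesis using op[of k] k by (auto simp: holomorphic_on_open field_differentiable_def)
    qed
    then show ?thesis by (simp add: holomorphic_on_def)
  qed
  \<comment> \<open>The piece k = 0 is the defining integral.\<close>
  have G_eq: "G s = 1 / Gamma (- s) * (LBINT u:{0<..}. complex_of_real u powr (- s - 1) * F (- u))"
    if "Re s < 0" for s
    using G[of s 0] that by (simp add: E_def mellin_def rGamma_inverse_Gamma field_simps)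
  have "cderiv0 F = G"
    unfolding cderiv0_def
  proof (rule the_equality)
    fix H assume H: "H holomorphic_on UNIV \<and> (\<forall>s. Re s < 0 \<longrightarrow>
        H s = 1 / Gamma (- s) * (LBINT u:{0<..}. complex_of_real u powr (- s - 1) * F (- u)))"
    show "H = G"
    proof
      fix z
      show "H z = G z"
        by (rule analytic_continuation_open[of "{s. Re s < 0}" UNIV])
           (use H G_hol G_eq in \<open>auto simp: open_halfspace_Re_lt intro!: exI[of _ "-1"]\<close>)
    qed
  qed (use G_hol G_eq in auto)
  then show "Re s < real k \<Longrightarrow> 
      cderiv0 F s = rGamma (of_nat k - s) * mellin (\<lambda>u. nderiv_neg k F (- u)) (of_nat k - s)"
    and "cderiv0 F holomorphic_on UNIV"
    using G G_hol by (auto simp: E_def)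
qed

text \<open>With k = n + 1 the Mellin argument is exactly 1, where \<open>rGamma\<close> equals 1
  and the transform is a boundary value.\<close>

lemma cderiv0_of_nat:
  assumes F: "F \<in> schwartz_neg"
  shows "cderiv0 F (of_nat n) = nderiv_neg n F 0"
proof -
  have "mellin (\<lambda>u. nderiv_neg (Suc n) F (- u)) 1 = nderiv_neg n F (- 0)"
    by (rule mellin_at_1[OF rapid_nderiv_neg[OF F, of n] rapid_nderiv_neg[OF F, of "Suc n"]
          nderiv_neg_reflect_has_vector_derivative[OF F]])
  moreover have "of_nat (Suc n) - of_nat n = (1 :: complex)" by simp
  ultimately show ?thesis
    using cderiv0_eq[OF F, of "of_nat n" "Suc n"] by (simp del: nderiv_neg.simps of_nat_Suc)
qed

lemma Gamma_cderiv0: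
  assumes F: "F \<in> schwartz_neg" and s: "Re s < 0"
  shows "Gamma (- s) * cderiv0 F s = mellin (\<lambda>u. F (- u)) (- s)"
proof -
  have "- s \<notin> \<int>\<^sub>\<le>\<^sub>0"
  proof
    assume "- s \<in> \<int>\<^sub>\<le>\<^sub>0"
    then obtain n where "- s = of_int n" "n \<le> 0" by (rule nonpos_Ints_cases)
    then have "- Re s = of_int n" by (metis Re_complex_of_real of_real_of_int_eq uminus_complex.sel(1))
    then show False using s \<open>n \<le> 0\<close> by linarith
  qed
  then have "Gamma (- s) \<noteq> 0" by (simp add: Gamma_eq_zero_iff)
  moreover have "cderiv0 F s = rGamma (- s) * mellin (\<lambda>u. F (- u)) (- s)"
    using cderiv0_eq[OF F, of s 0] s by simp
  ultimately show ?thesis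
    by (simp add: rGamma_inverse_Gamma)
qed

text \<open>The quotient Gamma(-s) / Gamma(k - s) is the reciprocal of a polynomial of degree k in
  s. Unlike the Gamma factor alone, this form can be estimated on vertical lines by elementary
  means.\<close>

lemma Gamma_cderiv0_eq_divide:
  assumes F: "F \<in> schwartz_neg" and s: "Re s < real k" "- s \<notin> \<int>\<^sub>\<le>\<^sub>0"
  shows "Gamma (- s) * cderiv0 F s = mellin (\<lambda>u. nderiv_neg k F (- u)) (of_nat k - s) / pochhammer (- s) k"
proof -
  have g: "Gamma (- s) \<noteq> 0" using s by (simp add: Gamma_eq_zero_iff)
  have "rGamma (- s) = pochhammer (- s) k * rGamma (- s + of_nat k)" by (rule pochhammer_rGamma)
  moreover have "rGamma (- s) * Gamma (- s) = 1" using g by (simp add: rGamma_inverse_Gamma)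
  ultimately have "pochhammer (- s) k * (rGamma (of_nat k - s) * Gamma (- s)) = 1" by (simp add: mult_ac)
  then have "rGamma (of_nat k - s) * Gamma (- s) = 1 / pochhammer (- s) k"
    by (metis divide_eq_eq mult.commute mult_zero_left zero_neq_one)
  then show ?thesis
    unfolding cderiv0_eq[OF F s(1)] by (simp add: mult_ac) (simp only: mult.assoc[symmetric], simp)
qed

text \<open>Each factor of \<open>pochhammer (- s) k\<close> has modulus at least |Im s|, while the
  Mellin transform in the numerator is bounded on the strip. The exponent \<open>p\<close> is
  arbitrary because \<open>k\<close> is.\<close>

lemma norm_Gamma_cderiv0_le:
  assumes F: "F \<in> schwartz_neg"
  obtains C where "C > 0"
    "\<And>s. a \<le> Re s \<Longrightarrow> Re s \<le> b \<Longrightarrow> 1 \<le> \<bar>Im s\<bar> \<Longrightarrow> norm (Gamma (- s) * cderiv0 F s) \<le> C / \<bar>Im s\<bar> ^ p"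
proof (cases "a \<le> b")
  case True
  \<comment> \<open>Above \<open>b\<close>, so that the representation holds on the whole strip, and
    at least \<open>p\<close>, so that |Im s| \<ge> 1 yields the required power.\<close>
  define k where "k = max p (nat \<lceil>\<bar>b\<bar>\<rceil> + 1)"
  have k: "b < real k" "p \<le> k" unfolding k_def by linarith+
  obtain C where C: "C > 0" "\<And>s. real k - b \<le> Re s \<Longrightarrow> Re s \<le> real k - a \<Longrightarrow> norm (mellin (\<lambda>u. nderiv_neg k F (- u)) s) \<le> C"
    by (rule norm_mellin_le[OF rapid_nderiv_neg[OF F, of k], of "real k - b" "real k - a"]) (use k True in auto)
  show ?thesis
  proof (rule that[OF C(1)])
    fix s assume s: "a \<le> Re s" "Re s \<le> b" "1 \<le> \<bar>Im s\<bar>"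
    have ni: "- s \<notin> \<int>\<^sub>\<le>\<^sub>0" using s(3) by (auto elim!: nonpos_Ints_cases simp: complex_eq_iff)
    have "\<bar>Im s\<bar> ^ p \<le> \<bar>Im s\<bar> ^ k" using s k by (intro power_increasing) auto
    also have "\<dots> = (\<Prod>i<k. \<bar>Im s\<bar>)" by simp
    also have "\<dots> \<le> (\<Prod>i<k. norm (- s + of_nat i))"
    proof (rule prod_mono)
      fix i show "0 \<le> \<bar>Im s\<bar> \<and> \<bar>Im s\<bar> \<le> norm (- s + of_nat i)"
        using abs_Im_le_cmod[of "- s + of_nat i"] by simp
    qed
    also have "\<dots> = norm (pochhammer (- s) k)"
      by (simp add: pochhammer_prod prod_norm atLeast0LessThan)
    finally have p: "\<bar>Im s\<bar> ^ p \<le> norm (pochhammer (- s) k)" .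
    have "norm (Gamma (- s) * cderiv0 F s) = norm (mellin (\<lambda>u. nderiv_neg k F (- u)) (of_nat k - s)) / norm (pochhammer (- s) k)"
      using Gamma_cderiv0_eq_divide[OF F _ ni, of k] s k by (simp add: norm_divide)
    also have "\<dots> \<le> C / \<bar>Im s\<bar> ^ p"
      using C s p by (intro frac_le) auto
    finally show "norm (Gamma (- s) * cderiv0 F s) \<le> C / \<bar>Im s\<bar> ^ p" .
  qed
next
  case False
  then show ?thesis using that[of 1] by fastforce
qed

section \<open>Continuation and growth of the zeta function\<close>

lemma norm_pochhammer_le: "norm (pochhammer z n) \<le> (norm z + real n) ^ n" for z :: complex
proof -
  have "norm (pochhammer z n) = (\<Prod>i<n. norm (z + of_nat i))"
    by (simp add: pochhammer_prod prod_norm atLeast0LessThan)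
  also have "\<dots> \<le> (\<Prod>i<n. norm z + real n)"
  proof (rule prod_mono)
    fix i assume "i \<in> {..<n}"
    then show "0 \<le> norm (z + of_nat i) \<and> norm (z + of_nat i) \<le> norm z + real n"
      using norm_triangle_ineq[of z "of_nat i"] by simp
  qed
  finally show ?thesis by simp
qed

text \<open>Twice the Taylor weight (1/2)^i / i! at the odd index i = 2j + 1; in particular the
  coefficient for j = 0 is 1.\<close>

definition midpoint_coeff :: "nat \<Rightarrow> complex" where
  "midpoint_coeff j = (1/2) ^ (2 * j) / fact (2 * j + 1)"

text \<open>The j = 0 term of the sum is (s - 1) (n + 1)^(-s). Summing over n therefore produces (s
  - 1) zeta(s), with shifted zeta values coming from j \<ge> 1.\<close>

definition midpoint_error :: "nat \<Rightarrow> nat \<Rightarrow> complex \<Rightarrow> complex" where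
  "midpoint_error J n s =
     complex_of_real (real n + 1/2) powr (1 - s) - complex_of_real (real n + 3/2) powr (1 - s)
     - (\<Sum>j<J. midpoint_coeff j * pochhammer (s - 1) (2 * j + 1) * of_nat (Suc n) powr (- s - of_nat (2 * j)))"

text \<open>Taylor expansion of \<open>x\<^sup>1\<^sup>-\<^sup>s\<close> about the integer \<open>n + 1\<close>, evaluated at the two midpoints
  \<open>n + 1 \<plusminus> 1/2\<close>: the terms of even order cancel in the difference, so no Bernoulli numbers appear,
  and the main terms telescope over \<open>n\<close>.\<close>

lemma sum_symmetric_diff:
  fixes c :: "nat \<Rightarrow> complex"
  shows "(\<Sum>i\<le>2*J. c i * (1/2) ^ i / fact i) - (\<Sum>i\<le>2*J. c i * (-1/2) ^ i / fact i)
       = (\<Sum>j<J. midpoint_coeff j * c (2 * j + 1))"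
proof (induction J)
  case (Suc J)
  have e: "{..2 * Suc J} = insert (2 * J + 2) (insert (2 * J + 1) {..2 * J})" by auto
  have p: "(-1/2 :: complex) ^ (2 * J) = (1/2) ^ (2 * J)" by (simp add: power_mult power2_eq_square)
  have "(\<Sum>i\<le>2*Suc J. c i * (1/2) ^ i / fact i) - (\<Sum>i\<le>2*Suc J. c i * (-1/2) ^ i / fact i)
      = ((\<Sum>i\<le>2*J. c i * (1/2) ^ i / fact i) - (\<Sum>i\<le>2*J. c i * (-1/2) ^ i / fact i))
        + (c (2*J+1) * (1/2)^(2*J+1) / fact (2*J+1) - c (2*J+1) * (-1/2)^(2*J+1) / fact (2*J+1))
        + (c (2*J+2) * (1/2)^(2*J+2) / fact (2*J+2) - c (2*J+2) * (-1/2)^(2*J+2) / fact (2*J+2))"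
    unfolding e by (simp add: algebra_simps del: fact_Suc power_Suc)
  also have "c (2*J+2) * (1/2)^(2*J+2) / fact (2*J+2) - c (2*J+2) * (-1/2)^(2*J+2) / fact (2*J+2) = 0"
    by (simp add: power_add p)
  also have "c (2*J+1) * (1/2)^(2*J+1) / fact (2*J+1) - c (2*J+1) * (-1/2)^(2*J+1) / fact (2*J+1)
      = midpoint_coeff J * c (2*J+1)"
    unfolding midpoint_coeff_def by (simp add: power_add p field_simps del: fact_Suc)
  finally show ?case using Suc by simp
qed simp

text \<open>Each midpoint contributes a Taylor remainder of at most half the bound. The hypothesis
  makes the modulus of the derivative of order 2J + 1 nonincreasing along the segment, so its
  maximum is at the left end. The Pochhammer factor is kept because its zeros force the error to
  vanish exactly at s = 1 (for J \<ge> 0) and at the even nonpositive integers used later.\<close>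

lemma norm_midpoint_error_le:
  assumes s: "Re s + 2 * real J \<ge> 0"
  shows "norm (midpoint_error J n s) \<le> norm (pochhammer (s - 1) (2 * J + 1)) * (real n + 1/2) powr (- Re s - 2 * real J)"
proof -
  \<comment> \<open>\<open>f i\<close> is the i-th derivative of x^(1 - s): the falling product (1 -
    s)(-s)... is a signed Pochhammer symbol of s - 1.\<close>
  define f where "f = (\<lambda>i x. (-1) ^ i * pochhammer (s - 1) i * x powr (1 - s - of_nat i :: complex))"
  define S where "S = complex_of_real ` {real n + 1/2..real n + 3/2}"
  define m where "m = complex_of_real (real (Suc n))"
  define B where "B = norm (pochhammer (s - 1) (2 * J + 1)) * (real n + 1/2) powr (- Re s - 2 * real J)"
  have S: "convex S"
  proof -
    have "S = closed_segment (complex_of_real (real n + 1/2)) (complex_of_real (real n + 3/2))"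
      unfolding S_def closed_segment_of_real by (simp add: closed_segment_eq_real_ivl)
    then show ?thesis by simp
  qed
  have der: "(f i has_field_derivative f (Suc i) x) (at x within S)" if x: "x \<in> S" for i x
  proof -
    have nz: "x \<notin> \<real>\<^sub>\<le>\<^sub>0" using x by (auto simp: S_def complex_nonpos_Reals_iff)
    have "((\<lambda>x. x powr (1 - s - of_nat i)) has_field_derivative (1 - s - of_nat i) * x powr (1 - s - of_nat i - 1)) (at x)"
      by (rule has_field_derivative_powr[OF nz])
    then have "(f i has_field_derivative (-1) ^ i * pochhammer (s - 1) i * ((1 - s - of_nat i) * x powr (1 - s - of_nat i - 1))) (at x)"
      unfolding f_def by (rule DERIV_cmult)
    also have "(-1) ^ i * pochhammer (s - 1) i * ((1 - s - of_nat i) * x powr (1 - s - of_nat i - 1)) = f (Suc i) x"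
      by (simp add: f_def pochhammer_Suc algebra_simps)
    finally show ?thesis by (rule has_field_derivative_at_within)
  qed
  have B: "norm (f (Suc (2 * J)) x) \<le> B" if x: "x \<in> S" for x
  proof -
    obtain r where r: "x = complex_of_real r" "real n + 1/2 \<le> r" using x by (auto simp: S_def)
    have "norm (f (Suc (2 * J)) x) = norm (pochhammer (s - 1) (2 * J + 1)) * r powr (- Re s - 2 * real J)"
      using r by (simp add: f_def norm_mult norm_power norm_powr_real_powr)
    also have "\<dots> \<le> B"
      unfolding B_def using r s by (intro mult_left_mono powr_mono2') auto
    finally show ?thesis .
  qed
  have m: "m \<in> S" unfolding m_def S_def by (rule imageI) auto
  have T: "norm (f 0 z - (\<Sum>i\<le>2*J. f i m * (z - m) ^ i / fact i)) \<le> B / 2"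
    if z: "z \<in> S" "norm (z - m) = 1/2" for z
  proof -
    have "norm (f 0 z - (\<Sum>i\<le>2*J. f i m * (z - m) ^ i / fact i)) \<le> B * norm (z - m) ^ Suc (2*J) / fact (2*J)"
      by (rule complex_Taylor[OF S der B m z(1)])
    also have "\<dots> = (B / 2) * ((1/2) ^ (2*J) / fact (2*J))" by (simp add: z(2))
    also have "\<dots> \<le> (B / 2) * 1"
    proof (rule mult_left_mono)
      have "(1/2::real) ^ (2*J) \<le> 1" by (simp add: power_le_one)
      also have "(1::real) \<le> fact (2*J)" by (rule fact_ge_1)
      finally show "(1/2::real) ^ (2*J) / fact (2*J) \<le> 1" by simp
    qed (simp add: B_def)
    finally show ?thesis by simp
  qed
  define z1 where "z1 = complex_of_real (real n + 3/2)"
  define z2 where "z2 = complex_of_real (real n + 1/2)"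
  have z: "z1 - m = 1/2" "z2 - m = -1/2"
    by (simp_all add: z1_def z2_def m_def)
  have zn: "norm (z1 - m) = 1/2" "norm (z2 - m) = 1/2" unfolding z by simp_all
  have zS: "z1 \<in> S" "z2 \<in> S"
    unfolding z1_def z2_def S_def by (rule imageI, simp)+
  have "midpoint_error J n s = (f 0 z2 - (\<Sum>i\<le>2*J. f i m * (z2 - m) ^ i / fact i)) - (f 0 z1 - (\<Sum>i\<le>2*J. f i m * (z1 - m) ^ i / fact i))"
  proof -
    have "f (2 * j + 1) m = - (pochhammer (s - 1) (2 * j + 1) * of_nat (Suc n) powr (- s - of_nat (2 * j)))" for j
      by (simp add: f_def m_def algebra_simps)
    then have "(\<Sum>j<J. midpoint_coeff j * f (2 * j + 1) m) = 
      - (\<Sum>j<J. midpoint_coeff j * pochhammer (s - 1) (2 * j + 1) * of_nat (Suc n) powr (- s - of_nat (2 * j)))"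
      by (simp add: sum_negf mult.assoc)
    then show ?thesis
      using sum_symmetric_diff[of "\<lambda>i. f i m" J]
      unfolding z midpoint_error_def by (simp add: f_def z1_def z2_def)
  qed
  also have "norm \<dots> \<le> B / 2 + B / 2"
    by (rule order_trans[OF norm_triangle_ineq4 add_mono[OF T[OF zS(2) zn(2)] T[OF zS(1) zn(1)]]])
  finally show ?thesis by (simp add: B_def)
qed

lemma summable_shifted_powr:
  fixes p :: real assumes "p > 1"
  shows "summable (\<lambda>n. (real n + 1/2) powr (- p))"
proof (rule summable_comparison_test')
  have "summable (\<lambda>n. real n powr (- p))" using assms by (simp add: summable_real_powr_iff)
  then have "summable (\<lambda>n. real (Suc n) powr (- p))" by (subst summable_Suc_iff)
  then show "summable (\<lambda>n. 2 powr p * real (Suc n) powr (- p))" by (rule summable_mult)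
  fix n :: nat
  have "(real n + 1/2) powr (- p) \<le> (real (Suc n) / 2) powr (- p)"
    using assms by (intro powr_mono2') auto
  also have "\<dots> = 2 powr p * real (Suc n) powr (- p)"
    by (simp add: powr_divide powr_minus) (simp add: divide_inverse)
  finally show "norm ((real n + 1/2) powr (- p)) \<le> 2 powr p * real (Suc n) powr (- p)" by simp
qed

definition midpoint_series :: "nat \<Rightarrow> complex \<Rightarrow> complex" where
  "midpoint_series J s = (\<Sum>n. midpoint_error J n s)"

lemma midpoint_error_field_differentiable:
  "midpoint_error J n field_differentiable (at s)"
proof -
  have "(\<lambda>s. midpoint_error J n s) holomorphic_on UNIV"
    unfolding midpoint_error_def pochhammer_prod
    by (intro holomorphic_intros)
  then show ?thesis by (simp add: holomorphic_on_def)
qed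

text \<open>Locally uniform convergence of the errors. Termwise differentiation is recorded because
  \<gamma> will be read off from the derivative at 1.\<close>

lemma
  assumes s: "Re s > 1 - 2 * real J"
  shows midpoint_series_deriv_sums: "(\<lambda>n. deriv (midpoint_error J n) s) sums deriv (midpoint_series J) s"
    and midpoint_series_field_differentiable: "midpoint_series J field_differentiable (at s)"
proof -
  define S where "S = {s. Re s > 1 - 2 * real J}"
  have opS: "open S" unfolding S_def by (rule open_halfspace_Re_gt)
  obtain g g' where g: "\<And>x. x \<in> S \<Longrightarrow> (\<lambda>n. midpoint_error J n x) sums g x \<and>
      (\<lambda>n. deriv (midpoint_error J n) x) sums g' x \<and> (g has_field_derivative g' x) (at x)"
  proof -
    have "\<exists>g g'. \<forall>x\<in>S. (\<lambda>n. midpoint_error J n x) sums g x \<and>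
      (\<lambda>n. deriv (midpoint_error J n) x) sums g' x \<and> (g has_field_derivative g' x) (at x)"
    proof (rule series_and_derivative_comparison_complex[OF opS])
      show "(midpoint_error J n has_field_derivative deriv (midpoint_error J n) x) (at x)" for n x
        using midpoint_error_field_differentiable field_differentiable_derivI by blast
      fix x assume x: "x \<in> S"
      \<comment> \<open>Half the distance from x to the line Re s = 1 - 2J; on the ball of this
        radius the decay exponent Re y + 2J is still at least 1 + d.\<close>
      define d where "d = (Re x + 2 * real J - 1) / 2"
      have d: "d > 0" using x by (simp add: d_def S_def)
      define P where "P = (norm x + d + 1 + real (2 * J + 1)) ^ (2 * J + 1)"
      have P: "P \<ge> 0" unfolding P_def using d by simp
      have "norm (midpoint_error J n y) \<le> norm (complex_of_real (P * (real n + 1/2) powr (- (1 + d))))"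
        if y: "y \<in> ball x d" and n: "n \<ge> 1" for y n
      proof -
        have yn: "norm (y - x) < d" using y by (simp add: dist_norm norm_minus_commute)
        have Re_y: "Re y + 2 * real J \<ge> 1 + d"
          using abs_Re_le_cmod[of "y - x"] yn unfolding d_def minus_complex.sel by (simp add: field_simps)
        have "norm (midpoint_error J n y) \<le> norm (pochhammer (y - 1) (2 * J + 1)) * (real n + 1/2) powr (- Re y - 2 * real J)"
          by (rule norm_midpoint_error_le) (use Re_y d in simp)
        also have "\<dots> \<le> P * (real n + 1/2) powr (- Re y - 2 * real J)"
        proof (rule mult_right_mono)
          have "norm (y - 1) \<le> norm x + d + 1"
            using yn norm_triangle_ineq4[of y 1] norm_triangle_sub[of y x] by simp
          then show "norm (pochhammer (y - 1) (2 * J + 1)) \<le> P"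
            unfolding P_def by (intro order_trans[OF norm_pochhammer_le] power_mono) auto
        qed simp
        \<comment> \<open>n \<ge> 1 makes the base at least 1, so a smaller exponent gives a smaller
          power.\<close>
        also have "\<dots> \<le> P * (real n + 1/2) powr (- (1 + d))"
          using n Re_y P by (intro mult_left_mono powr_mono) auto
        finally show ?thesis using P by (simp add: norm_mult)
      qed
      then show "\<exists>d h. 0 < d \<and> summable h \<and> range h \<subseteq> \<real>\<^sub>\<ge>\<^sub>0 \<and>
         (\<forall>\<^sub>F n in sequentially. \<forall>y\<in>ball x d \<inter> S. cmod (midpoint_error J n y) \<le> cmod (h n))"
        using d P summable_shifted_powr[of "1 + d"]
        by (intro exI[of _ d] exI[of _ "\<lambda>n. complex_of_real (P * (real n + 1/2) powr (- (1 + d)))"])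
           (auto intro!: eventually_sequentiallyI[of 1] summable_mult summable_of_real simp del: of_real_mult)
    qed
    then show ?thesis using that by blast
  qed
  have sS: "s \<in> S" using s by (simp add: S_def)
  have eq: "midpoint_series J x = g x" if "x \<in> S" for x
    using g[OF that] by (simp add: midpoint_series_def sums_iff)
  have "(midpoint_series J has_field_derivative g' s) (at s)"
    by (rule has_field_derivative_transform_within_open[of g _ _ S]) (use g sS eq opS in auto)
  then show "(\<lambda>n. deriv (midpoint_error J n) s) sums deriv (midpoint_series J) s"
    "midpoint_series J field_differentiable (at s)"
    using g[OF sS] eq[OF sS] by (auto simp: DERIV_imp_deriv field_differentiable_def)
qed

lemma norm_midpoint_series_le:
  assumes a: "a > 1 - 2 * real J"
  obtains K where "K > 0" "\<And>s. a \<le> Re s \<Longrightarrow> Re s \<le> b \<Longrightarrow>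
    norm (midpoint_series J s) \<le> K * norm (pochhammer (s - 1) (2 * J + 1))"
proof -
  \<comment> \<open>The factor 2^(b - a) accounts for n = 0, where the base 1/2 is below 1 and
    lowering the exponent from -a to -Re s enlarges the power.\<close>
  define h where "h = (\<lambda>n. 2 powr (b - a) * (real n + 1/2) powr (- (a + 2 * real J)))"
  have h: "summable h"
    unfolding h_def by (intro summable_mult summable_shifted_powr) (use a in simp)
  have "norm (midpoint_series J s) \<le> (suminf h + 1) * norm (pochhammer (s - 1) (2 * J + 1))"
    if s: "a \<le> Re s" "Re s \<le> b" for s
  proof -
    have "norm (midpoint_error J n s) \<le> norm (pochhammer (s - 1) (2 * J + 1)) * h n" for n
    proof -
      have "norm (midpoint_error J n s) \<le> norm (pochhammer (s - 1) (2 * J + 1)) * (real n + 1/2) powr (- Re s - 2 * real J)"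
        by (rule norm_midpoint_error_le) (use s a in simp)
      also have "(real n + 1/2) powr (- Re s - 2 * real J) = (real n + 1/2) powr (a - Re s) * (real n + 1/2) powr (- (a + 2 * real J))"
        by (simp flip: powr_add)
      also have "\<dots> \<le> h n"
        unfolding h_def
      proof (rule mult_right_mono)
        have "(real n + 1/2) powr (a - Re s) \<le> (1/2) powr (a - Re s)"
          using s by (intro powr_mono2') auto
        also have "\<dots> = 2 powr (Re s - a)" by (simp add: powr_divide powr_minus_divide[symmetric])
        also have "\<dots> \<le> 2 powr (b - a)" using s by (intro powr_mono) auto
        finally show "(real n + 1/2) powr (a - Re s) \<le> 2 powr (b - a)" .
      qed simp
      finally show ?thesis by (simp add: mult_left_mono)
    qed
    then have "norm (midpoint_series J s) \<le> (\<Sum>n. norm (pochhammer (s - 1) (2 * J + 1)) * h n)"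
      unfolding midpoint_series_def by (intro norm_suminf_le summable_mult h)
    also have "\<dots> = suminf h * norm (pochhammer (s - 1) (2 * J + 1))"
      by (subst suminf_mult[OF h]) (rule mult.commute)
    also have "\<dots> \<le> (suminf h + 1) * norm (pochhammer (s - 1) (2 * J + 1))"
      by (simp add: algebra_simps)
    finally show ?thesis .
  qed
  moreover have "suminf h \<ge> 0" by (rule suminf_nonneg[OF h]) (simp add: h_def)
  ultimately show ?thesis by (intro that[of "suminf h + 1"]) auto
qed

section \<open>Continuation of the Dirichlet series to the plane\<close>

definition dirichlet_zeta :: "complex \<Rightarrow> complex" where
  "dirichlet_zeta s = (\<Sum>n. 1 / of_nat (Suc n) powr s)"

lemma dirichlet_zeta_summable_norm:
  assumes "Re s > 1" shows "summable (\<lambda>n. norm (1 / complex_of_real (real (Suc n)) powr s))"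
proof -
  have "summable (\<lambda>n. real n powr (- Re s))" using assms by (simp add: summable_real_powr_iff)
  then have "summable (\<lambda>n. real (Suc n) powr (- Re s))" by (subst summable_Suc_iff)
  moreover have "real (Suc n) powr (- Re s) = norm (1 / complex_of_real (real (Suc n)) powr s)" for n
    unfolding norm_divide by (subst norm_powr_real_powr) (simp_all add: powr_minus divide_inverse del: of_nat_Suc)
  ultimately show ?thesis by simp
qed

lemma dirichlet_zeta_sums:
  assumes "Re s > 1" shows "(\<lambda>n. 1 / of_nat (Suc n) powr s) sums dirichlet_zeta s"
  using summable_sums[OF summable_norm_cancel[OF dirichlet_zeta_summable_norm[OF assms]]]
  unfolding dirichlet_zeta_def of_real_of_nat_eq .

text \<open>The differences of x^(1 - s) at consecutive midpoints telescope to the single value at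
  1/2, since the terms at infinity vanish for Re s > 1.\<close>

lemma midpoint_series_eq_dirichlet:
  assumes s: "Re s > 1"
  shows "midpoint_series J s = (1/2) powr (1 - s)
    - (\<Sum>j<J. midpoint_coeff j * pochhammer (s - 1) (2 * j + 1) * dirichlet_zeta (s + of_nat (2 * j)))"
proof -
  have "(\<lambda>n. norm (complex_of_real (real n + 1/2) powr (1 - s))) \<longlonglongrightarrow> 0"
  proof -
    have "(\<lambda>n. (real n + 1/2) powr (1 - Re s)) \<longlonglongrightarrow> 0"
      by (rule tendsto_neg_powr) (use s in \<open>auto intro!: filterlim_at_top_mono[OF filterlim_real_sequentially]\<close>)
    then show ?thesis by (simp add: norm_powr_real_powr)
  qed
  then have "(\<lambda>n. complex_of_real (real n + 1/2) powr (1 - s)) \<longlonglongrightarrow> 0"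
    by (rule tendsto_norm_zero_cancel)
  from telescope_sums'[OF this]
  have t: "(\<lambda>n. complex_of_real (real n + 1/2) powr (1 - s) - complex_of_real (real n + 3/2) powr (1 - s)) sums (1/2) powr (1 - s)"
    by (simp add: add_ac)
  have "(\<lambda>n. midpoint_coeff j * pochhammer (s - 1) (2 * j + 1) * of_nat (Suc n) powr (- s - of_nat (2 * j)))
     sums (midpoint_coeff j * pochhammer (s - 1) (2 * j + 1) * dirichlet_zeta (s + of_nat (2 * j)))" for j
  proof -
    have "(\<lambda>n. 1 / of_nat (Suc n) powr (s + of_nat (2*j))) sums dirichlet_zeta (s + of_nat (2*j))"
      by (rule dirichlet_zeta_sums) (use s in simp)
    moreover have "1 / of_nat (Suc n) powr (s + of_nat (2*j)) = of_nat (Suc n) powr (- s - of_nat (2*j) :: complex)" for n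
      using powr_minus_divide[of "of_nat (Suc n)" "s + of_nat (2*j)"] by (simp add: algebra_simps)
    ultimately show ?thesis by (intro sums_mult) simp
  qed
  then have "(\<lambda>n. midpoint_error J n s) sums ((1/2) powr (1 - s)
    - (\<Sum>j<J. midpoint_coeff j * pochhammer (s - 1) (2 * j + 1) * dirichlet_zeta (s + of_nat (2 * j))))"
    unfolding midpoint_error_def by (intro sums_diff t sums_sum)
  then show ?thesis by (simp add: midpoint_series_def sums_iff)
qed

text \<open>Only shifts by 2j with j \<ge> 1 occur, so knowledge of \<open>Z\<close> to the right of
  3 - 2J suffices: one application moves the boundary two units to the left.\<close>

lemma zeta_recursion_rhs_holomorphic:
  assumes Z: "Z holomorphic_on {s. Re s > 3 - 2 * real J}"
  shows "(\<lambda>s. (1/2) powr (1 - s) - midpoint_series J s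
     - (\<Sum>j\<in>{1..<J}. midpoint_coeff j * pochhammer (s - 1) (2 * j) * Z (s + of_nat (2 * j)))) holomorphic_on {s. Re s > 1 - 2 * real J}"
proof -
  have 1: "midpoint_series J holomorphic_on {s. Re s > 1 - 2 * real J}"
    using midpoint_series_field_differentiable by (auto simp: holomorphic_on_def intro: field_differentiable_at_within)
  have 2: "(\<lambda>s. Z (s + of_nat (2 * j))) holomorphic_on {s. Re s > 1 - 2 * real J}" if "j \<in> {1..<J}" for j
    by (rule holomorphic_on_compose_gen[OF _ Z, unfolded o_def])
       (use that in \<open>auto intro!: holomorphic_intros\<close>)
  show ?thesis
    unfolding pochhammer_prod by (intro holomorphic_intros 1 2) auto
qed

text \<open>The previous identity solved for its j = 0 term. The last factor s - 1 + 2j of the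
  Pochhammer symbol is absorbed into \<open>Z (s + 2j)\<close>, which lowers its length from 2j + 1
  to 2j and removes the pole of the shifted zeta.\<close>

lemma zeta_recursion_dirichlet:
  assumes s: "Re s > 1" and J: "J \<ge> 1"
    and Z: "\<And>s. Re s > 1 \<Longrightarrow> Z s = (s - 1) * dirichlet_zeta s"
  shows "Z s = (1/2) powr (1 - s) - midpoint_series J s
     - (\<Sum>j\<in>{1..<J}. midpoint_coeff j * pochhammer (s - 1) (2 * j) * Z (s + of_nat (2 * j)))"
proof -
  have "{..<J} = insert 0 {1..<J}" using J by auto
  then have "(\<Sum>j<J. midpoint_coeff j * pochhammer (s - 1) (2 * j + 1) * dirichlet_zeta (s + of_nat (2 * j)))
    = (s - 1) * dirichlet_zeta s + (\<Sum>j\<in>{1..<J}. midpoint_coeff j * pochhammer (s - 1) (2 * j + 1) * dirichlet_zeta (s + of_nat (2 * j)))"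
    by (simp add: midpoint_coeff_def)
  also have "(\<Sum>j\<in>{1..<J}. midpoint_coeff j * pochhammer (s - 1) (2 * j + 1) * dirichlet_zeta (s + of_nat (2 * j)))
     = (\<Sum>j\<in>{1..<J}. midpoint_coeff j * pochhammer (s - 1) (2 * j) * Z (s + of_nat (2 * j)))"
  proof (rule sum.cong)
    fix j assume "j \<in> {1..<J}"
    have "Z (s + of_nat (2 * j)) = (s - 1 + of_nat (2 * j)) * dirichlet_zeta (s + of_nat (2 * j))"
      using Z[of "s + of_nat (2 * j)"] s by (simp add: algebra_simps)
    then show "midpoint_coeff j * pochhammer (s - 1) (2 * j + 1) * dirichlet_zeta (s + of_nat (2 * j))
      = midpoint_coeff j * pochhammer (s - 1) (2 * j) * Z (s + of_nat (2 * j))"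
      by (simp add: pochhammer_Suc del: of_nat_mult)
  qed simp
  finally have D: "(\<Sum>j<J. midpoint_coeff j * pochhammer (s - 1) (2 * j + 1) * dirichlet_zeta (s + of_nat (2 * j)))
    = (s - 1) * dirichlet_zeta s + (\<Sum>j\<in>{1..<J}. midpoint_coeff j * pochhammer (s - 1) (2 * j) * Z (s + of_nat (2 * j)))" .
  show ?thesis unfolding Z[OF s] midpoint_series_eq_dirichlet[OF s] D by simp
qed

lemma zeta_halfplane_continuation:
  "\<exists>Z. Z holomorphic_on {s. Re s > 1 - 2 * real (Suc J)} \<and> (\<forall>s. Re s > 1 \<longrightarrow> Z s = (s - 1) * dirichlet_zeta s)"
proof (induction J)
  case 0
  let ?Z = "\<lambda>s. (1/2) powr (1 - s) - midpoint_series 1 s"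
  have "?Z holomorphic_on {s. Re s > 1 - 2 * real 1}"
    using midpoint_series_field_differentiable[of 1]
    by (intro holomorphic_intros) (auto simp: holomorphic_on_def intro: field_differentiable_at_within)
  moreover have "?Z s = (s - 1) * dirichlet_zeta s" if "Re s > 1" for s
    using midpoint_series_eq_dirichlet[OF that, of 1] by (simp add: midpoint_coeff_def)
  ultimately show ?case by (intro exI[of _ ?Z]) auto
next
  case (Suc J)
  then obtain Z where Z: "Z holomorphic_on {s. Re s > 1 - 2 * real (Suc J)}"
    "\<And>s. Re s > 1 \<Longrightarrow> Z s = (s - 1) * dirichlet_zeta s" by blast
  let ?J = "Suc (Suc J)"
  let ?Z = "\<lambda>s. (1/2) powr (1 - s) - midpoint_series ?J s
     - (\<Sum>j\<in>{1..<?J}. midpoint_coeff j * pochhammer (s - 1) (2 * j) * Z (s + of_nat (2 * j)))"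
  have "?Z holomorphic_on {s. Re s > 1 - 2 * real ?J}"
    by (rule zeta_recursion_rhs_holomorphic) (use Z(1) in \<open>simp add: algebra_simps\<close>)
  moreover have "?Z s = (s - 1) * dirichlet_zeta s" if "Re s > 1" for s
    using zeta_recursion_dirichlet[OF that _ Z(2), of ?J] Z(2)[OF that] by simp
  ultimately show ?case by (intro exI[of _ ?Z]) blast
qed

lemma halfplane_identity:
  assumes "f holomorphic_on {s. Re s > a}" "g holomorphic_on {s. Re s > a}" "a \<le> 1"
    "\<And>s. Re s > 1 \<Longrightarrow> f s = g s" "Re s > a"
  shows "f s = g s"
proof (rule analytic_continuation_open[of "{s. Re s > 1}" "{s. Re s > a}" f g s])
  show "{s. Re s > 1} \<noteq> {}" by (auto intro!: exI[of _ 2])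
  show "connected {s. Re s > a}" by (intro convex_connected convex_halfspace_Re_gt)
qed (use assms in \<open>auto simp: open_halfspace_Re_gt\<close>)

lemma zeta_entire_continuation:
  "\<exists>Z. Z holomorphic_on UNIV \<and> (\<forall>s. Re s > 1 \<longrightarrow> Z s = (s - 1) * dirichlet_zeta s)"
proof -
  obtain Z where Z: "\<And>J. Z J holomorphic_on {s. Re s > 1 - 2 * real (Suc J)}"
    "\<And>J s. Re s > 1 \<Longrightarrow> Z J s = (s - 1) * dirichlet_zeta s"
    using zeta_halfplane_continuation by metis
  \<comment> \<open>As for \<open>cderiv0\<close>, the index depends on \<open>s\<close>, but the
    half-plane functions agree on overlaps by the identity theorem.\<close>
  define G where "G = (\<lambda>s. Z (nat \<lceil>\<bar>Re s\<bar>\<rceil>) s)"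
  have large: "x > 1 - 2 * real (Suc (nat \<lceil>\<bar>x\<bar>\<rceil>))" for x :: real
    using real_nat_ceiling_ge[of "\<bar>x\<bar>"] by (smt (verit) of_nat_Suc)
  have eq: "Z J s = Z K s" if "Re s > 1 - 2 * real (Suc J)" "J \<le> K" for J K s
    by (rule halfplane_identity[of _ "1 - 2 * real (Suc J)"])
       (use that Z in \<open>auto intro: holomorphic_on_subset[OF Z(1)]\<close>)
  have G: "G s = Z J s" if s: "Re s > 1 - 2 * real (Suc J)" for s J
  proof -
    show ?thesis
    proof (cases "J \<le> nat \<lceil>\<bar>Re s\<bar>\<rceil>")
      case True
      show ?thesis unfolding G_def by (rule eq[OF s True, symmetric])
    next
      case False
      show ?thesis unfolding G_def by (rule eq[OF large less_imp_le]) (use False in \<open>simp only: not_le\<close>)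
    qed
  qed
  have "G field_differentiable (at s)" for s
  proof -
    define J where "J = nat \<lceil>\<bar>Re s\<bar>\<rceil>"
    have J: "Re s > 1 - 2 * real (Suc J)" unfolding J_def by (rule large)
    have "G holomorphic_on {s. Re s > 1 - 2 * real (Suc J)}"
      using holomorphic_transform[OF Z(1)[of J]] G by simp
    then show ?thesis using J open_halfspace_Re_gt
      by (auto simp: holomorphic_on_open field_differentiable_def)
  qed
  then have "G holomorphic_on UNIV" by (simp add: holomorphic_on_def)
  moreover have "G s = (s - 1) * dirichlet_zeta s" if "Re s > 1" for s
    using G[of 0 s] Z(2)[of s 0] that by simp
  ultimately show ?thesis by blast
qed

text \<open>The recursion relates \<open>\<zeta>(s)\<close> to \<open>\<zeta>(s + 2j)\<close> only, so the trivial zeros follow by induction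
  from \<open>\<zeta>(0) = -1/2\<close>. Working with the entire function \<open>(s - 1) \<zeta>(s)\<close> avoids the poles of the shifted terms.\<close>

definition zeta_reg :: "complex \<Rightarrow> complex" where
  "zeta_reg s = (if s = 1 then 1 else (s - 1) * riemann_zeta s)"

text \<open>The quotient Z(s) / (s - 1) of the entire continuation satisfies the description of
  zeta, and connectedness of the punctured plane gives uniqueness. It remains to see that Z(1) is
  the value 1 built into \<open>zeta_reg\<close>.\<close>

lemma
  shows zeta_reg_holomorphic: "zeta_reg holomorphic_on UNIV"
    and zeta_reg_eq_dirichlet: "Re s > 1 \<Longrightarrow> zeta_reg s = (s - 1) * dirichlet_zeta s"
    and riemann_zeta_eq_dirichlet: "Re s > 1 \<Longrightarrow> riemann_zeta s = dirichlet_zeta s"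
proof -
  obtain Z where Z: "Z holomorphic_on UNIV" "\<And>s. Re s > 1 \<Longrightarrow> Z s = (s - 1) * dirichlet_zeta s"
    using zeta_entire_continuation by blast
  \<comment> \<open>The value 0 at the pole is the dummy value prescribed by the
    description.\<close>
  define G where "G = (\<lambda>s. if s = 1 then 0 else Z s / (s - 1))"
  have G_hol: "G holomorphic_on (- {1})"
  proof -
    have "(\<lambda>s. Z s / (s - 1)) holomorphic_on (- {1})"
      using Z(1) by (intro holomorphic_intros) (auto intro: holomorphic_on_subset)
    then show ?thesis by (rule holomorphic_transform) (auto simp: G_def)
  qed
  have G_eq: "G s = dirichlet_zeta s" if "Re s > 1" for s
    using Z(2)[OF that] that by (auto simp: G_def)
  have rz: "riemann_zeta = G"
    unfolding riemann_zeta_def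
  proof (rule the_equality)
    show "G holomorphic_on - {1} \<and> (\<forall>s. 1 < Re s \<longrightarrow> (\<lambda>n. 1 / of_nat (Suc n) powr s) sums G s) \<and> G 1 = 0"
      using G_hol G_eq dirichlet_zeta_sums by (auto simp: G_def simp del: of_nat_Suc)
    fix H assume H: "H holomorphic_on - {1} \<and> (\<forall>s. 1 < Re s \<longrightarrow> (\<lambda>n. 1 / of_nat (Suc n) powr s) sums H s) \<and> H 1 = 0"
    show "H = G"
    proof
      fix s
      show "H s = G s"
      proof (cases "s = 1")
        case False
        have eq: "H z = G z" if "Re z > 1" for z
          using H G_eq[OF that] dirichlet_zeta_sums[OF that] that sums_unique2 by metis
        show ?thesis
          by (rule analytic_continuation_open[of "{s. Re s > 1}" "- {1}" H G s])
             (use H G_hol eq False in \<open>auto simp: open_halfspace_Re_gt intro!: exI[of _ 2] connected_punctured_universe\<close>)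
      qed (use H in \<open>simp add: G_def\<close>)
    qed
  qed
  show "Re s > 1 \<Longrightarrow> riemann_zeta s = dirichlet_zeta s" using rz G_eq by simp
  have Z_eq: "Z s = (1/2) powr (1 - s) - midpoint_series 1 s" if "Re s > -1" for s
  proof (rule halfplane_identity[of Z "-1"])
    have "midpoint_series 1 holomorphic_on {s. Re s > -1}"
      using midpoint_series_field_differentiable[of 1] by (auto simp: holomorphic_on_def intro: field_differentiable_at_within)
    then show "(\<lambda>s. (1/2) powr (1 - s) - midpoint_series 1 s) holomorphic_on {s. Re s > -1}"
      by (intro holomorphic_intros) auto
    show "Z s = (1/2) powr (1 - s) - midpoint_series 1 s" if "Re s > 1" for s
      using zeta_recursion_dirichlet[OF that _ Z(2), of 1] by simp
  qed (use Z that in \<open>auto intro: holomorphic_on_subset\<close>)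
  \<comment> \<open>At s = 1 the error bound contains \<open>pochhammer 0 3 = 0\<close>, so every
    error vanishes and Z(1) = (1/2)^0 = 1: the residue of zeta.\<close>
  have "midpoint_error 1 n 1 = 0" for n
    using norm_midpoint_error_le[of 1 1 n] by (simp add: pochhammer_0_left)
  then have "midpoint_series 1 1 = 0" by (simp add: midpoint_series_def)
  then have "Z 1 = 1" using Z_eq[of 1] by simp
  then have zr: "zeta_reg = Z" by (auto simp: zeta_reg_def rz G_def fun_eq_iff)
  show "zeta_reg holomorphic_on UNIV" "Re s > 1 \<Longrightarrow> zeta_reg s = (s - 1) * dirichlet_zeta s"
    using zr Z by auto
qed

section \<open>The recursion on half-planes and special values of zeta\<close>

lemma zeta_reg_recursion:
  assumes J: "J \<ge> 1" and s: "Re s > 1 - 2 * real J"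
  shows "zeta_reg s = (1/2) powr (1 - s) - midpoint_series J s
     - (\<Sum>j\<in>{1..<J}. midpoint_coeff j * pochhammer (s - 1) (2 * j) * zeta_reg (s + of_nat (2 * j)))"
proof (rule halfplane_identity[of zeta_reg "1 - 2 * real J"])
  show "(\<lambda>s. (1/2) powr (1 - s) - midpoint_series J s
     - (\<Sum>j\<in>{1..<J}. midpoint_coeff j * pochhammer (s - 1) (2 * j) * zeta_reg (s + of_nat (2 * j))))
      holomorphic_on {s. Re s > 1 - 2 * real J}"
    by (rule zeta_recursion_rhs_holomorphic) (rule holomorphic_on_subset[OF zeta_reg_holomorphic], simp)
  show "zeta_reg s = (1/2) powr (1 - s) - midpoint_series J s
     - (\<Sum>j\<in>{1..<J}. midpoint_coeff j * pochhammer (s - 1) (2 * j) * zeta_reg (s + of_nat (2 * j)))" if "Re s > 1" for s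
    by (rule zeta_recursion_dirichlet[OF that J zeta_reg_eq_dirichlet])
qed (use s in \<open>auto intro: holomorphic_on_subset[OF zeta_reg_holomorphic]\<close>)

lemma zeta_reg_1: "zeta_reg 1 = 1"
  by (simp add: zeta_reg_def)

text \<open>The recursion with J = 1 is differentiated at 1: the power of 1/2 contributes ln 2, and
  the error series, differentiated termwise, contributes ln 2 - \<gamma>, which is
  subtracted.\<close>

lemma deriv_zeta_reg_1: "(zeta_reg has_field_derivative euler_mascheroni) (at 1)"
proof -
  have d: "((\<lambda>s. c powr (1 - s)) has_field_derivative - Ln c) (at 1)" if "c \<noteq> 0" for c :: complex
    using that by (auto intro!: derivative_eq_intros simp: powr_def)
  have dn: "(midpoint_error 1 n has_field_derivative
      complex_of_real (ln (real n + 3/2) - ln (real n + 1/2) - 1 / real (Suc n))) (at 1)" for n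
  proof -
    have "((\<lambda>s. (s - 1) * of_nat (Suc n) powr (- s)) has_field_derivative of_nat (Suc n) powr (-1)) (at (1::complex))"
    proof -
      have "((\<lambda>s. of_nat (Suc n) powr (- s)) has_field_derivative - Ln (of_nat (Suc n)) * of_nat (Suc n) powr (- 1)) (at (1::complex))"
        unfolding powr_def by (auto intro!: derivative_eq_intros simp del: of_nat_Suc)
      moreover have "((\<lambda>s. s - 1) has_field_derivative 1) (at (1::complex))"
        by (auto intro!: derivative_eq_intros)
      ultimately show ?thesis
        using DERIV_mult by fastforce
    qed
    moreover have "of_nat (Suc n) powr (-1) = complex_of_real (1 / real (Suc n))"
      by (simp add: powr_minus_divide del: of_nat_Suc)
    moreover have "complex_of_real (real n + 1/2) \<noteq> 0" "complex_of_real (real n + 3/2) \<noteq> 0"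
      unfolding of_real_eq_0_iff by linarith+
    ultimately have "((\<lambda>s. complex_of_real (real n + 1/2) powr (1 - s) - complex_of_real (real n + 3/2) powr (1 - s)
       - (s - 1) * of_nat (Suc n) powr (- s)) has_field_derivative
        (- Ln (complex_of_real (real n + 1/2)) - - Ln (complex_of_real (real n + 3/2)) - complex_of_real (1 / real (Suc n)))) (at 1)"
      by (intro DERIV_diff d) simp_all
    moreover have "- Ln (complex_of_real (real n + 1/2)) - - Ln (complex_of_real (real n + 3/2)) - complex_of_real (1 / real (Suc n))
       = complex_of_real (ln (real n + 3/2) - ln (real n + 1/2) - 1 / real (Suc n))"
      by (subst (1 2) Ln_of_real) auto
    moreover have "midpoint_error 1 n = (\<lambda>s. complex_of_real (real n + 1/2) powr (1 - s) - complex_of_real (real n + 3/2) powr (1 - s)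
       - (s - 1) * of_nat (Suc n) powr (- s))"
      by (auto simp: midpoint_error_def midpoint_coeff_def fun_eq_iff)
    ultimately show ?thesis by simp
  qed
  have "(\<lambda>n. deriv (midpoint_error 1 n) 1) sums deriv (midpoint_series 1) 1"
    by (rule midpoint_series_deriv_sums) simp
  then have s1: "(\<lambda>n. complex_of_real (ln (real n + 3/2) - ln (real n + 1/2) - 1 / real (Suc n))) sums deriv (midpoint_series 1) 1"
    unfolding DERIV_imp_deriv[OF dn] .
  have "(\<lambda>n. ln (real n + 3/2) - ln (real n + 1/2) - 1 / real (Suc n)) sums (ln 2 - euler_mascheroni)"
  proof -
    \<comment> \<open>The logarithms telescope and the reciprocals form \<open>harm N\<close>; the
      start -ln(1/2) is the source of ln 2.\<close>
    have ps: "(\<Sum>n<N. ln (real n + 3/2) - ln (real n + 1/2) - 1 / real (Suc n)) = ln (real N + 1/2) + ln 2 - harm N" for N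
    proof (induction N)
      case 0
      have "ln (1/2 :: real) = - ln 2" by (simp add: ln_div)
      then show ?case by (simp add: harm_def)
    next
      case (Suc N)
      have "real (Suc N) + 1/2 = real N + 3/2" by simp
      then show ?case using Suc by (simp only: sum.lessThan_Suc harm_Suc inverse_eq_divide)
    qed
    have "(\<lambda>N. ln 2 - (harm N - ln (real N)) + (ln (real N + 1/2) - ln (real N))) \<longlonglongrightarrow> ln 2 - euler_mascheroni + 0"
    proof (intro tendsto_intros euler_mascheroni_LIMSEQ)
      have "(\<lambda>N. ln (1 + (1/2) / real N)) \<longlonglongrightarrow> ln (1 + 0)"
        by (intro tendsto_intros lim_const_over_n | simp)+
      then have "(\<lambda>N. ln (1 + (1/2) / real N)) \<longlonglongrightarrow> 0" by simp
      then show "(\<lambda>N. ln (real N + 1/2) - ln (real N)) \<longlonglongrightarrow> 0"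
      proof (rule Lim_transform_eventually)
        show "\<forall>\<^sub>F N in sequentially. ln (1 + (1/2) / real N) = ln (real N + 1/2) - ln (real N)"
          using eventually_gt_at_top[of 0]
        proof eventually_elim
          case (elim N)
          have "1 + (1/2) / real N = (real N + 1/2) / real N" using elim by (simp add: field_simps)
          moreover have "ln ((real N + 1/2) / real N) = ln (real N + 1/2) - ln (real N)"
            using elim by (intro ln_divide_pos) auto
          ultimately show ?case by metis
        qed
      qed
    qed
    then show ?thesis unfolding sums_def ps by (simp add: algebra_simps)
  qed
  then have "(\<lambda>n. complex_of_real (ln (real n + 3/2) - ln (real n + 1/2) - 1 / real (Suc n))) sums complex_of_real (ln 2 - euler_mascheroni)"
    by (subst sums_of_real_iff)
  then have dm: "deriv (midpoint_series 1) 1 = complex_of_real (ln 2 - euler_mascheroni)"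
    using s1 sums_unique2 by blast
  have "(midpoint_series 1 has_field_derivative complex_of_real (ln 2 - euler_mascheroni)) (at 1)"
    unfolding dm[symmetric] by (rule field_differentiable_derivI, rule midpoint_series_field_differentiable) simp
  then have "((\<lambda>s. (1/2) powr (1 - s) - midpoint_series 1 s) has_field_derivative (- Ln (1/2) - complex_of_real (ln 2 - euler_mascheroni))) (at 1)"
    by (intro DERIV_diff d) auto
  moreover have "Ln (1/2 :: complex) = complex_of_real (ln (1/2))"
    using Ln_of_real[of "1/2"] by simp
  ultimately have "((\<lambda>s. (1/2) powr (1 - s) - midpoint_series 1 s) has_field_derivative euler_mascheroni) (at 1)"
    by (simp add: ln_div)
  then show ?thesis
    by (rule has_field_derivative_transform_within_open[of _ _ _ "{s. Re s > -1}"])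
       (use zeta_reg_recursion[of 1] in \<open>auto simp: open_halfspace_Re_gt\<close>)
qed

text \<open>At s = -2m with J = m + 1 the Pochhammer symbol in the error bound runs through 0, so
  the infinite series drops out and a finite exact recursion remains.\<close>

lemma zeta_reg_recursion_neg_even:
  "zeta_reg (- of_nat (2 * m)) = (1/2) ^ (2 * m + 1)
     - (\<Sum>j\<in>{1..m}. midpoint_coeff j * pochhammer (- of_nat (2 * m + 1)) (2 * j) * zeta_reg (- of_nat (2 * (m - j))))"
proof -
  let ?s = "- of_nat (2 * m) :: complex"
  have 0: "?s - 1 = - of_nat (2 * m + 1)" by simp
  have "pochhammer (?s - 1) (2 * Suc m + 1) = 0"
    unfolding 0 by (rule pochhammer_of_nat_eq_0_lemma) simp
  then have "midpoint_error (Suc m) n ?s = 0" for n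
    using norm_midpoint_error_le[of ?s "Suc m" n] by simp
  then have 1: "midpoint_series (Suc m) ?s = 0" by (simp add: midpoint_series_def)
  have 2: "(1/2) powr (1 - ?s) = (1/2) ^ (2 * m + 1)"
  proof -
    have "1 - ?s = of_nat (2 * m + 1)" by simp
    then show ?thesis by (metis powr_nat' add_is_0 one_neq_zero)
  qed
  have 3: "(\<Sum>j\<in>{1..<Suc m}. midpoint_coeff j * pochhammer (- of_nat (2 * m + 1)) (2 * j) * zeta_reg (?s + of_nat (2 * j)))
     = (\<Sum>j\<in>{1..m}. midpoint_coeff j * pochhammer (- of_nat (2 * m + 1)) (2 * j) * zeta_reg (- of_nat (2 * (m - j))))"
    by (intro sum.cong) (auto simp: of_nat_diff algebra_simps)
  show ?thesis
    using zeta_reg_recursion[of "Suc m" ?s] unfolding 0 1 2 3 by simp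
qed

lemma zeta_reg_0: "zeta_reg 0 = 1/2"
  using zeta_reg_recursion_neg_even[of 0] by simp

text \<open>By induction only j = m survives in the sum. It carries the value 1/2 at 0, and its
  Pochhammer symbol equals (2m + 1)!, so it is (1/2)^(2m + 1) and cancels the leading term.\<close>

lemma zeta_reg_neg_even: "m \<ge> 1 \<Longrightarrow> zeta_reg (- of_nat (2 * m)) = 0"
proof (induction m rule: less_induct)
  case (less m)
  have "(\<Sum>j\<in>{1..m}. midpoint_coeff j * pochhammer (- of_nat (2 * m + 1)) (2 * j) * zeta_reg (- of_nat (2 * (m - j))))
      = (\<Sum>j\<in>{m}. midpoint_coeff j * pochhammer (- of_nat (2 * m + 1)) (2 * j) * zeta_reg (- of_nat (2 * (m - j))))"
    by (rule sum.mono_neutral_right) (use less in \<open>auto simp del: of_nat_mult of_nat_diff\<close>)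
  also have "\<dots> = (1/2) ^ (2 * m) / fact (2 * m + 1) * pochhammer (- of_nat (2 * m + 1)) (2 * m) * (1/2)"
    by (simp add: midpoint_coeff_def zeta_reg_0)
  also have "pochhammer (- of_nat (2 * m + 1)) (2 * m) = (fact (2 * m + 1) :: complex)"
  proof -
    have "pochhammer (- of_nat (2 * m + 1)) (2 * m + 1) = (-1) ^ (2 * m + 1) * (fact (2 * m + 1) :: complex)"
      by (rule pochhammer_same)
    moreover have "pochhammer (- of_nat (2 * m + 1)) (2 * m + 1) = - pochhammer (- of_nat (2 * m + 1) :: complex) (2 * m)"
      unfolding Suc_eq_plus1[symmetric] pochhammer_Suc by (simp add: algebra_simps)
    ultimately show ?thesis by (simp del: fact_Suc)
  qed
  also have "(1/2) ^ (2 * m) / fact (2 * m + 1) * fact (2 * m + 1) * (1/2) = ((1/2) ^ (2 * m + 1) :: complex)"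
    by (simp del: fact_Suc)
  finally show ?case
    using zeta_reg_recursion_neg_even[of m] by simp
qed

section \<open>Polynomial growth of zeta on vertical strips\<close>

definition poly_bounded_strip :: "real \<Rightarrow> real \<Rightarrow> (complex \<Rightarrow> complex) \<Rightarrow> bool" where
  "poly_bounded_strip a b f \<longleftrightarrow> (\<exists>C p. \<forall>s. a \<le> Re s \<longrightarrow> Re s \<le> b \<longrightarrow> norm (f s) \<le> C * (1 + norm s) ^ p)"

lemma poly_bounded_stripI:
  "(\<And>s. a \<le> Re s \<Longrightarrow> Re s \<le> b \<Longrightarrow> norm (f s) \<le> C * (1 + norm s) ^ p) \<Longrightarrow> poly_bounded_strip a b f"
  unfolding poly_bounded_strip_def by blast

lemma poly_bounded_stripE:
  assumes "poly_bounded_strip a b f"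
  obtains C p where "C > 0" "\<And>s. a \<le> Re s \<Longrightarrow> Re s \<le> b \<Longrightarrow> norm (f s) \<le> C * (1 + norm s) ^ p"
proof -
  obtain C p where C: "\<And>s. a \<le> Re s \<Longrightarrow> Re s \<le> b \<Longrightarrow> norm (f s) \<le> C * (1 + norm s) ^ p"
    using assms unfolding poly_bounded_strip_def by blast
  have "norm (f s) \<le> max 1 C * (1 + norm s) ^ p" if "a \<le> Re s" "Re s \<le> b" for s
    by (rule order_trans[OF C[OF that]]) (auto intro!: mult_right_mono)
  then show ?thesis by (intro that[of "max 1 C" p]) auto
qed

lemma poly_bounded_strip_diff:
  assumes "poly_bounded_strip a b f" "poly_bounded_strip a b g"
  shows "poly_bounded_strip a b (\<lambda>s. f s - g s)"
proof -
  obtain C p where C: "C > 0" "\<And>s. a \<le> Re s \<Longrightarrow> Re s \<le> b \<Longrightarrow> norm (f s) \<le> C * (1 + norm s) ^ p"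
    using assms(1) by (rule poly_bounded_stripE) blast
  obtain D q where D: "D > 0" "\<And>s. a \<le> Re s \<Longrightarrow> Re s \<le> b \<Longrightarrow> norm (g s) \<le> D * (1 + norm s) ^ q"
    using assms(2) by (rule poly_bounded_stripE) blast
  show ?thesis
  proof (rule poly_bounded_stripI)
    fix s assume s: "a \<le> Re s" "Re s \<le> b"
    have "norm (f s - g s) \<le> C * (1 + norm s) ^ p + D * (1 + norm s) ^ q"
      by (rule order_trans[OF norm_triangle_ineq4 add_mono[OF C(2)[OF s] D(2)[OF s]]])
    also have "\<dots> \<le> C * (1 + norm s) ^ (p + q) + D * (1 + norm s) ^ (p + q)"
      using C D by (intro add_mono mult_left_mono power_increasing) auto
    finally show "norm (f s - g s) \<le> (C + D) * (1 + norm s) ^ (p + q)" by (simp add: algebra_simps)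
  qed
qed

lemma poly_bounded_strip_mult:
  assumes "poly_bounded_strip a b f" "poly_bounded_strip a b g"
  shows "poly_bounded_strip a b (\<lambda>s. f s * g s)"
proof -
  obtain C p where C: "C > 0" "\<And>s. a \<le> Re s \<Longrightarrow> Re s \<le> b \<Longrightarrow> norm (f s) \<le> C * (1 + norm s) ^ p"
    using assms(1) by (rule poly_bounded_stripE) blast
  obtain D q where D: "D > 0" "\<And>s. a \<le> Re s \<Longrightarrow> Re s \<le> b \<Longrightarrow> norm (g s) \<le> D * (1 + norm s) ^ q"
    using assms(2) by (rule poly_bounded_stripE) blast
  show ?thesis
  proof (rule poly_bounded_stripI)
    fix s assume s: "a \<le> Re s" "Re s \<le> b"
    have "norm (f s * g s) \<le> (C * (1 + norm s) ^ p) * (D * (1 + norm s) ^ q)"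
      unfolding norm_mult using C D s by (intro mult_mono) (auto intro!: mult_nonneg_nonneg)
    then show "norm (f s * g s) \<le> (C * D) * (1 + norm s) ^ (p + q)" by (simp add: power_add mult_ac)
  qed
qed

lemma poly_bounded_strip_const: "poly_bounded_strip a b (\<lambda>s. c)"
  by (rule poly_bounded_stripI[where C = "norm c" and p = 0]) simp

lemma poly_bounded_strip_sum:
  assumes "\<And>i. i \<in> A \<Longrightarrow> poly_bounded_strip a b (f i)"
  shows "poly_bounded_strip a b (\<lambda>s. \<Sum>i\<in>A. f i s)"
  using assms
proof (induction A rule: infinite_finite_induct)
  case (insert x A)
  have "poly_bounded_strip a b (\<lambda>s. f x s - (-1) * (\<Sum>i\<in>A. f i s))"
    using insert by (intro poly_bounded_strip_diff poly_bounded_strip_mult poly_bounded_strip_const) auto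
  then show ?case using insert by simp
qed (auto intro: poly_bounded_strip_const)

lemma poly_bounded_strip_pochhammer: "poly_bounded_strip a b (\<lambda>s. pochhammer (s - 1) n)"
proof (rule poly_bounded_stripI)
  fix s :: complex
  have "norm (pochhammer (s - 1) n) \<le> (norm (s - 1) + real n) ^ n" by (rule norm_pochhammer_le)
  also have "\<dots> \<le> ((real n + 1) * (1 + norm s)) ^ n"
    proof (rule power_mono)
    have "(real n + 1) * (1 + norm s) = 1 + real n + norm s + real n * norm s" by (simp add: algebra_simps)
    moreover have "0 \<le> real n * norm s" by simp
    moreover have "norm (s - 1) \<le> norm s + 1" using norm_triangle_ineq4[of s 1] by simp
    ultimately show "norm (s - 1) + real n \<le> (real n + 1) * (1 + norm s)" by linarith
  qed simp
  finally show "norm (pochhammer (s - 1) n) \<le> (real n + 1) ^ n * (1 + norm s) ^ n"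
    by (simp add: power_mult_distrib)
qed

lemma poly_bounded_strip_shift:
  assumes "poly_bounded_strip a' b' f" "a' \<le> a + real n" "b + real n \<le> b'"
  shows "poly_bounded_strip a b (\<lambda>s. f (s + of_nat n))"
proof -
  obtain C p where C: "C > 0" "\<And>s. a' \<le> Re s \<Longrightarrow> Re s \<le> b' \<Longrightarrow> norm (f s) \<le> C * (1 + norm s) ^ p"
    using assms(1) by (rule poly_bounded_stripE) blast
  show ?thesis
  proof (rule poly_bounded_stripI)
    fix s assume s: "a \<le> Re s" "Re s \<le> b"
    have "norm (f (s + of_nat n)) \<le> C * (1 + norm (s + of_nat n)) ^ p"
      using s assms by (intro C(2)) auto
    also have "\<dots> \<le> C * ((real n + 1) * (1 + norm s)) ^ p"
      proof (intro mult_left_mono power_mono)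
      have "(real n + 1) * (1 + norm s) = 1 + real n + norm s + real n * norm s" by (simp add: algebra_simps)
      moreover have "0 \<le> real n * norm s" by simp
      moreover have "norm (s + of_nat n) \<le> norm s + real n" using norm_triangle_ineq[of s "of_nat n"] by simp
      ultimately show "1 + norm (s + of_nat n) \<le> (real n + 1) * (1 + norm s)" by linarith
    qed (use C in auto)
    finally show "norm (f (s + of_nat n)) \<le> (C * (real n + 1) ^ p) * (1 + norm s) ^ p"
      by (simp add: power_mult_distrib mult_ac)
  qed
qed

lemma poly_bounded_strip_midpoint_series:
  assumes "a > 1 - 2 * real J"
  shows "poly_bounded_strip a b (midpoint_series J)"
proof -
  obtain K where K: "K > 0" "\<And>s. a \<le> Re s \<Longrightarrow> Re s \<le> b \<Longrightarrow>
    norm (midpoint_series J s) \<le> K * norm (pochhammer (s - 1) (2 * J + 1))"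
    using norm_midpoint_series_le[OF assms] by blast
  obtain C p where C: "C > 0" "\<And>s. a \<le> Re s \<Longrightarrow> Re s \<le> b \<Longrightarrow> norm (pochhammer (s - 1) (2 * J + 1)) \<le> C * (1 + norm s) ^ p"
    using poly_bounded_strip_pochhammer[of a b "2 * J + 1"] by (rule poly_bounded_stripE) blast
  show ?thesis
  proof (rule poly_bounded_stripI)
    fix s assume s: "a \<le> Re s" "Re s \<le> b"
    have "norm (midpoint_series J s) \<le> K * (C * (1 + norm s) ^ p)"
      by (rule order_trans[OF K(2)[OF s] mult_left_mono[OF C(2)[OF s]]]) (use K in simp)
    then show "norm (midpoint_series J s) \<le> (K * C) * (1 + norm s) ^ p" by (simp add: mult.assoc)
  qed
qed

text \<open>Every ingredient of the recursion grows at most polynomially on the strip, the error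
  series because its bound is a Pochhammer symbol times a constant.\<close>

lemma poly_bounded_strip_zeta_reg_step:
  assumes a: "a > 1 - 2 * real (Suc J)"
    and IH: "\<And>j. j \<in> {1..J} \<Longrightarrow> poly_bounded_strip a b (\<lambda>s. zeta_reg (s + of_nat (2 * j)))"
  shows "poly_bounded_strip a b zeta_reg"
proof -
  have 1: "poly_bounded_strip a b (\<lambda>s. (1/2) powr (1 - s))"
  proof (rule poly_bounded_stripI)
    fix s assume "Re s \<le> b"
    then show "norm ((1/2) powr (1 - s)) \<le> 2 powr (b - 1) * (1 + norm s) ^ 0"
      using norm_powr_real_powr[of "1/2" "1 - s"] by (simp add: powr_divide powr_minus_divide[symmetric])
  qed
  have 2: "poly_bounded_strip a b (midpoint_series (Suc J))"
    by (rule poly_bounded_strip_midpoint_series[OF a])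
  have 3: "poly_bounded_strip a b (\<lambda>s. \<Sum>j\<in>{1..<Suc J}. midpoint_coeff j * pochhammer (s - 1) (2 * j) * zeta_reg (s + of_nat (2 * j)))"
    by (intro poly_bounded_strip_sum poly_bounded_strip_mult poly_bounded_strip_const poly_bounded_strip_pochhammer IH) auto
  obtain C p where C: "\<And>s. a \<le> Re s \<Longrightarrow> Re s \<le> b \<Longrightarrow>
     norm ((1/2) powr (1 - s) - midpoint_series (Suc J) s
       - (\<Sum>j\<in>{1..<Suc J}. midpoint_coeff j * pochhammer (s - 1) (2 * j) * zeta_reg (s + of_nat (2 * j)))) \<le> C * (1 + norm s) ^ p"
    using poly_bounded_strip_diff[OF poly_bounded_strip_diff[OF 1 2] 3] by (rule poly_bounded_stripE) blast
  show ?thesis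
  proof (rule poly_bounded_stripI)
    fix s assume s: "a \<le> Re s" "Re s \<le> b"
    show "norm (zeta_reg s) \<le> C * (1 + norm s) ^ p"
      using C[OF s] zeta_reg_recursion[of "Suc J" s] s a by simp
  qed
qed

lemma poly_bounded_strip_zeta_reg: "poly_bounded_strip a b zeta_reg"
proof -
  have *: "a > 1 - 2 * real (Suc J) \<Longrightarrow> poly_bounded_strip a b zeta_reg" for J a b
  proof (induction J arbitrary: a b)
    case 0
    show ?case by (rule poly_bounded_strip_zeta_reg_step[OF 0]) auto
  next
    case (Suc J)
    \<comment> \<open>One wide strip contains all the shifts by 2j for 1 \<le> j \<le> J + 1: its
      left edge is the smallest shift of \<open>a\<close>, its right edge the largest shift of
      \<open>b\<close>.\<close>
    have IH: "poly_bounded_strip (a + 2) (b + real (2 * Suc J)) zeta_reg"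
      by (rule Suc.IH) (use Suc.prems in simp)
    show ?case
    proof (rule poly_bounded_strip_zeta_reg_step[OF Suc.prems])
      fix j assume "j \<in> {1..Suc J}"
      then show "poly_bounded_strip a b (\<lambda>s. zeta_reg (s + of_nat (2 * j)))"
        by (intro poly_bounded_strip_shift[OF IH]) auto
    qed
  qed
  have "a > 1 - 2 * real (Suc (nat \<lceil>\<bar>a\<bar>\<rceil>))"
    using real_nat_ceiling_ge[of "\<bar>a\<bar>"] by (smt (verit) of_nat_Suc)
  then show ?thesis by (rule *)
qed

section \<open>Mellin inversion\<close>

text \<open>The Dirichlet kernel 2 sin(T x) / x, written with \<open>sinc\<close> so that x = 0 is
  included and the antiderivative \<open>Si\<close> can be used.\<close>

lemma integral_exp_symmetric:
  fixes x T :: real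
  assumes T: "T \<ge> 0"
  shows "(LBINT y. indicator {-T..T} y *\<^sub>R exp (\<i> * complex_of_real (y * x))) = complex_of_real (2 * T * sinc (T * x))"
proof (cases "x = 0")
  case True
  then show ?thesis using T by (simp add: measure_lborel_Icc scaleR_conv_of_real)
next
  case False
  have "(LBINT y. indicator {-T..T} y *\<^sub>R exp (\<i> * complex_of_real (y * x)))
     = exp (\<i> * complex_of_real (T * x)) / (\<i> * complex_of_real x) - exp (\<i> * complex_of_real ((-T) * x)) / (\<i> * complex_of_real x)"
  proof (rule integral_FTC_atLeastAtMost)
    fix y
    have "((\<lambda>z. exp (\<i> * (z * complex_of_real x)) / (\<i> * complex_of_real x)) has_field_derivative
        exp (\<i> * (complex_of_real y * complex_of_real x))) (at (complex_of_real y))"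
      using False by (auto intro!: derivative_eq_intros simp: algebra_simps)
    then have "((\<lambda>y. exp (\<i> * (complex_of_real y * complex_of_real x)) / (\<i> * complex_of_real x)) has_vector_derivative
        exp (\<i> * (complex_of_real y * complex_of_real x))) (at y within {-T..T})"
      by (rule has_vector_derivative_real_field)
    then show "((\<lambda>y. exp (\<i> * complex_of_real (y * x)) / (\<i> * complex_of_real x)) has_vector_derivative
        exp (\<i> * complex_of_real (y * x))) (at y within {-T..T})" by simp
  qed (use T in \<open>auto intro!: continuous_intros\<close>)
  also have "\<dots> = (exp (\<i> * complex_of_real (T * x)) - exp (- (\<i> * complex_of_real (T * x)))) / (\<i> * complex_of_real x)"
    by (simp add: diff_divide_distrib)
  also have "exp (\<i> * complex_of_real (T * x)) - exp (- (\<i> * complex_of_real (T * x))) = 2 * \<i> * sin (complex_of_real (T * x))"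
    by (simp add: sin_exp_eq)
  also have "\<dots> / (\<i> * complex_of_real x) = complex_of_real (2 * sin (T * x) / x)"
    using False by (simp flip: sin_of_real)
  also have "2 * sin (T * x) / x = 2 * T * sinc (T * x)"
    using False by simp
  finally show ?thesis .
qed

lemma LIMSEQ_integral_symmetric:
  fixes m :: "real \<Rightarrow> complex"
  assumes m_int: "integrable lborel m"
  shows "(\<lambda>n. LBINT y. indicator {-real n..real n} y *\<^sub>R m y) \<longlonglongrightarrow> (LBINT y. m y)"
proof (rule integral_dominated_convergence[where w = "\<lambda>y. norm (m y)"])
  show "AE y in lborel. (\<lambda>n. indicator {- real n..real n} y *\<^sub>R m y) \<longlonglongrightarrow> m y"
  proof (rule AE_I2)
    fix y
    show "(\<lambda>n. indicator {- real n..real n} y *\<^sub>R m y) \<longlonglongrightarrow> m y"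
    proof (rule tendsto_eventually)
      obtain N :: nat where "\<bar>y\<bar> \<le> real N" using real_arch_simple by blast
      then show "\<forall>\<^sub>F n in sequentially. indicator {- real n..real n} y *\<^sub>R m y = m y"
        by (intro eventually_sequentiallyI[of N]) (auto simp: indicator_def)
    qed
  qed
qed (use m_int in \<open>auto simp: indicator_def\<close>)

lemma abs_sinc_le: "\<bar>sinc x\<bar> \<le> 1" for x :: real
proof (cases "x = 0")
  case False
  have "\<bar>sin x / x\<bar> \<le> 1" using abs_sin_x_le_abs_x[of x] False by (simp add: abs_divide)
  then show ?thesis using False by simp
qed simp

text \<open>The truncated inversion integral is \<open>\<integral> h(u) d(2 Si(T ln(u/v)))\<close> with \<open>h(u) = (u/v)\<^sup>c g(u)\<close>. Integrating by
  parts and letting \<open>T \<rightarrow> \<infinity>\<close> gives \<open>-\<pi> \<integral> sgn(u - v) h'(u) du = 2\<pi> h(v)\<close>.\<close>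

lemma mellin_inversion:
  fixes g g' :: "real \<Rightarrow> complex"
  assumes g: "rapid g" and g': "rapid g'"
    and der: "\<And>u. u > 0 \<Longrightarrow> (g has_vector_derivative - g' u) (at u)"
    and c: "c > 0" and v: "v > 0"
    and int: "integrable lborel (\<lambda>y. mellin g (Complex c y))"
  shows "(LBINT y. mellin g (Complex c y) * complex_of_real v powr (- Complex c y)) = 2 * pi * g v"
proof -
  define K where "K = complex_of_real v powr (- complex_of_real c)"
  define L where "L = (\<lambda>u. ln (u / v))"
  \<comment> \<open>\<open>K\<close> is v^(-c), so h(u) = (u/v)^c g(u) and h(v) = g(v);
    \<open>h'\<close> is the derivative of \<open>h\<close>.\<close>
  define h where "h = (\<lambda>u. K * (complex_of_real u powr complex_of_real c * g u))"
  define h' where "h' = (\<lambda>u. K * (complex_of_real c * (complex_of_real u powr (complex_of_real c - 1) * g u)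
      - complex_of_real u powr complex_of_real c * g' u))"
  \<comment> \<open>W(u) = h(u) / u on the positive half-line, extended by 0 so that the exchange of
    integrals takes place on the whole plane.\<close>
  define W where "W = (\<lambda>u. indicator {0<..} u *\<^sub>R (K * (complex_of_real u powr (complex_of_real c - 1) * g u)))"
  define m where "m = (\<lambda>y. mellin g (Complex c y) * complex_of_real v powr (- Complex c y))"
  have i1: "set_integrable lborel {0<..} (\<lambda>u. complex_of_real u powr (complex_of_real c - 1) * g u)"
    using set_integrable_mellin[OF g, of "complex_of_real c"] c by simp
  have i2: "set_integrable lborel {0<..} (\<lambda>u. complex_of_real u powr complex_of_real c * g' u)"
    using set_integrable_mellin[OF g', of "complex_of_real c + 1"] c by simp
  have cg: "continuous_on {0<..} g" "continuous_on {0<..} g'"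
    using g g' by (auto simp: rapid_def elim: continuous_on_subset)
  have W: "integrable lborel W"
    using set_integrable_mult_right[of K, OF i1] by (simp add: W_def set_integrable_def)
  then have W_meas [measurable]: "W \<in> borel_measurable borel" by simp
  have h'_int: "set_integrable lborel {0<..} h'"
    unfolding h'_def using i1 i2 by (intro set_integrable_mult_right set_integral_diff) auto
  have h_v: "h v = g v"
    using v by (simp add: h_def K_def powr_minus field_simps)
  have h_der: "(h has_vector_derivative h' u) (at u)" if u: "u > 0" for u
  proof -
    have "((\<lambda>u. complex_of_real u powr complex_of_real c) has_vector_derivative complex_of_real c * complex_of_real u powr (complex_of_real c - 1)) (at u)"
      using u by (intro has_vector_derivative_real_field) (auto intro!: derivative_eq_intros)
    from has_vector_derivative_mult[OF this der[OF u]]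
    show ?thesis unfolding h_def h'_def
      by (intro has_vector_derivative_mult_right) (simp add: algebra_simps)
  qed
  have h'_cont: "isCont h' u" if "u > 0" for u
  proof -
    have "continuous_on {0<..} h'" unfolding h'_def using cg by (auto intro!: continuous_intros)
    then show ?thesis using that by (simp add: continuous_on_eq_continuous_at)
  qed
  have h_0: "(h \<longlongrightarrow> 0) (at_right 0)"
    unfolding h_def by (rule tendsto_mult_right_zero, rule tendsto_0_powr_mult_rapid[OF g]) (use c in simp)
  have h_inf: "(h \<longlongrightarrow> 0) at_top"
    unfolding h_def by (rule tendsto_mult_right_zero, rule tendsto_powr_mult_rapid[OF g])

  have m_eq: "m y = (LBINT u. exp (\<i> * complex_of_real (y * L u)) * W u)" for y
  proof -
    have "m y = (LBINT u. (indicator {0<..} u *\<^sub>R (complex_of_real u powr (Complex c y - 1) * g u)) * complex_of_real v powr (- Complex c y))"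
      unfolding m_def mellin_def set_lebesgue_integral_def by (rule integral_mult_left_zero[symmetric])
    also have "\<dots> = (LBINT u. exp (\<i> * complex_of_real (y * L u)) * W u)"
    proof (rule Bochner_Integration.integral_cong[OF refl])
      fix u :: real
      show "(indicator {0<..} u *\<^sub>R (complex_of_real u powr (Complex c y - 1) * g u)) * complex_of_real v powr (- Complex c y)
         = exp (\<i> * complex_of_real (y * L u)) * W u"
      proof (cases "u > 0")
        case True
        have e: "Complex c y = complex_of_real c + \<i> * complex_of_real y" by (simp add: complex_eq_iff)
        have l: "L u = ln u - ln v" unfolding L_def using True v by (simp add: ln_div)
        have "complex_of_real u powr (Complex c y - 1) * complex_of_real v powr (- Complex c y)
          = exp (\<i> * complex_of_real (y * L u)) * (K * complex_of_real u powr (complex_of_real c - 1))"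
          unfolding powr_def K_def l e using True v
          by (simp add: Ln_of_real exp_add[symmetric] algebra_simps)
        then show ?thesis using True by (simp add: W_def mult_ac)
      qed (simp add: W_def)
    qed
    finally show ?thesis .
  qed

  have step1: "(LBINT y. indicator {-T..T} y *\<^sub>R m y) = (LBINT u. complex_of_real (2 * T * sinc (T * L u)) * W u)" if T: "T \<ge> 0" for T
  proof -
    define f where "f = (\<lambda>u y. (indicator {-T..T} y *\<^sub>R exp (\<i> * complex_of_real (y * L u))) * W u)"
    have meas: "(\<lambda>(u, y). f u y) \<in> borel_measurable (lborel \<Otimes>\<^sub>M lborel)"
      unfolding f_def L_def by measurable
    have nf: "norm (f u y) = indicator {-T..T} y *\<^sub>R norm (W u)" for u y
      by (simp add: f_def norm_mult indicator_def)
    \<comment> \<open>The oscillating factor has modulus 1, so at finite height the double integral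
      is at most 2T times the L1 norm of W. This bound is lost as T grows.\<close>
    have fint: "integrable (lborel \<Otimes>\<^sub>M lborel) (\<lambda>(u, y). f u y)"
    proof (rule lborel_pair.Fubini_integrable[OF meas])
      have "integrable lborel (\<lambda>u. 2 * T * norm (W u))" using W by simp
      then show "integrable lborel (\<lambda>x. LBINT y. norm (case (x, y) of (u, y) \<Rightarrow> f u y))"
        using T by (simp add: nf measure_lborel_Icc)
      show "AE x in lborel. integrable lborel (\<lambda>y. case (x, y) of (u, y) \<Rightarrow> f u y)"
      proof (rule AE_I2)
        fix x :: real
        have "set_integrable lborel {-T..T} (\<lambda>y. exp (\<i> * complex_of_real (y * L x)))"
          by (rule borel_integrable_compact[folded set_integrable_def] borel_integrable_atLeastAtMost') (auto intro!: continuous_intros)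
        then show "integrable lborel (\<lambda>y. case (x, y) of (u, y) \<Rightarrow> f u y)"
          unfolding f_def set_integrable_def prod.case by (rule integrable_mult_left)
      qed
    qed
    have "(LBINT y. indicator {-T..T} y *\<^sub>R m y) = (LBINT y. LBINT u. f u y)"
      unfolding m_eq f_def by (simp add: mult.assoc flip: integral_scaleR_right)
    also have "\<dots> = (LBINT u. LBINT y. f u y)"
      by (rule lborel_pair.Fubini_integral[OF fint])
    also have "\<dots> = (LBINT u. complex_of_real (2 * T * sinc (T * L u)) * W u)"
      unfolding f_def by (simp only: integral_mult_left_zero integral_exp_symmetric[OF T])
    finally show ?thesis .
  qed

  \<comment> \<open>A bound independent of T: it removes the boundary terms below and dominates the
    limit T \<rightarrow> \<infinity>.\<close>
  obtain B where B: "\<And>T. \<bar>Si T\<bar> \<le> B" using bounded_Si by blast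

  have Si_der: "((\<lambda>u. complex_of_real (2 * Si (T * L u))) has_vector_derivative complex_of_real (2 * T * sinc (T * L u) / u)) (at u)"
    if u: "u > 0" for u T
  proof -
    have "((\<lambda>u. 2 * Si (T * L u)) has_real_derivative 2 * (sinc (T * L u) * (T * (1 / u)))) (at u)"
      unfolding L_def by (intro DERIV_cmult DERIV_chain2[OF DERIV_Si]) (use u v in \<open>auto intro!: derivative_eq_intros simp: field_simps\<close>)
    then have "((\<lambda>u. complex_of_real (2 * Si (T * L u))) has_vector_derivative complex_of_real (2 * (sinc (T * L u) * (T * (1 / u))))) (at u)"
      by (intro has_vector_derivative_of_real) (simp add: has_real_derivative_iff_has_vector_derivative)
    then show ?thesis by (simp add: mult_ac)
  qed

  have Si_bdd_mult: "((\<lambda>u. complex_of_real (2 * Si (T * L u)) * h u) \<longlongrightarrow> 0) G" if "(h \<longlongrightarrow> 0) G" for T G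
  proof (rule Lim_null_comparison)
    show "\<forall>\<^sub>F u in G. norm (complex_of_real (2 * Si (T * L u)) * h u) \<le> 2 * B * norm (h u)"
      using B by (intro always_eventually allI) (simp add: norm_mult mult_right_mono)
    show "((\<lambda>u. 2 * B * norm (h u)) \<longlongrightarrow> 0) G"
      using that by (intro tendsto_mult_right_zero tendsto_norm_zero)
  qed

  have Si_meas: "(\<lambda>u. complex_of_real (2 * Si (T * L u))) \<in> borel_measurable borel" for T
    unfolding L_def by measurable

  have h'_ind_meas: "(\<lambda>u. indicator {0<..} u *\<^sub>R h' u) \<in> borel_measurable borel"
    using h'_int by (simp add: set_integrable_def)

  have Si_h'_int: "set_integrable lborel {0<..} (\<lambda>u. complex_of_real (2 * Si (T * L u)) * h' u)" for T
  proof (rule set_integrable_bound[OF set_integrable_mult_right[of "2 * B", OF set_integrable_norm[OF h'_int]]])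
    show "set_borel_measurable lborel {0<..} (\<lambda>u. complex_of_real (2 * Si (T * L u)) * h' u)"
      unfolding set_borel_measurable_def
      using borel_measurable_times[OF Si_meas[of T] h'_ind_meas] by simp
    have "norm (complex_of_real (2 * Si (T * L u)) * h' u) \<le> norm (2 * B * norm (h' u))" for u
    proof -
      have "\<bar>2 * Si (T * L u)\<bar> \<le> 2 * B" using B[of "T * L u"] by simp
      then have "\<bar>2 * Si (T * L u)\<bar> * norm (h' u) \<le> 2 * B * norm (h' u)" by (rule mult_right_mono) simp
      then show ?thesis unfolding norm_mult norm_of_real real_norm_def by linarith
    qed
    then show "AE x in lborel. x \<in> {0<..} \<longrightarrow> norm (complex_of_real (2 * Si (T * L x)) * h' x) \<le> norm (2 * B * norm (h' x))"
      by simp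
  qed

  have sincW_int: "integrable lborel (\<lambda>u. complex_of_real (2 * T * sinc (T * L u)) * W u)" for T
  proof (rule Bochner_Integration.integrable_bound)
    show "integrable lborel (\<lambda>u. \<bar>2 * T\<bar> * norm (W u))" using W by simp
    show "(\<lambda>u. complex_of_real (2 * T * sinc (T * L u)) * W u) \<in> borel_measurable lborel"
      unfolding L_def by measurable
    show "AE u in lborel. norm (complex_of_real (2 * T * sinc (T * L u)) * W u) \<le> norm (\<bar>2 * T\<bar> * norm (W u))"
    proof (rule AE_I2)
      fix u
      have "\<bar>2 * T * sinc (T * L u)\<bar> \<le> \<bar>2 * T\<bar> * 1"
        unfolding abs_mult[of "2 * T"] by (rule mult_left_mono[OF abs_sinc_le]) simp
      then have "\<bar>2 * T * sinc (T * L u)\<bar> * norm (W u) \<le> \<bar>2 * T\<bar> * norm (W u)"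
        by (intro mult_right_mono) auto
      moreover have "norm (\<bar>2 * T\<bar> * norm (W u)) = \<bar>2 * T\<bar> * norm (W u)" by (simp add: abs_mult)
      ultimately show "norm (complex_of_real (2 * T * sinc (T * L u)) * W u) \<le> norm (\<bar>2 * T\<bar> * norm (W u))"
        by (simp only: norm_mult norm_of_real)
    qed
  qed

  have W_ind: "indicator {0<..} u *\<^sub>R (a * W u) = a * W u" for u a
    by (simp add: W_def indicator_def)

  have W_eq: "W u = h u / complex_of_real u" if "u > 0" for u
    using that by (simp add: W_def h_def powr_diff)

  \<comment> \<open>The kernel over u is the derivative of 2 Si(T ln(u/v)), so integration by parts
    transfers the derivative to \<open>h\<close>; T then occurs only inside the bounded function
    \<open>Si\<close>.\<close>
  have step2: "(LBINT u. complex_of_real (2 * T * sinc (T * L u)) * W u) = - (LBINT u:{0<..}. complex_of_real (2 * Si (T * L u)) * h' u)" for T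
  proof -
    let ?f = "\<lambda>u. complex_of_real (2 * Si (T * L u)) * h' u + complex_of_real (2 * T * sinc (T * L u)) * W u"
    have sW: "set_integrable lborel {0<..} (\<lambda>u. complex_of_real (2 * T * sinc (T * L u)) * W u)"
      unfolding set_integrable_def W_ind by (rule sincW_int)
    have "(LBINT u=ereal 0..\<infinity>. ?f u) = 0 - 0"
    proof (rule interval_integral_FTC_integrable[where F = "\<lambda>u. complex_of_real (2 * Si (T * L u)) * h u"])
      fix u :: real assume "ereal 0 < ereal u"
      then have u: "u > 0" by simp
      from has_vector_derivative_mult[OF Si_der[OF u, of T] h_der[OF u]]
      show "((\<lambda>u. complex_of_real (2 * Si (T * L u)) * h u) has_vector_derivative ?f u) (at u)"
        using u by (simp add: W_eq)
      have "continuous_on {0<..} W"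
        by (rule continuous_on_eq[of _ "\<lambda>u. K * (complex_of_real u powr (complex_of_real c - 1) * g u)"])
           (use cg in \<open>auto simp: W_def intro!: continuous_intros\<close>)
      then have "isCont W u" using u by (simp add: continuous_on_eq_continuous_at)
      moreover have L: "isCont L u" unfolding L_def using u v by (intro continuous_intros) auto
      moreover have "isCont (\<lambda>u. Si (T * L u)) u"
        by (rule isCont_o2[OF _ isCont_Si]) (intro continuous_intros L)
      moreover have "isCont (\<lambda>u. sinc (T * L u)) u"
        by (rule isCont_o2[OF _ isCont_sinc]) (intro continuous_intros L)
      ultimately show "isCont ?f u" using h'_cont[OF u] by (intro continuous_intros)
    next
      show "set_integrable lborel (einterval (ereal 0) \<infinity>) ?f"
        using Si_h'_int[of T] sW by (auto intro!: set_integral_add)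
      show "(((\<lambda>u. complex_of_real (2 * Si (T * L u)) * h u) \<circ> real_of_ereal) \<longlongrightarrow> 0) (at_right (ereal 0))"
        using Si_bdd_mult[OF h_0] by (simp add: ereal_tendsto_simps)
      show "(((\<lambda>u. complex_of_real (2 * Si (T * L u)) * h u) \<circ> real_of_ereal) \<longlongrightarrow> 0) (at_left \<infinity>)"
        using Si_bdd_mult[OF h_inf] by (simp add: ereal_tendsto_simps)
    qed auto
    then have "(LBINT u:{0<..}. ?f u) = 0" by (simp add: interval_integral_to_infinity_eq)
    then have a: "(LBINT u:{0<..}. complex_of_real (2 * Si (T * L u)) * h' u) + (LBINT u:{0<..}. complex_of_real (2 * T * sinc (T * L u)) * W u) = 0"
      using Si_h'_int[of T] sW by (subst (asm) set_integral_add) auto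
    have b: "(LBINT u:{0<..}. complex_of_real (2 * T * sinc (T * L u)) * W u) = (LBINT u. complex_of_real (2 * T * sinc (T * L u)) * W u)"
      unfolding set_lebesgue_integral_def W_ind ..
    show ?thesis by (rule minus_unique[OF a[unfolded b], symmetric])
  qed

  have int_lo: "(LBINT u:{0<..<v}. h' u) = h v"
  proof -
    have "(LBINT u=ereal 0..ereal v. h' u) = h v - 0"
    proof (rule interval_integral_FTC_integrable)
      show "set_integrable lborel (einterval (ereal 0) (ereal v)) h'"
        by (rule set_integrable_subset[OF h'_int]) auto
      show "((h \<circ> real_of_ereal) \<longlongrightarrow> 0) (at_right (ereal 0))"
        using h_0 by (simp add: ereal_tendsto_simps)
      have "(h \<longlongrightarrow> h v) (at_left v)"
        using has_vector_derivative_continuous[OF h_der[OF v]] by (simp add: continuous_at filterlim_at_split)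
      then show "((h \<circ> real_of_ereal) \<longlongrightarrow> h v) (at_left (ereal v))"
        by (simp add: ereal_tendsto_simps)
    qed (use v h_der h'_cont in auto)
    then show ?thesis using v by (simp add: interval_integral_Ioo)
  qed
  have int_hi: "(LBINT u:{v<..}. h' u) = - h v"
  proof -
    have "(LBINT u=ereal v..\<infinity>. h' u) = 0 - h v"
    proof (rule interval_integral_FTC_integrable)
      show "set_integrable lborel (einterval (ereal v) \<infinity>) h'"
        by (rule set_integrable_subset[OF h'_int]) (use v in auto)
      show "((h \<circ> real_of_ereal) \<longlongrightarrow> 0) (at_left \<infinity>)"
        using h_inf by (simp add: ereal_tendsto_simps)
      have "(h \<longlongrightarrow> h v) (at_right v)"
        using has_vector_derivative_continuous[OF h_der[OF v]] by (simp add: continuous_at filterlim_at_split)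
      then show "((h \<circ> real_of_ereal) \<longlongrightarrow> h v) (at_right (ereal v))"
        by (simp add: ereal_tendsto_simps)
    qed (use v h_der h'_cont in auto)
    then show ?thesis by (simp add: interval_integral_to_infinity_eq)
  qed

  \<comment> \<open>The pointwise limit of Si(n ln(u/v)) away from the null set u = v: ln(u/v)
    changes sign there and Si tends to \<pi>/2 and -\<pi>/2 at the two ends.\<close>
  define S where "S = (\<lambda>u. if u < v then - (pi / 2) else pi / 2)"
  have lim: "(\<lambda>n. LBINT u:{0<..}. complex_of_real (2 * Si (real n * L u)) * h' u) \<longlonglongrightarrow> (LBINT u:{0<..}. complex_of_real (2 * S u) * h' u)"
    unfolding set_lebesgue_integral_def
  proof (rule integral_dominated_convergence[where w = "\<lambda>u. indicator {0<..} u *\<^sub>R (2 * B * norm (h' u))"])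
    have "(\<lambda>u. complex_of_real (2 * S u) * (indicator {0<..} u *\<^sub>R h' u)) \<in> borel_measurable borel"
      unfolding S_def using h'_ind_meas by measurable
    then show "(\<lambda>u. indicator {0<..} u *\<^sub>R (complex_of_real (2 * S u) * h' u)) \<in> borel_measurable lborel" by simp
    show "(\<lambda>u. indicator {0<..} u *\<^sub>R (complex_of_real (2 * Si (real n * L u)) * h' u)) \<in> borel_measurable lborel" for n
      using Si_h'_int[of "real n"] by (simp add: set_integrable_def)
    show "integrable lborel (\<lambda>u. indicator {0<..} u *\<^sub>R (2 * B * norm (h' u)))"
      using set_integrable_mult_right[of "2 * B", OF set_integrable_norm[OF h'_int]] by (simp add: set_integrable_def)
    show "AE u in lborel. norm (indicator {0<..} u *\<^sub>R (complex_of_real (2 * Si (real n * L u)) * h' u)) \<le> indicator {0<..} u *\<^sub>R (2 * B * norm (h' u))" for n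
    proof (rule AE_I2)
      fix u
      have "\<bar>2 * Si (real n * L u)\<bar> \<le> 2 * B" using B[of "real n * L u"] by simp
      then have "norm (complex_of_real (2 * Si (real n * L u)) * h' u) \<le> 2 * B * norm (h' u)"
        unfolding norm_mult norm_of_real by (rule mult_right_mono) simp
      then show "norm (indicator {0<..} u *\<^sub>R (complex_of_real (2 * Si (real n * L u)) * h' u)) \<le> indicator {0<..} u *\<^sub>R (2 * B * norm (h' u))"
        by (auto simp: indicator_def)
    qed
    have pt: "(\<lambda>n. Si (real n * L u)) \<longlonglongrightarrow> S u" if u: "u > 0" "u \<noteq> v" for u
    proof (cases "u < v")
      case False
      then have "L u > 0" unfolding L_def using u v by simp
      then have "filterlim (\<lambda>n. real n * L u) at_top sequentially"
        by (intro filterlim_at_top_mult_tendsto_pos[OF tendsto_const _ filterlim_real_sequentially])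
      from filterlim_compose[OF Si_at_top this] show ?thesis using False by (simp add: S_def)
    next
      case True
      then have "- L u > 0" unfolding L_def using u v by (simp add: ln_less_zero_iff)
      then have "filterlim (\<lambda>n. real n * - L u) at_top sequentially"
        by (intro filterlim_at_top_mult_tendsto_pos[OF tendsto_const _ filterlim_real_sequentially])
      from tendsto_minus[OF filterlim_compose[OF Si_at_top this]] 
      have "(\<lambda>n. - Si (- (real n * L u))) \<longlonglongrightarrow> - (pi / 2)" by simp
      moreover have "- Si (- x) = Si x" for x
        using Si_neg[of x] Si_neg[of "-x"] by (cases "x \<ge> 0") auto
      ultimately show ?thesis using True by (simp add: S_def)
    qed
    show "AE u in lborel. (\<lambda>n. indicator {0<..} u *\<^sub>R (complex_of_real (2 * Si (real n * L u)) * h' u)) \<longlonglongrightarrow> indicator {0<..} u *\<^sub>R (complex_of_real (2 * S u) * h' u)"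
      using AE_lborel_singleton[of v]
    proof eventually_elim
      case (elim u)
      show ?case
      proof (cases "u > 0")
        case True
        show ?thesis by (intro tendsto_intros pt True elim)
      qed simp
    qed
  qed

  \<comment> \<open>The integrals of h' over (0, v) and (v, \<infinity>) are h(v) and -h(v);
    weighted by -\<pi> and \<pi> they add up instead of cancelling.\<close>
  have "(LBINT u:{0<..}. complex_of_real (2 * S u) * h' u) = - (2 * pi * h v)"
  proof -
    have e: "(LBINT u:{0<..}. complex_of_real (2 * S u) * h' u) = (LBINT u. indicator {v<..} u *\<^sub>R (pi * h' u) - indicator {0<..<v} u *\<^sub>R (pi * h' u))"
      unfolding set_lebesgue_integral_def
    proof (rule integral_cong_AE)
      show "(\<lambda>u. indicator {0<..} u *\<^sub>R (complex_of_real (2 * S u) * h' u)) \<in> borel_measurable lborel"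
      proof -
        have "(\<lambda>u. complex_of_real (2 * S u) * (indicator {0<..} u *\<^sub>R h' u)) \<in> borel_measurable borel"
          unfolding S_def using h'_ind_meas by measurable
        then show ?thesis by simp
      qed
      have "set_integrable lborel {v<..} (\<lambda>u. pi * h' u)" "set_integrable lborel {0<..<v} (\<lambda>u. pi * h' u)"
        by (rule set_integrable_subset[OF set_integrable_mult_right[of "complex_of_real pi", OF h'_int]]; use v in auto)+
      then show "(\<lambda>u. indicator {v<..} u *\<^sub>R (pi * h' u) - indicator {0<..<v} u *\<^sub>R (pi * h' u)) \<in> borel_measurable lborel"
        by (simp add: set_integrable_def)
      show "AE u in lborel. indicator {0<..} u *\<^sub>R (complex_of_real (2 * S u) * h' u) = indicator {v<..} u *\<^sub>R (pi * h' u) - indicator {0<..<v} u *\<^sub>R (pi * h' u)"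
        using AE_lborel_singleton[of v]
        by eventually_elim (use v in \<open>auto simp: S_def indicator_def\<close>)
    qed
    have i: "set_integrable lborel {v<..} h'" "set_integrable lborel {0<..<v} h'"
      by (rule set_integrable_subset[OF h'_int]; use v in auto)+
    have "(LBINT u. indicator {v<..} u *\<^sub>R (pi * h' u) - indicator {0<..<v} u *\<^sub>R (pi * h' u)) = (LBINT u:{v<..}. pi * h' u) - (LBINT u:{0<..<v}. pi * h' u)"
      using set_integrable_mult_right[of "complex_of_real pi", OF i(1)] set_integrable_mult_right[of "complex_of_real pi", OF i(2)]
      unfolding set_integrable_def set_lebesgue_integral_def by (rule Bochner_Integration.integral_diff)
    also have "\<dots> = pi * (LBINT u:{v<..}. h' u) - pi * (LBINT u:{0<..<v}. h' u)"
      by (simp only: set_integral_mult_right)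
    finally show ?thesis unfolding e int_lo int_hi by simp
  qed
  with tendsto_minus[OF lim] have lim1: "(\<lambda>n. LBINT y. indicator {-real n..real n} y *\<^sub>R m y) \<longlonglongrightarrow> 2 * pi * h v"
    unfolding step1[OF of_nat_0_le_iff] step2 by (simp only: minus_minus)
  \<comment> \<open>The limit above concerns symmetric truncations; integrability on the line
    identifies it with the full integral.\<close>
  have m_int: "integrable lborel m"
  proof -
    have nm: "norm (m y) = v powr (- c) * norm (mellin g (Complex c y))" for y
      using v by (simp add: m_def norm_mult norm_powr_real_powr)
    have "(\<lambda>y. complex_of_real v powr (- Complex c y)) \<in> borel_measurable borel"
      using v by (intro borel_measurable_continuous_onI) (auto intro!: continuous_intros simp: powr_def Complex_eq)
    then have "m \<in> borel_measurable lborel"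
      unfolding m_def using int by (intro borel_measurable_times) auto
    moreover have i: "integrable lborel (\<lambda>y. v powr (- c) * norm (mellin g (Complex c y)))" using int by simp
    ultimately show ?thesis
      by (intro Bochner_Integration.integrable_bound[OF i]) (auto simp: nm)
  qed
  from LIMSEQ_unique[OF LIMSEQ_integral_symmetric[OF m_int] lim1]
  show ?thesis using h_v unfolding m_def by simp
qed

section \<open>The divisor sum as a vertical line integral\<close>

text \<open>Pairs are grouped by their product: (m, k) corresponds to the divisor m of m k.
  Unordered summation makes the regrouping legitimate.\<close>

lemma divisor_count_has_sum:
  fixes f :: "nat \<Rightarrow> complex"
  assumes "((\<lambda>(m, k). f (m * k)) has_sum S) ({1..} \<times> {1..})"
  shows "((\<lambda>n. of_nat (divisor_count n) * f n) has_sum S) {1..}"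
proof -
  have "bij_betw (\<lambda>(m, k). (m * k, m)) ({1..} \<times> {1..}) (SIGMA n:{1::nat..}. {d. d dvd n})"
    by (rule bij_betwI[where g = "\<lambda>(n, d). (d, n div d)"]) (auto simp: Suc_le_eq elim!: dvdE)
  from has_sum_reindex_bij_betw[OF this, of "\<lambda>(n, d). f n" S]
  have "((\<lambda>(n, d). f n) has_sum S) (SIGMA n:{1::nat..}. {d. d dvd n})"
    using assms by (simp add: case_prod_unfold)
  then show ?thesis
  proof (rule has_sum_SigmaD)
    fix n :: nat assume "n \<in> {1..}"
    then have "finite {d. d dvd n}" by simp
    then show "((\<lambda>y. case (n, y) of (n, d) \<Rightarrow> f n) has_sum of_nat (divisor_count n) * f n) {d. d dvd n}"
      by (auto intro!: has_sum_finiteI simp: divisor_count_def)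
  qed
qed

lemma has_sum_product:
  fixes f g :: "nat \<Rightarrow> complex"
  assumes f: "(f has_sum X) A" "(\<lambda>m. norm (f m)) summable_on A" and g: "(g has_sum Y) B" "(\<lambda>k. norm (g k)) summable_on B"
  shows "((\<lambda>(m, k). f m * g k) has_sum X * Y) (A \<times> B)"
proof -
  have "(\<lambda>p. norm (case p of (m, k) \<Rightarrow> f m * g k)) summable_on (A \<times> B)"
    unfolding Infinite_Sum.abs_summable_on_Sigma_iff
  proof (intro conjI ballI)
    fix x show "(\<lambda>y. norm (case (x, y) of (m, k) \<Rightarrow> f m * g k)) summable_on B"
      using g(2) by (simp add: norm_mult summable_on_cmult_right)
  next
    have "(\<lambda>x. norm (f x) * (\<Sum>\<^sub>\<infinity>y\<in>B. norm (g y))) summable_on A"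
      using f(2) by (rule summable_on_cmult_left)
    then show "(\<lambda>x. norm (\<Sum>\<^sub>\<infinity>y\<in>B. norm (case (x, y) of (m, k) \<Rightarrow> f m * g k))) summable_on A"
      by (simp add: norm_mult infsum_cmult_right' infsum_nonneg abs_mult)
  qed
  then obtain S where S: "((\<lambda>(m, k). f m * g k) has_sum S) (A \<times> B)"
    using Infinite_Sum.abs_summable_summable summable_on_def by blast
  have "((\<lambda>m. f m * Y) has_sum S) A"
    by (rule has_sum_SigmaD[OF S]) (simp add: has_sum_cmult_right[OF g(1)])
  moreover have "((\<lambda>m. f m * Y) has_sum X * Y) A" by (rule has_sum_cmult_left[OF f(1)])
  ultimately show ?thesis using S has_sum_unique by blast
qed

lemma bij_betw_Suc_atLeast_1: "bij_betw Suc UNIV {1..}"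
proof (rule bij_betwI[where g = "\<lambda>n. n - 1"])
  show "Suc (n - 1) = n" if "n \<in> {1..}" for n using that by simp
qed simp_all

text \<open>Two absolutely convergent series are multiplied, and since n^(-w) is completely
  multiplicative the product depends only on m k, so pairs can be grouped by divisors.\<close>

lemma riemann_zeta_square:
  assumes w: "Re w > 1"
  shows "(\<lambda>n. of_nat (divisor_count (Suc n)) * of_nat (Suc n) powr (- w)) sums (riemann_zeta w)\<^sup>2"
proof -
  define f where "f = (\<lambda>n::nat. of_nat n powr (- w) :: complex)"
  have f_Suc: "f (Suc n) = 1 / of_nat (Suc n) powr w" for n
    unfolding f_def by (rule powr_minus_divide)
  have "summable (\<lambda>n. norm (f (Suc n)))"
    using dirichlet_zeta_summable_norm[OF w] unfolding f_Suc of_real_of_nat_eq .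
  moreover have "(\<lambda>n. f (Suc n)) sums riemann_zeta w"
    using dirichlet_zeta_sums[OF w] unfolding f_Suc riemann_zeta_eq_dirichlet[OF w] .
  ultimately have hs: "((\<lambda>n. f (Suc n)) has_sum riemann_zeta w) UNIV" "(\<lambda>n. norm (f (Suc n))) summable_on UNIV"
    using norm_summable_imp_has_sum norm_summable_imp_summable_on[of "\<lambda>n. norm (f (Suc n))"] by (auto simp: summable_on_UNIV_nonneg_real_iff)
  have f1: "(f has_sum riemann_zeta w) {1..}"
    using hs(1) has_sum_reindex_bij_betw[OF bij_betw_Suc_atLeast_1, of f] by simp
  have f2: "(\<lambda>n. norm (f n)) summable_on {1..}"
    using hs(2) summable_on_reindex_bij_betw[OF bij_betw_Suc_atLeast_1, of "\<lambda>n. norm (f n)"] by simp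
  have "((\<lambda>(m, k). f m * f k) has_sum (riemann_zeta w)\<^sup>2) ({1..} \<times> {1..})"
    unfolding power2_eq_square by (rule has_sum_product[OF f1 f2 f1 f2])
  moreover have "f m * f k = f (m * k)" for m k
  proof -
    have "complex_of_real (real m * real k) powr (- w) = complex_of_real (real m) powr (- w) * complex_of_real (real k) powr (- w)"
      unfolding of_real_mult by (rule powr_times_real) auto
    then show ?thesis by (simp add: f_def)
  qed
  ultimately have "((\<lambda>(m, k). f (m * k)) has_sum (riemann_zeta w)\<^sup>2) ({1..} \<times> {1..})" by simp
  from divisor_count_has_sum[OF this]
  have "((\<lambda>n. of_nat (divisor_count (Suc n)) * f (Suc n)) has_sum (riemann_zeta w)\<^sup>2) UNIV"
    using has_sum_reindex_bij_betw[OF bij_betw_Suc_atLeast_1, of "\<lambda>n. of_nat (divisor_count n) * f n"] by simp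
  from has_sum_imp_sums[OF this] show ?thesis by (simp only: f_def)
qed

text \<open>The complex series at a real point has nonnegative real terms, so its convergence is
  already absolute convergence.\<close>

lemma summable_divisor_count_powr:
  assumes "\<sigma> > 1"
  shows "summable (\<lambda>n. real (divisor_count (Suc n)) * real (Suc n) powr (- \<sigma>))"
proof -
  have "summable (\<lambda>n. of_nat (divisor_count (Suc n)) * of_nat (Suc n) powr (- complex_of_real \<sigma>))"
    using riemann_zeta_square[of "complex_of_real \<sigma>"] assms by (simp add: sums_iff)
  moreover have "of_nat (divisor_count (Suc n)) * of_nat (Suc n) powr (- complex_of_real \<sigma>)
     = complex_of_real (real (divisor_count (Suc n)) * real (Suc n) powr (- \<sigma>))" for n
    unfolding of_real_mult of_real_of_nat_eq by (simp add: powr_of_real[symmetric] del: of_nat_Suc)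
  ultimately show ?thesis by (simp only: summable_of_real_iff)
qed

lemma integrable_inverse_square_decay:
  fixes f :: "real \<Rightarrow> complex"
  assumes f: "continuous_on UNIV f" and C: "\<And>y. 1 \<le> \<bar>y\<bar> \<Longrightarrow> norm (f y) \<le> C / \<bar>y\<bar> ^ 2"
  shows "integrable lborel f"
proof -
  have "bounded (f ` {-1..1})"
    by (intro compact_imp_bounded compact_continuous_image continuous_on_subset[OF f]) auto
  then obtain B where B: "\<forall>y\<in>{-1..1}. norm (f y) \<le> B" by (auto simp: bounded_iff)
  have C0: "C \<ge> 0" using order_trans[OF norm_ge_zero C[of 1]] by simp
  have B0: "B \<ge> 0" using order_trans[OF norm_ge_zero B[rule_format, of 0]] by simp
  \<comment> \<open>The factor 2 covers both ranges: 1 + y^2 is at most 2 for |y| \<le> 1 and at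
    most 2 y^2 beyond.\<close>
  have I: "integrable lborel (\<lambda>y::real. (2 * (B + C)) * inverse (1 + y\<^sup>2))"
    using integrable_inverse_1_plus_square by (simp add: set_integrable_def einterval_iff)
  show ?thesis
  proof (rule Bochner_Integration.integrable_bound[OF I])
    show "f \<in> borel_measurable lborel" using borel_measurable_continuous_onI[OF f] by simp
    have "norm (f y) \<le> (2 * (B + C)) * inverse (1 + y\<^sup>2)" for y
    proof (cases "\<bar>y\<bar> \<le> 1")
      case True
      have "y\<^sup>2 \<le> 1" using True by (simp add: abs_square_le_1)
      then have "B * (1 + y\<^sup>2) \<le> (B + C) * 2" using B0 C0 by (intro mult_mono) auto
      moreover have "norm (f y) \<le> B" using B True by (simp add: abs_le_iff)
      moreover have "0 < 1 + y\<^sup>2" by (simp add: add_pos_nonneg)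
      ultimately have "B \<le> (2 * (B + C)) * inverse (1 + y\<^sup>2)" by (simp add: field_simps)
      with \<open>norm (f y) \<le> B\<close> show ?thesis by simp
    next
      case False
      then have y: "1 \<le> \<bar>y\<bar>" by simp
      then have y2: "1 \<le> y\<^sup>2" using one_le_power[of "\<bar>y\<bar>" 2] by simp
      have "norm (f y) \<le> C / y\<^sup>2" using C[OF y] by simp
      also have "\<dots> \<le> (2 * (B + C)) * inverse (1 + y\<^sup>2)"
      proof -
        have "C / y\<^sup>2 \<le> C / ((1 + y\<^sup>2) / 2)" using C0 y2 by (intro divide_left_mono mult_pos_pos) auto
        also have "\<dots> = (2 * C) * inverse (1 + y\<^sup>2)" by (simp add: inverse_eq_divide)
        also have "\<dots> \<le> (2 * (B + C)) * inverse (1 + y\<^sup>2)" by (rule mult_right_mono) (use B0 y2 in simp_all)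
        finally show ?thesis .
      qed
      finally show ?thesis .
    qed
    then show "AE y in lborel. norm (f y) \<le> norm ((2 * (B + C)) * inverse (1 + y\<^sup>2))"
      unfolding real_norm_def by (intro AE_I2 order_trans[OF _ abs_ge_self])
  qed
qed

lemma continuous_on_vline:
  assumes "f holomorphic_on S" "\<And>y. Complex c y \<in> S"
  shows "continuous_on UNIV (\<lambda>y. f (Complex c y))"
proof (rule continuous_on_compose2[OF holomorphic_on_imp_continuous_on[OF assms(1)]])
  show "continuous_on UNIV (Complex c)"
    unfolding complex_eq_iff[symmetric] Complex_eq by (intro continuous_intros)
qed (use assms(2) in auto)

text \<open>Provides the integrability that Mellin inversion assumes; the decay is that of Gamma(-s)
  F^(s)(0) at s = -w.\<close>

lemma integrable_mellin_vline:
  assumes F: "F \<in> schwartz_neg" and c: "c > 0"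
  shows "integrable lborel (\<lambda>y. mellin (\<lambda>u. F (- u)) (Complex c y))"
proof -
  obtain C where C: "\<And>s. - c \<le> Re s \<Longrightarrow> Re s \<le> - c \<Longrightarrow> 1 \<le> \<bar>Im s\<bar> \<Longrightarrow> norm (Gamma (- s) * cderiv0 F s) \<le> C / \<bar>Im s\<bar> ^ 2"
    using norm_Gamma_cderiv0_le[OF F] by metis
  show ?thesis
  proof (rule integrable_inverse_square_decay)
    show "continuous_on UNIV (\<lambda>y. mellin (\<lambda>u. F (- u)) (Complex c y))"
      by (rule continuous_on_vline[OF mellin_holomorphic]) (use rapid_nderiv_neg[OF F, of 0] c in auto)
    fix y :: real assume "1 \<le> \<bar>y\<bar>"
    then show "norm (mellin (\<lambda>u. F (- u)) (Complex c y)) \<le> C / \<bar>y\<bar> ^ 2"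
      using C[of "- Complex c y"] Gamma_cderiv0[OF F, of "- Complex c y"] c by simp
  qed
qed

lemma divisor_sum_eq_vline:
  assumes F: "F \<in> schwartz_neg" and t: "t < 0"
  shows "(\<lambda>n. of_nat (divisor_count (Suc n)) * F (real (Suc n) * t)) sums
     (1 / (2 * pi) * (LBINT y. remainder_integrand F t (Complex (- 2) y)))"
proof -
  define f where "f = (\<lambda>u. F (- u))"
  \<comment> \<open>The Mellin variable w = -s on the line Re w = 2, inside the region Re w > 1
    where the Dirichlet series of the squared zeta converges absolutely.\<close>
  define w where "w = Complex 2"
  define M where "M = (\<lambda>y. mellin f (w y))"
  define v where "v = (\<lambda>n. real (Suc n) * (- t))"
  define D where "D = (\<lambda>n. complex_of_nat (divisor_count (Suc n)))"
  define q where "q = (\<lambda>n y. D n * (M y * complex_of_real (v n) powr (- w y)))"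
  have v: "v n > 0" for n unfolding v_def using t by (simp add: mult_pos_neg)
  have rf: "rapid f" "rapid (\<lambda>u. nderiv_neg 1 F (- u))"
    using rapid_nderiv_neg[OF F, of 0] rapid_nderiv_neg[OF F, of 1] by (auto simp: f_def simp del: nderiv_neg.simps(2))
  have fder: "(f has_vector_derivative - nderiv_neg 1 F (- u)) (at u)" if "u > 0" for u
    using nderiv_neg_reflect_has_vector_derivative[OF F that, of 0] by (simp add: f_def)
  have M: "integrable lborel M"
    unfolding M_def w_def f_def by (rule integrable_mellin_vline[OF F]) simp
  have inv: "(LBINT y. M y * complex_of_real (v n) powr (- w y)) = 2 * pi * f (v n)" for n
    unfolding M_def w_def by (rule mellin_inversion[OF rf fder]) (use v M in \<open>auto simp: M_def w_def\<close>)
  have powr_cont: "continuous_on UNIV (\<lambda>y. complex_of_real a powr (- w y))" if "a > 0" for a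
    unfolding w_def using that
    by (intro continuous_on_vline[where f = "\<lambda>s. complex_of_real a powr (- s)" and S = UNIV] holomorphic_intros) auto
  have q_int: "integrable lborel (q n)" for n
    unfolding q_def
  proof (intro integrable_mult_right)
    show "integrable lborel (\<lambda>y. M y * complex_of_real (v n) powr (- w y))"
    proof (rule Bochner_Integration.integrable_bound)
      show "integrable lborel (\<lambda>y. v n powr (- 2) * norm (M y))" using M by simp
      show "(\<lambda>y. M y * complex_of_real (v n) powr (- w y)) \<in> borel_measurable lborel"
        using M borel_measurable_continuous_onI[OF powr_cont[OF v[of n]]] by (intro borel_measurable_times) auto
    qed (use v[of n] in \<open>auto simp: norm_mult norm_powr_real_powr w_def\<close>)
  qed
  have q_norm: "norm (q n y) = (real (divisor_count (Suc n)) * real (Suc n) powr (- 2)) * ((- t) powr (- 2) * norm (M y))" for n y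
  proof -
    have "norm (complex_of_real (v n) powr (- w y)) = v n powr (- 2)"
      using v[of n] by (simp add: norm_powr_real_powr w_def)
    also have "\<dots> = real (Suc n) powr (- 2) * (- t) powr (- 2)"
      unfolding v_def using t by (intro powr_mult)
    finally show ?thesis by (simp add: q_def D_def norm_mult)
  qed
  have sumD: "summable (\<lambda>n. real (divisor_count (Suc n)) * real (Suc n) powr (- 2))"
    by (rule summable_divisor_count_powr) simp
  \<comment> \<open>Sum and integral may be exchanged because the L1 norm of \<open>q n\<close> is a
    constant times d(n + 1) (n + 1)^(-2), which is summable.\<close>
  have s: "(\<lambda>n. integral\<^sup>L lborel (q n)) sums (LBINT y. (\<Sum>n. q n y))"
  proof (rule sums_integral[OF q_int])
    show "AE y in lborel. summable (\<lambda>n. norm (q n y))"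
      unfolding q_norm by (intro AE_I2 summable_mult2 sumD)
    show "summable (\<lambda>n. LBINT y. norm (q n y))"
      unfolding q_norm by (simp only: integral_mult_right_zero) (intro summable_mult2 sumD)
  qed
  have q_sum: "(\<Sum>n. q n y) = remainder_integrand F t (Complex (- 2) (- y))" for y
  proof -
    have e: "Complex (- 2) (- y) = - w y" by (simp add: w_def complex_eq_iff)
    have z: "(\<lambda>n. D n * of_nat (Suc n) powr (- w y)) sums (riemann_zeta (w y))\<^sup>2"
      unfolding D_def by (rule riemann_zeta_square) (simp add: w_def)
    have "complex_of_real (v n) powr (- w y) = of_nat (Suc n) powr (- w y) * complex_of_real (- t) powr (- w y)" for n
      unfolding v_def of_real_mult using t by (subst powr_times_real) auto
    then have "q n y = (D n * of_nat (Suc n) powr (- w y)) * (M y * complex_of_real (- t) powr (- w y))" for n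
      unfolding q_def by (simp add: mult_ac)
    then have "(\<lambda>n. q n y) sums ((riemann_zeta (w y))\<^sup>2 * (M y * complex_of_real (- t) powr (- w y)))"
      using sums_mult2[OF z] by simp
    then have "(\<Sum>n. q n y) = (riemann_zeta (w y))\<^sup>2 * (M y * complex_of_real (- t) powr (- w y))"
      by (rule sums_unique[symmetric])
    moreover have "M y = Gamma (w y) * cderiv0 F (- w y)"
      using Gamma_cderiv0[OF F, of "- w y"] by (simp add: M_def f_def w_def)
    ultimately show ?thesis
      unfolding remainder_integrand_def e minus_minus by (simp only: mult_ac)
  qed
  \<comment> \<open>Passing from w to s = -w reverses the height y, and the integral over the whole
    line is invariant under this reflection.\<close>
  have refl: "(LBINT y. remainder_integrand F t (Complex (- 2) (- y))) = (LBINT y. remainder_integrand F t (Complex (- 2) y))"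
    using lborel_integral_real_affine[of "-1" "\<lambda>y. remainder_integrand F t (Complex (- 2) y)" 0] by simp
  have "integral\<^sup>L lborel (q n) = 2 * pi * (D n * F (real (Suc n) * t))" for n
    unfolding q_def by (simp only: integral_mult_right_zero inv) (simp add: f_def v_def)
  with s have "(\<lambda>n. 2 * pi * (D n * F (real (Suc n) * t))) sums (LBINT y. remainder_integrand F t (Complex (- 2) y))"
    by (simp only: q_sum refl)
  from sums_mult[OF this, of "1 / (2 * pi)"] show ?thesis by (simp add: D_def)
qed

section \<open>Shifting the line of integration\<close>

text \<open>The residue theorem on a rectangle of half-height T; the two horizontal edges contribute
  O(1 / T^2). The factor is 2 \<pi> rather than 2 \<pi> i because the integrals are taken in y, with
  ds = i dy.\<close>

lemma vline_shift_residues: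
  fixes f :: "complex \<Rightarrow> complex" and a b C :: real
  assumes ab: "a < b" and S: "open S" "connected S" and pts: "finite pts" "\<And>p. p \<in> pts \<Longrightarrow> a < Re p \<and> Re p < b"
    and sub: "{s. a \<le> Re s \<and> Re s \<le> b} \<subseteq> S"
    and holo: "f holomorphic_on S - pts"
    and decay: "\<And>s. a \<le> Re s \<Longrightarrow> Re s \<le> b \<Longrightarrow> 1 \<le> \<bar>Im s\<bar> \<Longrightarrow> norm (f s) \<le> C / \<bar>Im s\<bar> ^ 2"
  shows "integrable lborel (\<lambda>y. f (Complex a y))" "integrable lborel (\<lambda>y. f (Complex b y))"
    "(LBINT y. f (Complex b y)) - (LBINT y. f (Complex a y)) = 2 * pi * (\<Sum>p\<in>pts. residue f p)"
proof -
  have int: "integrable lborel (\<lambda>y. f (Complex c y))" if "c = a \<or> c = b" for c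
  proof (rule integrable_inverse_square_decay)
    show "continuous_on UNIV (\<lambda>y. f (Complex c y))"
    proof (rule continuous_on_vline[OF holo])
      fix y show "Complex c y \<in> S - pts" using that sub pts(2)[of "Complex c y"] ab by fastforce
    qed
    show "norm (f (Complex c y)) \<le> C / \<bar>y\<bar> ^ 2" if "1 \<le> \<bar>y\<bar>" for y
      using decay[of "Complex c y"] that ab \<open>c = a \<or> c = b\<close> by auto
  qed
  show i: "integrable lborel (\<lambda>y. f (Complex a y))" "integrable lborel (\<lambda>y. f (Complex b y))"
    using int by auto
  define R where "R = (\<Sum>p\<in>pts. residue f p)"
  define I where "I = (\<lambda>c n. LBINT y. indicator {-real n..real n} y *\<^sub>R f (Complex c y))"
  have C0: "C \<ge> 0" using order_trans[OF norm_ge_zero decay[of "Complex a 1"]] ab by simp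
  \<comment> \<open>Once T exceeds B every pole lies strictly inside the rectangle, so all winding
    numbers are 1.\<close>
  obtain B where B: "\<And>p. p \<in> pts \<Longrightarrow> norm p \<le> B"
    using finite_imp_bounded[OF pts(1)] by (auto simp: bounded_iff)
  have main: "norm (\<i> * I b n - \<i> * I a n - 2 * pi * \<i> * R) \<le> 2 * C * (b - a) / (real n)\<^sup>2"
    if n: "1 \<le> n" "B < real n" for n
  proof -
    define T where "T = real n"
    have T: "T \<ge> 1" "B < T" using n by (auto simp: T_def)
    define a1 a2 a3 a4 where "a1 = Complex a (-T)" and "a2 = Complex b (-T)" and "a3 = Complex b T" and "a4 = Complex a T"
    let ?g = "rectpath a1 a3"
    have box: "cbox a1 a3 \<subseteq> S" using sub by (auto simp: in_cbox_complex_iff a1_def a3_def)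
    have in_box: "p \<in> box a1 a3" if "p \<in> pts" for p
      using pts(2)[OF that] B[OF that] T abs_Im_le_cmod[of p] by (auto simp: in_box_complex_iff a1_def a3_def)
    have img: "path_image ?g \<subseteq> S - pts"
    proof -
      have "path_image ?g \<subseteq> cbox a1 a3"
        by (rule path_image_rectpath_subset_cbox) (use ab T in \<open>auto simp: a1_def a3_def\<close>)
      moreover have "path_image ?g \<inter> box a1 a3 = {}"
        by (rule path_image_rectpath_inter_box) (use ab T in \<open>auto simp: a1_def a3_def\<close>)
      ultimately show ?thesis using box in_box by blast
    qed
    have "contour_integral ?g f = complex_of_real (2 * pi) * \<i> * (\<Sum>p\<in>pts. winding_number ?g p * residue f p)"
    proof (rule Residue_theorem[OF S pts(1) holo valid_path_rectpath _ img])
      show "\<forall>z. z \<notin> S \<longrightarrow> winding_number ?g z = 0"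
        using box by (auto intro!: winding_number_rectpath_outside simp: a1_def a3_def ab less_imp_le) (use T in auto)
    qed simp
    also have "(\<Sum>p\<in>pts. winding_number ?g p * residue f p) = R"
      unfolding R_def by (rule sum.cong) (auto simp: winding_number_rectpath in_box)
    finally have res: "contour_integral ?g f = 2 * pi * \<i> * R" by simp
    have g: "?g = linepath a1 a2 +++ linepath a2 a3 +++ linepath a3 a4 +++ linepath a4 a1"
      by (simp add: rectpath_def Let_def a1_def a2_def a3_def a4_def)
    have "path_image ?g = closed_segment a1 a2 \<union> (closed_segment a2 a3 \<union> (closed_segment a3 a4 \<union> closed_segment a4 a1))"
      unfolding g by (simp add: path_image_join)
    then have seg: "closed_segment a1 a2 \<subseteq> S - pts" "closed_segment a2 a3 \<subseteq> S - pts" "closed_segment a3 a4 \<subseteq> S - pts" "closed_segment a4 a1 \<subseteq> S - pts"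
      using img by auto
    have cont: "continuous_on A f" if "A \<subseteq> S - pts" for A
      using holomorphic_on_imp_continuous_on[OF holo] that continuous_on_subset by blast
    note ci = contour_integrable_continuous_linepath[OF cont[OF seg(1)]] contour_integrable_continuous_linepath[OF cont[OF seg(2)]]
      contour_integrable_continuous_linepath[OF cont[OF seg(3)]] contour_integrable_continuous_linepath[OF cont[OF seg(4)]]
    have split: "contour_integral ?g f = contour_integral (linepath a1 a2) f + (contour_integral (linepath a2 a3) f
        + (contour_integral (linepath a3 a4) f + contour_integral (linepath a4 a1) f))"
      unfolding g using ci by (simp add: contour_integrable_joinI)
    have vert: "contour_integral (linepath (Complex c (-T)) (Complex c T)) f = \<i> * I c n" if c: "c = a \<or> c = b" for c
    proof -
      have "set_integrable lborel {-T..T} (\<lambda>y. f (Complex c y))"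
        unfolding set_integrable_def using int[OF c] by (intro integrable_mult_indicator) auto
      from set_borel_integral_eq_integral(2)[OF this]
      have "integral {-T..T} (\<lambda>y. f (Complex c y)) = I c n"
        by (simp add: I_def T_def set_lebesgue_integral_def)
      then show ?thesis
        using contour_integral_linepath_same_Re[of "Complex c (-T)" c "Complex c T" "-T" T f] T by simp
    qed
    have v23: "contour_integral (linepath a2 a3) f = \<i> * I b n"
      unfolding a2_def a3_def by (rule vert) simp
    have v41: "contour_integral (linepath a4 a1) f = - (\<i> * I a n)"
      using contour_integral_reverse_linepath[OF cont[OF seg(4)]] vert[of a] by (simp add: a1_def a4_def)
    have hb: "norm (contour_integral (linepath p q) f) \<le> C / T\<^sup>2 * (b - a)"
      if pq: "closed_segment p q \<subseteq> S - pts" "\<bar>Im p\<bar> = T" "Im q = Im p" "Re p \<in> {a, b}" "Re q \<in> {a, b}" "Re p \<noteq> Re q" for p q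
    proof -
      have "norm (contour_integral (linepath p q) f) \<le> C / T\<^sup>2 * norm (q - p)"
      proof (rule contour_integral_bound_linepath)
        show "f contour_integrable_on linepath p q"
          by (rule contour_integrable_continuous_linepath[OF cont[OF pq(1)]])
        show "0 \<le> C / T\<^sup>2" using C0 by simp
        fix x assume x: "x \<in> closed_segment p q"
        have "Im x = Im p" "a \<le> Re x" "Re x \<le> b"
        proof -
          have "x \<in> closed_segment p q \<longleftrightarrow> Im x = Im p \<and> Re x \<in> closed_segment (Re p) (Re q)"
            using closed_segment_same_Im[of p q] pq by auto
          then show "Im x = Im p" "a \<le> Re x" "Re x \<le> b" using x pq ab
            by (auto simp: closed_segment_eq_real_ivl split: if_splits)
        qed
        then show "norm (f x) \<le> C / T\<^sup>2" using decay[of x] pq T by simp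
      qed
      also have "norm (q - p) = b - a"
      proof -
        have "q - p = complex_of_real (Re q - Re p)" using pq by (simp add: complex_eq_iff)
        then have "norm (q - p) = \<bar>Re q - Re p\<bar>" by (simp only: norm_of_real)
        then show ?thesis using pq ab by auto
      qed
      finally show ?thesis .
    qed
    have h12: "norm (contour_integral (linepath a1 a2) f) \<le> C / T\<^sup>2 * (b - a)"
      by (rule hb[OF seg(1)]) (use T ab in \<open>auto simp: a1_def a2_def\<close>)
    have h34: "norm (contour_integral (linepath a3 a4) f) \<le> C / T\<^sup>2 * (b - a)"
      by (rule hb[OF seg(3)]) (use T ab in \<open>auto simp: a3_def a4_def\<close>)
    have "\<i> * I b n - \<i> * I a n - 2 * pi * \<i> * R = - (contour_integral (linepath a1 a2) f + contour_integral (linepath a3 a4) f)"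
      using res unfolding split v23 v41 by (simp add: algebra_simps)
    then have "norm (\<i> * I b n - \<i> * I a n - 2 * pi * \<i> * R) \<le> C / T\<^sup>2 * (b - a) + C / T\<^sup>2 * (b - a)"
      using norm_triangle_le[OF add_mono[OF h12 h34]] by (simp only: norm_minus_cancel)
    then show ?thesis by (simp add: T_def)
  qed
  have "(\<lambda>n. \<i> * I b n - \<i> * I a n - 2 * pi * \<i> * R) \<longlonglongrightarrow> \<i> * (LBINT y. f (Complex b y)) - \<i> * (LBINT y. f (Complex a y)) - 2 * pi * \<i> * R"
    unfolding I_def by (intro tendsto_intros LIMSEQ_integral_symmetric i)
  moreover have "(\<lambda>n. \<i> * I b n - \<i> * I a n - 2 * pi * \<i> * R) \<longlonglongrightarrow> 0"
  proof (rule Lim_null_comparison)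
    obtain M :: nat where M: "B < real M" using reals_Archimedean2 by blast
    show "\<forall>\<^sub>F n in sequentially. norm (\<i> * I b n - \<i> * I a n - 2 * pi * \<i> * R) \<le> 2 * C * (b - a) / (real n)\<^sup>2"
      by (rule eventually_sequentiallyI[of "max 1 M"]) (rule main; use M in auto)
    show "(\<lambda>n. 2 * C * (b - a) / (real n)\<^sup>2) \<longlonglongrightarrow> 0"
      by real_asymp
  qed
  ultimately have "\<i> * (LBINT y. f (Complex b y)) - \<i> * (LBINT y. f (Complex a y)) - 2 * pi * \<i> * R = 0"
    by (rule LIMSEQ_unique)
  then have "\<i> * ((LBINT y. f (Complex b y)) - (LBINT y. f (Complex a y)) - 2 * pi * R) = 0"
    by (simp add: algebra_simps)
  then show "(LBINT y. f (Complex b y)) - (LBINT y. f (Complex a y)) = 2 * pi * (\<Sum>p\<in>pts. residue f p)"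
    unfolding R_def by simp
qed

text \<open>If zeta grows with degree p on the reflected strip, its square costs 2p powers of |Im
  s|; asking for decay of order 2p + 2 from the Gamma factor leaves the inverse square.\<close>

lemma remainder_integrand_decay:
  assumes F: "F \<in> schwartz_neg" and t: "t < 0"
  obtains C where "\<And>s. a \<le> Re s \<Longrightarrow> Re s \<le> b \<Longrightarrow> 1 \<le> \<bar>Im s\<bar> \<Longrightarrow> norm (remainder_integrand F t s) \<le> C / \<bar>Im s\<bar> ^ 2"
proof -
  obtain C1 p where C1: "C1 > 0" "\<And>s. - b \<le> Re s \<Longrightarrow> Re s \<le> - a \<Longrightarrow> norm (zeta_reg s) \<le> C1 * (1 + norm s) ^ p"
    using poly_bounded_strip_zeta_reg[of "- b" "- a"] by (rule poly_bounded_stripE) blast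
  obtain C2 where C2: "C2 > 0" "\<And>s. a \<le> Re s \<Longrightarrow> Re s \<le> b \<Longrightarrow> 1 \<le> \<bar>Im s\<bar> \<Longrightarrow> norm (Gamma (- s) * cderiv0 F s) \<le> C2 / \<bar>Im s\<bar> ^ (2 * p + 2)"
    using norm_Gamma_cderiv0_le[OF F, of a b "2 * p + 2"] by metis
  \<comment> \<open>Chosen so that 1 + |s| \<le> A |Im s| on the strip with |Im s| \<ge> 1, which
    turns growth in |s| into growth in |Im s|.\<close>
  define A where "A = \<bar>a\<bar> + \<bar>b\<bar> + 2"
  define P where "P = (- t) powr a + (- t) powr b"
  have A: "A > 0" by (simp add: A_def)
  show ?thesis
  proof (rule that[of "C2 * (C1 * A ^ p) ^ 2 * P"])
    fix s assume s: "a \<le> Re s" "Re s \<le> b" "1 \<le> \<bar>Im s\<bar>"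
    define y where "y = \<bar>Im s\<bar>"
    have y: "y \<ge> 1" using s by (simp add: y_def)
    have "1 + norm s \<le> A * y"
    proof -
      have "norm s \<le> \<bar>Re s\<bar> + y" unfolding y_def by (rule cmod_le)
      also have "\<bar>Re s\<bar> \<le> \<bar>a\<bar> + \<bar>b\<bar>" using s by linarith
      finally have "1 + norm s \<le> (\<bar>a\<bar> + \<bar>b\<bar> + 1) * 1 + y" by simp
      also have "\<dots> \<le> (\<bar>a\<bar> + \<bar>b\<bar> + 1) * y + y" using y by (intro add_mono mult_left_mono) auto
      also have "\<dots> = A * y" by (simp add: A_def algebra_simps)
      finally show ?thesis .
    qed
    then have zr: "norm (zeta_reg (- s)) \<le> C1 * (A * y) ^ p"
      using C1 s by (intro order_trans[OF C1(2)] mult_left_mono power_mono) auto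
    have ne: "- s \<noteq> 1" using s by (auto simp: complex_eq_iff)
    have "norm (riemann_zeta (- s)) \<le> norm (zeta_reg (- s))"
    proof -
      have "1 \<le> norm (- s - 1)" using abs_Im_le_cmod[of "- s - 1"] s by simp
      then have "1 * norm (riemann_zeta (- s)) \<le> norm (- s - 1) * norm (riemann_zeta (- s))" by (intro mult_right_mono) auto
      then show ?thesis using ne by (simp add: zeta_reg_def norm_mult)
    qed
    then have rz: "norm (riemann_zeta (- s)) \<le> C1 * (A * y) ^ p" using zr by simp
    \<comment> \<open>The exponents are raised by 1 to match \<open>powr_between\<close>, which is
      stated for powers u^(c - 1).\<close>
    have pw: "norm (complex_of_real (- t) powr s) \<le> P"
      using powr_between[of "- t" "a + 1" "Re s + 1" "b + 1"] s t norm_powr_real_powr[of "complex_of_real (- t)" s] by (simp add: P_def)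
    have "norm (remainder_integrand F t s) = norm (Gamma (- s) * cderiv0 F s) * norm (riemann_zeta (- s)) ^ 2 * norm (complex_of_real (- t) powr s)"
      by (simp add: remainder_integrand_def norm_mult norm_power mult_ac)
    also have "\<dots> \<le> C2 / y ^ (2 * p + 2) * (C1 * (A * y) ^ p) ^ 2 * P"
      using C2(2)[OF s] rz pw C1 C2 y A unfolding y_def[symmetric]
      by (intro mult_mono power_mono) (auto intro!: mult_nonneg_nonneg)
    also have "\<dots> = C2 * (C1 * A ^ p) ^ 2 * P / y ^ 2"
    proof -
      have "(C1 * (A * y) ^ p) ^ 2 = (C1 * A ^ p) ^ 2 * y ^ (2 * p)"
        by (simp add: power_mult_distrib power_mult mult.commute[of 2 p])
      moreover have "y ^ (2 * p + 2) = y ^ (2 * p) * y ^ 2" by (rule power_add)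
      moreover have "C2 / (Y * Z) * (K * Y) * P = C2 * K * P / Z" if "Y \<noteq> 0" for Y Z K :: real
        using that by simp
      moreover have "y ^ (2 * p) \<noteq> 0" using y by simp
      ultimately show ?thesis by presburger
    qed
    finally show "norm (remainder_integrand F t s) \<le> C2 * (C1 * A ^ p) ^ 2 * P / \<bar>Im s\<bar> ^ 2"
      by (simp add: y_def)
  qed
qed

section \<open>Poles and residues of the integrand\<close>

lemma riemann_zeta_holomorphic: "riemann_zeta holomorphic_on - {1}"
proof -
  have "(\<lambda>s. zeta_reg s / (s - 1)) holomorphic_on - {1}"
    by (intro holomorphic_intros holomorphic_on_subset[OF zeta_reg_holomorphic]) auto
  then show ?thesis by (rule holomorphic_transform) (auto simp: zeta_reg_def)
qed

lemma riemann_zeta_neg_even: "m \<ge> 1 \<Longrightarrow> riemann_zeta (- of_nat (2 * m)) = 0"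
proof -
  assume m: "m \<ge> 1"
  have ne: "- of_nat (2 * m) \<noteq> (1 :: complex)"
    by (metis Re_complex_of_real complex_Re_of_nat neg_le_0_iff_le not_one_le_zero of_nat_0_le_iff one_complex.sel(1) uminus_complex.sel(1))
  have "(- of_nat (2 * m) - 1) * riemann_zeta (- of_nat (2 * m)) = 0"
    using zeta_reg_neg_even[OF m] ne unfolding zeta_reg_def by simp
  then show ?thesis using ne by simp
qed

lemma riemann_zeta_0: "riemann_zeta 0 = - 1/2"
proof -
  have "- riemann_zeta 0 = 1/2" using zeta_reg_0 by (simp add: zeta_reg_def)
  from arg_cong[OF this, of uminus] show ?thesis by simp
qed

lemma filterlim_uminus_at: "filterlim uminus (at (- a)) (at a)" for a :: complex
proof -
  have "(uminus \<longlongrightarrow> - a) (at a)" by (intro tendsto_intros)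
  then show ?thesis by (simp add: filterlim_at eventually_at_filter)
qed

lemma tendsto_reflect:
  fixes f :: "complex \<Rightarrow> complex"
  assumes "(f \<longlongrightarrow> l) (at (- a))" shows "((\<lambda>s. f (- s)) \<longlongrightarrow> l) (at a)"
  using filterlim_compose[OF assms filterlim_uminus_at] .

text \<open>The extra minus sign, compared with the residue of Gamma at -n, comes from s - n = -(-s
  + n).\<close>

lemma Gamma_reflect_residue:
  "((\<lambda>s. Gamma (- s) * (s - of_nat n)) \<longlongrightarrow> - ((- 1) ^ n / fact n)) (at (of_nat n :: complex))"
proof -
  have "((\<lambda>s. - (Gamma (- s) * (- s + of_nat n))) \<longlongrightarrow> - ((- 1) ^ n / fact n)) (at (of_nat n :: complex))"
    by (intro tendsto_minus tendsto_reflect Gamma_residues)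
  then show ?thesis by (simp add: algebra_simps)
qed

text \<open>A uniform list of candidates: the point -1, from the double pole of the squared zeta,
  and every pole of Gamma(-s) left of 2N. The positive even points are listed too; their residues
  turn out to be 0.\<close>

definition remainder_poles :: "nat \<Rightarrow> complex set" where
  "remainder_poles N = insert (- 1) (of_nat ` {..<2 * N})"

text \<open>At \<open>2N\<close> the simple pole of the Gamma factor meets a double zero, so the continuous extension has
  the value \<open>0\<close>, which is also what \<open>Gamma (- 2N) = 0\<close> yields.\<close>

lemma remainder_integrand_holomorphic:
  assumes F: "F \<in> schwartz_neg" and t: "t < 0" and N: "N \<ge> 1"
  shows "remainder_integrand F t holomorphic_on {s. Re s < 2 * real N + 1} - remainder_poles N"
proof -
  define z where "z = complex_of_nat (2 * N)"
  let ?S = "{s. Re s < 2 * real N + 1}"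
  have fin: "finite (remainder_poles N)" by (simp add: remainder_poles_def)
  have op: "open (?S - remainder_poles N)"
    by (intro open_Diff open_halfspace_Re_lt finite_imp_closed fin)
  have ni: "- s \<notin> \<int>\<^sub>\<le>\<^sub>0" if s: "s \<in> ?S - remainder_poles N - {z}" for s
  proof
    assume "- s \<in> \<int>\<^sub>\<le>\<^sub>0"
    then obtain k where "- s = - of_nat k" by (rule nonpos_Ints_cases')
    then have k: "s = of_nat k" by simp
    then have "real k < 2 * real N + 1" using s by simp
    then have "k < 2 * N \<or> k = 2 * N" by linarith
    then show False using s k by (auto simp: remainder_poles_def z_def)
  qed
  have 1: "remainder_integrand F t holomorphic_on (?S - remainder_poles N) - {z}"
    unfolding remainder_integrand_def
  proof (intro holomorphic_on_mult holomorphic_on_power)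
    show "(\<lambda>s. Gamma (- s)) holomorphic_on (?S - remainder_poles N) - {z}"
      by (rule holomorphic_on_compose_gen[OF _ holomorphic_Gamma[of "- \<int>\<^sub>\<le>\<^sub>0"], unfolded o_def])
         (use ni in \<open>auto intro!: holomorphic_intros\<close>)
    show "(\<lambda>s. riemann_zeta (- s)) holomorphic_on (?S - remainder_poles N) - {z}"
      by (rule holomorphic_on_compose_gen[OF _ riemann_zeta_holomorphic, unfolded o_def])
         (auto intro!: holomorphic_intros simp: remainder_poles_def minus_equation_iff[of _ 1])
    show "cderiv0 F holomorphic_on (?S - remainder_poles N) - {z}"
      by (rule holomorphic_on_subset[OF cderiv0_holomorphic[OF F]]) simp
    show "(\<lambda>s. complex_of_real (- t) powr s) holomorphic_on (?S - remainder_poles N) - {z}"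
      by (intro holomorphic_intros)
  qed
  have z1: "- z \<noteq> 1"
    unfolding z_def by (metis Re_complex_of_real complex_Re_of_nat neg_le_0_iff_le not_one_le_zero of_nat_0_le_iff one_complex.sel(1) uminus_complex.sel(1))
  have rz0: "riemann_zeta (- z) = 0" unfolding z_def by (rule riemann_zeta_neg_even[OF N])
  have rz_der: "(riemann_zeta has_field_derivative deriv riemann_zeta (- z)) (at (- z))"
    by (rule holomorphic_derivI[OF riemann_zeta_holomorphic]) (use z1 in auto)
  have rz_lim: "((\<lambda>s. riemann_zeta (- s)) \<longlongrightarrow> 0) (at z)"
    using tendsto_reflect[of riemann_zeta 0 z] DERIV_isCont[OF rz_der] rz0 by (simp add: isCont_def)
  have "((\<lambda>w. riemann_zeta w / (w + z)) \<longlongrightarrow> deriv riemann_zeta (- z)) (at (- z))"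
    using rz_der rz0 by (simp add: has_field_derivative_iff)
  from tendsto_reflect[OF this]
  have quot: "((\<lambda>s. riemann_zeta (- s) / (- s + z)) \<longlongrightarrow> deriv riemann_zeta (- z)) (at z)" .
  have cd: "(cderiv0 F \<longlongrightarrow> cderiv0 F z) (at z)"
    using cderiv0_holomorphic[OF F] holomorphic_on_imp_continuous_on continuous_on_eq_continuous_at isCont_def by (metis UNIV_I open_UNIV)
  have pw: "((\<lambda>s. complex_of_real (- t) powr s) \<longlongrightarrow> complex_of_real (- t) powr z) (at z)"
    using t by (intro tendsto_intros) auto
  \<comment> \<open>The pole is paired with s - z, one zeta factor becomes a difference quotient
    with a finite limit, and the other zeta factor tends to 0.\<close>
  have "((\<lambda>s. (Gamma (- s) * (s - z)) * (- (riemann_zeta (- s) / (- s + z))) * riemann_zeta (- s) * cderiv0 F s * complex_of_real (- t) powr s)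
      \<longlongrightarrow> - ((- 1) ^ (2 * N) / fact (2 * N)) * (- deriv riemann_zeta (- z)) * 0 * cderiv0 F z * complex_of_real (- t) powr z) (at z)"
    unfolding z_def by (intro tendsto_mult tendsto_minus Gamma_reflect_residue quot[unfolded z_def] rz_lim[unfolded z_def] cd[unfolded z_def] pw[unfolded z_def])
  then have "((\<lambda>s. (Gamma (- s) * (s - z)) * (- (riemann_zeta (- s) / (- s + z))) * riemann_zeta (- s) * cderiv0 F s * complex_of_real (- t) powr s)
      \<longlongrightarrow> 0) (at z)" by simp
  then have "(remainder_integrand F t \<longlongrightarrow> 0) (at z)"
  proof (rule Lim_transform_eventually)
    show "\<forall>\<^sub>F s in at z. (Gamma (- s) * (s - z)) * (- (riemann_zeta (- s) / (- s + z))) * riemann_zeta (- s) * cderiv0 F s * complex_of_real (- t) powr s = remainder_integrand F t s"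
      unfolding eventually_at_filter
    proof (intro always_eventually allI impI)
      fix s assume "s \<noteq> z"
      then have "(s - z) * (- (riemann_zeta (- s) / (- s + z))) = riemann_zeta (- s)"
        by (simp add: field_simps)
      then have "(Gamma (- s) * (s - z)) * (- (riemann_zeta (- s) / (- s + z))) = Gamma (- s) * riemann_zeta (- s)"
        by (simp only: mult.assoc)
      then show "(Gamma (- s) * (s - z)) * (- (riemann_zeta (- s) / (- s + z))) * riemann_zeta (- s) * cderiv0 F s * complex_of_real (- t) powr s = remainder_integrand F t s"
        unfolding remainder_integrand_def power2_eq_square by (simp only: mult.assoc)
    qed
  qed
  moreover have "remainder_integrand F t z = 0"
    using rz0 by (simp add: remainder_integrand_def)
  ultimately have "(remainder_integrand F t \<longlongrightarrow> remainder_integrand F t z) (at z within ?S - remainder_poles N)"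
    by (metis tendsto_within_subset subset_UNIV)
  then show ?thesis
    by (intro no_isolated_singularity'[OF _ 1 op]) auto
qed

text \<open>The signs (-1)^n from the Gamma residue and from (-t)^n cancel, leaving t^n and an
  overall minus.\<close>

lemma remainder_integrand_residue_of_nat:
  assumes F: "F \<in> schwartz_neg" and t: "t < 0" and N: "N \<ge> 1" and n: "n < 2 * N"
  shows "residue (remainder_integrand F t) (of_nat n)
    = - (riemann_zeta (- of_nat n) ^ 2 / fact n * complex_of_real t ^ n * nderiv_neg n F 0)"
proof -
  define z where "z = complex_of_nat n"
  let ?S = "{s. Re s < 2 * real N + 1}"
  have fin: "finite (remainder_poles N)" by (simp add: remainder_poles_def)
  have z1: "- z \<noteq> 1"
    unfolding z_def by (metis Re_complex_of_real complex_Re_of_nat neg_le_0_iff_le not_one_le_zero of_nat_0_le_iff one_complex.sel(1) uminus_complex.sel(1))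
  have "residue (remainder_integrand F t) z = - ((- 1) ^ n / fact n) * riemann_zeta (- z) ^ 2 * cderiv0 F z * complex_of_real (- t) powr z"
  proof (rule residue_simple'[of "?S - (remainder_poles N - {z})"])
    show "open (?S - (remainder_poles N - {z}))"
      by (intro open_Diff open_halfspace_Re_lt finite_imp_closed finite_Diff fin)
    show "z \<in> ?S - (remainder_poles N - {z})" using n by (auto simp: z_def)
    show "remainder_integrand F t holomorphic_on ?S - (remainder_poles N - {z}) - {z}"
      by (rule holomorphic_on_subset[OF remainder_integrand_holomorphic[OF F t N]]) auto
    have "isCont riemann_zeta (- z)"
      using DERIV_isCont[OF holomorphic_derivI[OF riemann_zeta_holomorphic]] z1 by auto
    then have rz: "((\<lambda>s. riemann_zeta (- s)) \<longlongrightarrow> riemann_zeta (- z)) (at z)"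
      by (intro tendsto_reflect) (simp add: isCont_def)
    have cd: "(cderiv0 F \<longlongrightarrow> cderiv0 F z) (at z)"
      using cderiv0_holomorphic[OF F] holomorphic_on_imp_continuous_on continuous_on_eq_continuous_at isCont_def by (metis UNIV_I open_UNIV)
    have pw: "((\<lambda>s. complex_of_real (- t) powr s) \<longlongrightarrow> complex_of_real (- t) powr z) (at z)"
      using t by (intro tendsto_intros) auto
    have "((\<lambda>w. (Gamma (- w) * (w - z)) * riemann_zeta (- w) ^ 2 * cderiv0 F w * complex_of_real (- t) powr w)
       \<longlongrightarrow> - ((- 1) ^ n / fact n) * riemann_zeta (- z) ^ 2 * cderiv0 F z * complex_of_real (- t) powr z) (at z)"
      by (intro tendsto_mult tendsto_power rz cd pw) (unfold z_def, rule Gamma_reflect_residue)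
    then show "((\<lambda>w. remainder_integrand F t w * (w - z))
       \<longlongrightarrow> - ((- 1) ^ n / fact n) * riemann_zeta (- z) ^ 2 * cderiv0 F z * complex_of_real (- t) powr z) (at z)"
      unfolding remainder_integrand_def by (simp only: mult_ac)
  qed
  also have "cderiv0 F z = nderiv_neg n F 0" unfolding z_def by (rule cderiv0_of_nat[OF F])
  also have "complex_of_real (- t) powr z = (- 1) ^ n * complex_of_real t ^ n"
  proof -
    have "complex_of_real (- t) powr z = complex_of_real (- t) ^ n"
      unfolding z_def using t by (intro powr_nat') auto
    also have "\<dots> = (- 1) ^ n * complex_of_real t ^ n"
      unfolding of_real_minus by (rule power_minus)
    finally show ?thesis .
  qed
  also have "- ((- 1) ^ n / fact n) * riemann_zeta (- z) ^ 2 * nderiv_neg n F 0 * ((- 1) ^ n * complex_of_real t ^ n)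
     = - (((- 1) ^ n * (- 1) ^ n) * (riemann_zeta (- z) ^ 2 / fact n * complex_of_real t ^ n * nderiv_neg n F 0))"
    by simp
  also have "(- 1) ^ n * (- 1) ^ n = (1 :: complex)"
    by (simp flip: power_mult_distrib)
  finally show ?thesis by (simp add: z_def)
qed

text \<open>At a double pole the residue is a derivative, here of a product of three factors: the
  Mellin transform yields ln u, the squared \<open>zeta_reg\<close> yields 2 \<gamma>, and the power
  of -t yields -ln(-t).\<close>

lemma remainder_integrand_residue_minus_1:
  assumes F: "F \<in> schwartz_neg" and t: "t < 0"
  shows "set_integrable lborel {0<..} (\<lambda>u. F (- u) * complex_of_real (ln (u / (- t)) + 2 * euler_mascheroni))"
    and "residue (remainder_integrand F t) (- 1) = 1 / complex_of_real t *
        (LBINT u:{0<..}. F (- u) * complex_of_real (ln (u / (- t)) + 2 * euler_mascheroni))"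
proof -
  define f where "f = (\<lambda>u. F (- u))"
  define c where "c = - t"
  define k where "k = complex_of_real (2 * euler_mascheroni - ln c)"
  have c: "c > 0" using t by (simp add: c_def)
  have f: "rapid f" using rapid_nderiv_neg[OF F, of 0] by (simp add: f_def)
  have i1: "set_integrable lborel {0<..} (\<lambda>u. complex_of_real u powr (1 - 1) * f u)"
    by (rule set_integrable_mellin[OF f]) simp
  have i2: "set_integrable lborel {0<..} (\<lambda>u. complex_of_real (ln u) * (complex_of_real u powr (1 - 1) * f u))"
    by (rule set_integrable_mellin_ln[OF f]) simp
  have eq: "F (- u) * complex_of_real (ln (u / (- t)) + 2 * euler_mascheroni)
     = complex_of_real (ln u) * (complex_of_real u powr (1 - 1) * f u) + k * (complex_of_real u powr (1 - 1) * f u)" if "u > 0" for u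
  proof -
    have "ln (u / c) = ln u - ln c" using that c by (intro ln_divide_pos)
    then have l: "ln (u / (- t)) = ln u - ln c" unfolding c_def .
    show ?thesis unfolding l using that by (simp add: f_def k_def algebra_simps)
  qed
  have i: "set_integrable lborel {0<..} (\<lambda>u. complex_of_real (ln u) * (complex_of_real u powr (1 - 1) * f u) + k * (complex_of_real u powr (1 - 1) * f u))"
    by (rule set_integral_add(1)[OF i2 set_integrable_mult_right]) (rule i1)
  then show "set_integrable lborel {0<..} (\<lambda>u. F (- u) * complex_of_real (ln (u / (- t)) + 2 * euler_mascheroni))"
    by (rule set_integrable_cong[THEN iffD1, rotated -1]) (simp_all only: eq greaterThan_iff)
  have I: "(LBINT u:{0<..}. F (- u) * complex_of_real (ln (u / (- t)) + 2 * euler_mascheroni)) = mellin_ln f 1 + k * mellin f 1"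
  proof -
    have "(LBINT u:{0<..}. F (- u) * complex_of_real (ln (u / (- t)) + 2 * euler_mascheroni))
      = (LBINT u:{0<..}. complex_of_real (ln u) * (complex_of_real u powr (1 - 1) * f u) + k * (complex_of_real u powr (1 - 1) * f u))"
      by (intro set_lebesgue_integral_cong allI impI eq) auto
    also have "\<dots> = (LBINT u:{0<..}. complex_of_real (ln u) * (complex_of_real u powr (1 - 1) * f u)) + (LBINT u:{0<..}. k * (complex_of_real u powr (1 - 1) * f u))"
      by (rule set_integral_add(2)[OF i2 set_integrable_mult_right]) (rule i1)
    also have "\<dots> = mellin_ln f 1 + k * mellin f 1"
      unfolding mellin_def mellin_ln_def set_integral_mult_right ..
    finally show ?thesis .
  qed
  \<comment> \<open>The numerator over (w + 1)^2. Replacing zeta by \<open>zeta_reg\<close> puts the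
    double pole into the denominator, so q is holomorphic near -1.\<close>
  define q where "q = (\<lambda>w. mellin f (- w) * zeta_reg (- w) ^ 2 * complex_of_real c powr w)"
  have q_hol: "q holomorphic_on {w. Re w < 0}"
  proof -
    have "(\<lambda>w. mellin f (- w)) holomorphic_on {w. Re w < 0}"
      by (rule holomorphic_on_compose_gen[OF _ mellin_holomorphic[OF f], unfolded o_def]) (auto intro!: holomorphic_intros)
    moreover have "(\<lambda>w. zeta_reg (- w)) holomorphic_on {w. Re w < 0}"
      by (rule holomorphic_on_compose_gen[OF _ zeta_reg_holomorphic, unfolded o_def]) (auto intro!: holomorphic_intros)
    ultimately show ?thesis unfolding q_def by (intro holomorphic_intros)
  qed
  have "residue (remainder_integrand F t) (- 1) = residue (\<lambda>w. q w / (w - (- 1)) ^ Suc 1) (- 1)"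
  proof (rule residue_cong)
    have "\<forall>\<^sub>F w in at (- 1). Re w < 0"
      by (rule eventually_at_in_open'[of "{w. Re w < 0}", simplified]) (auto simp: open_halfspace_Re_lt)
    moreover have "\<forall>\<^sub>F w in at (- 1 :: complex). w \<noteq> - 1" by (simp add: eventually_at_filter)
    ultimately show "\<forall>\<^sub>F w in at (- 1). remainder_integrand F t w = q w / (w - (- 1)) ^ Suc 1"
    proof eventually_elim
      case (elim w)
      have "- w \<noteq> 1" using elim(2) by (metis minus_minus)
      define x where "x = w - (- 1)"
      have "- w - 1 = - x" by (simp add: x_def)
      then have "zeta_reg (- w) = - x * riemann_zeta (- w)" using \<open>- w \<noteq> 1\<close> by (simp only: zeta_reg_def if_False)
      then have "zeta_reg (- w) ^ 2 = x ^ Suc 1 * riemann_zeta (- w) ^ 2"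
        by (simp add: power2_eq_square)
      moreover have "x \<noteq> 0" using elim(2) by (simp add: x_def add_eq_0_iff2)
      ultimately have "riemann_zeta (- w) ^ 2 = zeta_reg (- w) ^ 2 / (w - (- 1)) ^ Suc 1"
        unfolding x_def[symmetric] by (metis nonzero_mult_div_cancel_left power_not_zero)
      moreover have "Gamma (- w) * cderiv0 F w = mellin f (- w)"
        unfolding f_def by (rule Gamma_cderiv0[OF F elim(1)])
      moreover have "remainder_integrand F t w = (Gamma (- w) * cderiv0 F w) * riemann_zeta (- w) ^ 2 * complex_of_real c powr w"
        unfolding remainder_integrand_def c_def by (simp only: mult_ac)
      ultimately show ?case by (simp add: q_def)
    qed
  qed simp
  also have "\<dots> = deriv q (- 1)"
    using residue_holomorphic_over_power[of "{w. Re w < 0}" "-1" q 1] q_hol by (simp add: open_halfspace_Re_lt)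
  also have "deriv q (- 1) = - (mellin_ln f 1 + k * mellin f 1) / c"
  proof (rule DERIV_imp_deriv)
    have um: "(uminus has_field_derivative - 1) (at (- 1 :: complex))"
      by (auto intro!: derivative_eq_intros)
    have d1: "((\<lambda>w. mellin f (- w)) has_field_derivative - mellin_ln f 1) (at (- 1))"
      using DERIV_chain2[OF _ um, of "mellin f" "mellin_ln f 1"] mellin_has_field_derivative[OF f, of 1] by simp
    have d2: "((\<lambda>w. zeta_reg (- w)) has_field_derivative - euler_mascheroni) (at (- 1))"
      using DERIV_chain2[OF _ um, of zeta_reg euler_mascheroni] deriv_zeta_reg_1 by simp
    have d3: "((\<lambda>w. complex_of_real c powr w) has_field_derivative complex_of_real (ln c) * (1 / complex_of_real c)) (at (- 1))"
    proof -
      have "complex_of_real c powr (- 1) = 1 / complex_of_real c" using c by (simp add: powr_minus_divide)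
      then show ?thesis
        using c by (auto intro!: derivative_eq_intros simp: powr_def Ln_of_real)
    qed
    have cp: "complex_of_real c powr (- 1) = 1 / complex_of_real c" using c by (simp add: powr_minus_divide)
    have D: "(q has_field_derivative
        ((- mellin_ln f 1 * zeta_reg 1 ^ 2 + of_nat 2 * (- euler_mascheroni * zeta_reg 1 ^ (2 - 1)) * mellin f 1) * (complex_of_real c powr (- 1))
         + complex_of_real (ln c) * (1 / complex_of_real c) * (mellin f 1 * zeta_reg 1 ^ 2))) (at (- 1))"
      unfolding q_def
      using DERIV_mult[OF DERIV_mult[OF d1 DERIV_power[OF d2, of 2]] d3] by simp
    show "(q has_field_derivative - (mellin_ln f 1 + k * mellin f 1) / c) (at (- 1))"
      by (rule DERIV_cong[OF D]) (use c in \<open>simp add: zeta_reg_1 cp k_def field_simps\<close>)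
  qed
  also have "\<dots> = 1 / complex_of_real t * (mellin_ln f 1 + k * mellin f 1)"
  proof -
    have "- X / complex_of_real c = 1 / complex_of_real t * X" for X by (simp add: c_def)
    then show ?thesis .
  qed
  finally show "residue (remainder_integrand F t) (- 1) = 1 / complex_of_real t *
        (LBINT u:{0<..}. F (- u) * complex_of_real (ln (u / (- t)) + 2 * euler_mascheroni))"
    unfolding I .
qed

text \<open>The form in which the trivial zeros enter: among the indices below 2N only 0 and the odd
  ones up to 2N - 1 contribute.\<close>

lemma sum_double_odd:
  fixes g :: "nat \<Rightarrow> complex"
  assumes "N \<ge> 1" and g: "\<And>m. m \<ge> 1 \<Longrightarrow> g (2 * m) = 0"
  shows "(\<Sum>n<2 * N. g n) = g 0 + (\<Sum>m=1..N. g (2 * m - 1))"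
  using assms(1)
proof (induction N rule: nat_induct_at_least)
  case base
  have "{..<2 * 1} = {0, 1 :: nat}" by auto
  then show ?case by simp
next
  case (Suc n)
  then show ?case using g[of n] by simp
qed

theorem mainTheorem4:
  fixes F :: "real \<Rightarrow> complex" and N :: nat and t :: real
  assumes "F \<in> schwartz_neg" and "N \<ge> 1" and "t < 0"
  shows "set_integrable lborel {0<..}
           (\<lambda>u. F (- u) * complex_of_real (ln (u / (- t)) + 2 * euler_mascheroni))
         \<and> vline_integrable (2 * real N) (remainder_integrand F t)
         \<and> (\<lambda>n. of_nat (divisor_count (Suc n)) * F (real (Suc n) * t)) sums
           (- (1 / complex_of_real t) *
              (LBINT u:{0<..}. F (- u) * complex_of_real (ln (u / (- t)) + 2 * euler_mascheroni))
            + F 0 / 4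
            + (\<Sum>n=1..N. riemann_zeta (- 2 * of_nat n + 1) ^ 2 / fact (2 * n - 1)
                 * complex_of_real t ^ (2 * n - 1) * nderiv_neg (2 * n - 1) F 0)
            + 1 / (2 * \<i> * complex_of_real pi)
                * vline_integral (2 * real N) (remainder_integrand F t))"
proof -
  note F = assms(1) and N = assms(2) and t = assms(3)
  let ?f = "remainder_integrand F t"
  define J where "J = (LBINT u:{0<..}. F (- u) * complex_of_real (ln (u / (- t)) + 2 * euler_mascheroni))"
  define g where "g = (\<lambda>n. riemann_zeta (- of_nat n) ^ 2 / fact n * complex_of_real t ^ n * nderiv_neg n F 0)"
  define I where "I = (\<lambda>c. LBINT y. ?f (Complex c y))"
  obtain C where C: "\<And>s. - 2 \<le> Re s \<Longrightarrow> Re s \<le> 2 * real N \<Longrightarrow> 1 \<le> \<bar>Im s\<bar> \<Longrightarrow> norm (?f s) \<le> C / \<bar>Im s\<bar> ^ 2"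
    using remainder_integrand_decay[OF F t] by metis
  have fin: "finite (remainder_poles N)" by (simp add: remainder_poles_def)
  have poles: "- 2 < Re p \<and> Re p < 2 * real N" if p: "p \<in> remainder_poles N" for p
  proof -
    consider "p = - 1" | n where "p = of_nat n" "n < 2 * N" using p by (auto simp: remainder_poles_def)
    then show ?thesis
    proof cases
      case 1
      then show ?thesis using N by simp
    next
      case (2 n)
      have "real n < real (2 * N)" using 2(2) by (simp only: of_nat_less_iff)
      then show ?thesis using 2(1) by simp
    qed
  qed
  have sub: "{s. - 2 \<le> Re s \<and> Re s \<le> 2 * real N} \<subseteq> {s. Re s < 2 * real N + 1}" by auto
  have con: "connected {s. Re s < 2 * real N + 1}"
    by (intro convex_connected convex_halfspace_Re_lt)
  note shift = vline_shift_residues[of "- 2" "2 * real N", OF _ open_halfspace_Re_lt con fin poles sub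
      remainder_integrand_holomorphic[OF F t N] C]
  have int: "integrable lborel (\<lambda>y. ?f (Complex (2 * real N) y))" using shift(2) by simp
  have "I (2 * real N) - I (- 2) = 2 * pi * (\<Sum>p\<in>remainder_poles N. residue ?f p)"
    unfolding I_def using shift(3) by simp
  also have "(\<Sum>p\<in>remainder_poles N. residue ?f p) = 1 / complex_of_real t * J - (g 0 + (\<Sum>m=1..N. g (2 * m - 1)))"
  proof -
    have ni: "- 1 \<notin> complex_of_nat ` {..<2 * N}"
      by (auto simp: complex_eq_iff)
    have "(\<Sum>p\<in>remainder_poles N. residue ?f p) = residue ?f (- 1) + (\<Sum>p\<in>complex_of_nat ` {..<2 * N}. residue ?f p)"
      unfolding remainder_poles_def using ni by (intro sum.insert) auto
    also have "(\<Sum>p\<in>complex_of_nat ` {..<2 * N}. residue ?f p) = (\<Sum>n<2 * N. residue ?f (of_nat n))"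
      by (subst sum.reindex) (auto simp: inj_on_def)
    also have "\<dots> = (\<Sum>n<2 * N. - g n)"
      by (rule sum.cong) (auto simp: g_def remainder_integrand_residue_of_nat[OF F t N] simp del: nderiv_neg.simps)
    also have "\<dots> = - (\<Sum>n<2 * N. g n)" by (rule sum_negf)
    also have "(\<Sum>n<2 * N. g n) = g 0 + (\<Sum>m=1..N. g (2 * m - 1))"
      by (rule sum_double_odd[OF N]) (simp only: g_def riemann_zeta_neg_even, simp)
    also have "residue ?f (- 1) = 1 / complex_of_real t * J"
      unfolding J_def by (rule remainder_integrand_residue_minus_1(2)[OF F t])
    finally show ?thesis by simp
  qed
  \<comment> \<open>Solving for the integral on the left line reverses the sign of every residue,
    which gives -1/t before the logarithmic integral and plus signs before the derivatives.\<close>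
  finally have "1 / (2 * pi) * I (- 2) = - (1 / complex_of_real t) * J + g 0 + (\<Sum>m=1..N. g (2 * m - 1)) + 1 / (2 * pi) * I (2 * real N)"
    by (simp add: field_simps)
  \<comment> \<open>The value -1/2 of zeta at 0, squared.\<close>
  also have "g 0 = F 0 / 4"
    by (simp add: g_def riemann_zeta_0 power2_eq_square)
  also have "(\<Sum>m=1..N. g (2 * m - 1)) = (\<Sum>n=1..N. riemann_zeta (- 2 * of_nat n + 1) ^ 2 / fact (2 * n - 1)
                 * complex_of_real t ^ (2 * n - 1) * nderiv_neg (2 * n - 1) F 0)"
  proof (rule sum.cong[OF refl])
    fix n assume "n \<in> {1..N}"
    then have "- complex_of_nat (2 * n - 1) = - 2 * of_nat n + 1" by (simp add: of_nat_diff)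
    then show "g (2 * n - 1) = riemann_zeta (- 2 * of_nat n + 1) ^ 2 / fact (2 * n - 1)
                 * complex_of_real t ^ (2 * n - 1) * nderiv_neg (2 * n - 1) F 0"
      by (simp only: g_def)
  qed
  \<comment> \<open>The factor i that \<open>vline_integral\<close> includes for ds = i dy cancels
    against the i in the prefactor.\<close>
  also have "1 / (2 * pi) * I (2 * real N) = 1 / (2 * \<i> * complex_of_real pi) * vline_integral (2 * real N) ?f"
    by (simp add: vline_integral_def I_def field_simps)
  finally have "1 / (2 * pi) * I (- 2) = - (1 / complex_of_real t) * J + F 0 / 4
            + (\<Sum>n=1..N. riemann_zeta (- 2 * of_nat n + 1) ^ 2 / fact (2 * n - 1)
                 * complex_of_real t ^ (2 * n - 1) * nderiv_neg (2 * n - 1) F 0)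
            + 1 / (2 * \<i> * complex_of_real pi) * vline_integral (2 * real N) ?f" .
  with divisor_sum_eq_vline[OF F t] remainder_integrand_residue_minus_1(1)[OF F t] int
  show ?thesis unfolding I_def J_def vline_integrable_def by simp
qed

end
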